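(* Let $N\ge2$ and fix a finite generating set of $\mathrm{SL}(N,\mathbb{Z})$. Consider all words of length $L$ in the generators, each counted equally. Then the proportion of such words whose product has characteristic polynomial with Galois group (over $\mathbb{Q}$) equal to the full symmetric group $S_N$ tends to $1$ as $L\to\infty$. *)

theory Defs
  imports "Jordan_Normal_Form.Char_Poly" "HOL-Computational_Algebra.Polynomial"
begin

definition SL_int :: "nat \<Rightarrow> int mat set" where
  "SL_int N = {A. A \<in> carrier_mat N N \<and> det A = 1}"

definition sym_gens :: "nat \<Rightarrow> int mat set \<Rightarrow> int mat set" where
  "sym_gens N S = S \<union> {B. B \<in> carrier_mat N N \<and> (\<exists>A\<in>S. A * B = 1\<^sub>m N)}"

definition word_prod :: "nat \<Rightarrow> int mat list \<Rightarrow> int mat" where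
  "word_prod N ws = foldr (\<lambda>A B. A * B) ws (1\<^sub>m N)"

definition words :: "'a set \<Rightarrow> nat \<Rightarrow> 'a list set" where
  "words T L = {ws. set ws \<subseteq> T \<and> length ws = L}"

definition generates_SL :: "nat \<Rightarrow> int mat set \<Rightarrow> bool" where
  "generates_SL N S \<longleftrightarrow> S \<subseteq> SL_int N \<and>
     SL_int N = {word_prod N ws | ws. set ws \<subseteq> sym_gens N S}"

definition complex_roots :: "int poly \<Rightarrow> complex set" where
  "complex_roots p = {z. poly (of_int_poly p) z = 0}"

definition is_subfield :: "complex set \<Rightarrow> bool" where
  "is_subfield K \<longleftrightarrow> 0 \<in> K \<and> 1 \<in> K \<and>
     (\<forall>x\<in>K. \<forall>y\<in>K. x + y \<in> K \<and> x - y \<in> K \<and> x * y \<in> K) \<and>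
     (\<forall>x\<in>K. x \<noteq> 0 \<longrightarrow> inverse x \<in> K)"

definition gen_subfield :: "complex set \<Rightarrow> complex set" where
  "gen_subfield R = \<Inter>{K. R \<subseteq> K \<and> is_subfield K}"

definition field_aut_on :: "complex set \<Rightarrow> (complex \<Rightarrow> complex) \<Rightarrow> bool" where
  "field_aut_on K \<phi> \<longleftrightarrow> bij_betw \<phi> K K \<and>
     (\<forall>x\<in>K. \<forall>y\<in>K. \<phi> (x + y) = \<phi> x + \<phi> y \<and> \<phi> (x * y) = \<phi> x * \<phi> y)"

text \<open>The Galois group over Q of p, viewed as a group of permutations of the complex roots
  of p: restrictions of the automorphisms of the splitting field Q(roots).\<close>
definition galois_perms :: "int poly \<Rightarrow> (complex \<Rightarrow> complex) set" where
  "galois_perms p = {\<sigma>. \<exists>\<phi>. field_aut_on (gen_subfield (complex_roots p)) \<phi> \<and>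
       (\<forall>z\<in>complex_roots p. \<sigma> z = \<phi> z) \<and> (\<forall>z. z \<notin> complex_roots p \<longrightarrow> \<sigma> z = z)}"

definition galois_full_symmetric :: "int poly \<Rightarrow> bool" where
  "galois_full_symmetric p \<longleftrightarrow> p \<noteq> 0 \<and> card (complex_roots p) = degree p \<and>
     {\<sigma>. \<sigma> permutes complex_roots p} = galois_perms p"

end

theory Submission
  imports Defs "HOL-Number_Theory.Number_Theory" "HOL-Combinatorics.Permutations" "HOL-Library.FuncSet"
begin

text \<open>Modulo an odd \<open>m\<close> the walk on \<open>SL(N, \<int>/m)\<close> equidistributes, since every matrix is a product of
  evenly many generators. For \<open>m\<close> a product of primes the reductions modulo the primes are independent
  in the limit, and each prime shows a prescribed factorization pattern of the characteristic
  polynomial with probability bounded below, because each polynomial with constant coefficient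
  \<open>(-1)^N\<close> is attained by a fraction of about \<open>l^(1-N)\<close> of \<open>SL(N, \<int>/l)\<close>. With many primes, two patterns
  occur almost surely: \<open>(N-1) + 1\<close>, and \<open>2 + 1 + \<dots> + 1\<close> without roots \<open>1\<close>, \<open>-1\<close>. Frobenius elements then
  give an \<open>(N-1)\<close>-cycle and a transposition in the Galois group. A fixed point of the group would be
  a rational root, that is \<open>1\<close> or \<open>-1\<close>, which the second pattern excludes; so the group is doubly
  transitive, contains all transpositions, and is the full symmetric group.

  Finite fields are replaced by the algebraic integers modulo a prime ideal \<open>P\<close> above \<open>l\<close>, in which
  roots of unity of order prime to \<open>l\<close> remain distinct and represent the elements of the extensions
  of the prime field.\<close>

section \<open>Algebraic integers and prime ideals\<close>

text \<open>The order of choices carries the limit: the tolerance fixes the number of primes, the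
  primes fix the modulus, and only then does the word length grow. Convergence on one finite group
  at a time therefore suffices, at a rate that may depend on the modulus. What has to be uniform is
  the share of each pattern. A pattern is given by lists of exponents of roots of unity; with one
  relation imposed by the determinant there are of the order of l^(N-1) such lists, and at most N^N
  of them give the same polynomial. This matches the size l^(1-N) of a single class, so the share is
  at least a constant \<open>density N\<close> that does not depend on l. All work with the Galois
  group is done on indices of roots. Power sums show that invariants of this index group are
  rational, hence integers, and this is what makes Frobenius elements available; automorphisms of
  the splitting field enter only to reach the final formulation. For N = 2 the transposition alone
  is the full group, so the pattern (N-1) + 1 is asked for from N = 3 on.\<close>

hide_const (open) up_ring.coeff up_ring.monom

lemma algebraic_int_eigenvalue:
  fixes M :: "int mat" and x :: complex
  assumes M: "M \<in> carrier_mat n n" and ev: "eigenvalue (map_mat of_int M) x"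
  shows "algebraic_int x"
proof -
  have "poly (char_poly (map_mat of_int M)) x = 0"
    using eigenvalue_root_char_poly[of "map_mat of_int M :: complex mat" n x] M ev by auto
  moreover have "char_poly (map_mat of_int M :: complex mat) = map_poly of_int (char_poly M)"
    using of_int_hom.char_poly_hom[OF M] by simp
  moreover have "lead_coeff (char_poly M) = 1"
    using degree_monic_char_poly[OF M] by auto
  ultimately show ?thesis
    unfolding algebraic_int_altdef_ipoly by auto
qed

definition zspan :: "('i \<Rightarrow> complex) \<Rightarrow> 'i set \<Rightarrow> complex set" where
  "zspan f I = {\<Sum>i\<in>I. of_int (c i) * f i | c. True}"

lemma zspan_0: "0 \<in> zspan f I"
  unfolding zspan_def by (rule CollectI, rule exI[of _ "\<lambda>_. 0"]) auto

lemma zspan_add: "x \<in> zspan f I \<Longrightarrow> y \<in> zspan f I \<Longrightarrow> x + y \<in> zspan f I"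
  unfolding zspan_def
  by clarify (rule_tac x = "\<lambda>i. c i + ca i" in exI, auto simp: sum.distrib algebra_simps)

lemma zspan_scale: "x \<in> zspan f I \<Longrightarrow> of_int a * x \<in> zspan f I"
  unfolding zspan_def
  by clarify (rule_tac x = "\<lambda>i. a * c i" in exI, auto simp: sum_distrib_left algebra_simps)

lemma zspan_sum: "(\<And>j. j \<in> J \<Longrightarrow> g j \<in> zspan f I) \<Longrightarrow> sum g J \<in> zspan f I"
  by (induction J rule: infinite_finite_induct) (auto simp: zspan_0 zspan_add)

lemma zspan_base:
  assumes "finite I" "i \<in> I"
  shows "f i \<in> zspan f I"
proof -
  have "(\<Sum>j\<in>I. of_int (if j = i then 1 else 0) * f j) = (\<Sum>j\<in>I. if j = i then f j else 0)"
    by (rule sum.cong) auto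
  also have "\<dots> = f i" using assms by simp
  finally show ?thesis unfolding zspan_def by (intro CollectI exI[of _ "\<lambda>j. if j = i then 1 else 0"]) simp
qed

lemma zspan_mult_closed:
  assumes "\<And>i. i \<in> I \<Longrightarrow> x * f i \<in> zspan f I" "v \<in> zspan f I"
  shows "x * v \<in> zspan f I"
proof -
  obtain c where c: "v = (\<Sum>i\<in>I. of_int (c i) * f i)" using assms(2) by (auto simp: zspan_def)
  have "x * v = (\<Sum>i\<in>I. of_int (c i) * (x * f i))"
    unfolding c by (simp add: sum_distrib_left algebra_simps)
  also have "\<dots> \<in> zspan f I" by (intro zspan_sum zspan_scale assms(1))
  finally show ?thesis .
qed

text \<open>The relations expressing \<open>x * f i\<close> through the \<open>f j\<close> form an
  integer matrix that has the vector of the \<open>f i\<close> as eigenvector with eigenvalue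
  \<open>x\<close>. The index \<open>i0\<close> guarantees that this vector is not zero.\<close>

lemma algebraic_int_zspan:
  assumes fin: "finite I" and nz: "i0 \<in> I" "f i0 \<noteq> 0"
    and cl: "\<And>i. i \<in> I \<Longrightarrow> x * f i \<in> zspan f I"
  shows "algebraic_int x"
proof -
  have "\<forall>i\<in>I. \<exists>c. x * f i = (\<Sum>j\<in>I. of_int (c j) * f j)"
    using cl by (auto simp: zspan_def)
  then obtain c where c: "\<And>i. i \<in> I \<Longrightarrow> x * f i = (\<Sum>j\<in>I. of_int (c i j) * f j)" by metis
  obtain h where h: "bij_betw h {..<card I} I"
    using ex_bij_betw_nat_finite[OF fin] by (auto simp: atLeast0LessThan)
  define n where "n = card I"
  define M where "M = mat n n (\<lambda>(i,j). c (h i) (h j))"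
  define v where "v = vec n (\<lambda>i. f (h i))"
  have hI: "h i \<in> I" if "i < n" for i using h that unfolding n_def by (auto simp: bij_betw_def)
  have "map_mat of_int M *\<^sub>v v = x \<cdot>\<^sub>v v"
  proof (rule eq_vecI)
    fix i assume "i < dim_vec (x \<cdot>\<^sub>v v)"
    hence i: "i < n" by (simp add: v_def)
    have "(map_mat of_int M *\<^sub>v v) $ i = (\<Sum>j = 0..<n. of_int (c (h i) (h j)) * f (h j))"
      using i by (simp add: M_def v_def scalar_prod_def)
    also have "\<dots> = (\<Sum>j\<in>I. of_int (c (h i) j) * f j)"
      using sum.reindex_bij_betw[OF h, of "\<lambda>j. of_int (c (h i) j) * f j"]
      by (simp add: n_def atLeast0LessThan)
    also have "\<dots> = x * f (h i)" using c hI[OF i] by simp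
    finally show "(map_mat of_int M *\<^sub>v v) $ i = (x \<cdot>\<^sub>v v) $ i" using i by (simp add: v_def)
  qed (simp add: M_def v_def)
  moreover have "v \<noteq> 0\<^sub>v n"
  proof
    assume "v = 0\<^sub>v n"
    moreover have "i0 \<in> h ` {..<n}" using h nz(1) unfolding n_def bij_betw_def by simp
    then obtain k where "k < n" "h k = i0" by auto
    ultimately show False using nz(2)
      by (metis index_vec index_zero_vec(1) v_def)
  qed
  ultimately have "eigenvalue (map_mat of_int M) x"
    unfolding eigenvalue_def eigenvector_def by (intro exI[of _ v]) (auto simp: M_def v_def)
  thus ?thesis by (intro algebraic_int_eigenvalue[of M n]) (auto simp: M_def)
qed

lemma algebraic_int_power_reduce:
  fixes x :: complex
  assumes "algebraic_int x"
  obtains a c where "a > 0" "x ^ a = (\<Sum>k<a. of_int (c k) * x ^ k)"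
proof -
  obtain p where p: "poly (map_poly of_int p) x = 0" "lead_coeff p = 1"
    using assms unfolding algebraic_int_altdef_ipoly by auto
  have d: "degree p > 0"
  proof (rule ccontr)
    assume "\<not> degree p > 0"
    then obtain a where "p = [:a:]" using degree_eq_zeroE by auto
    thus False using p by simp
  qed
  have "0 = (\<Sum>k\<le>degree p. of_int (coeff p k) * x ^ k)"
    using p(1) by (simp add: poly_altdef)
  also have "\<dots> = x ^ degree p + (\<Sum>k<degree p. of_int (coeff p k) * x ^ k)"
    using p(2) by (simp flip: lessThan_Suc_atMost)
  finally have "x ^ degree p = - (\<Sum>k<degree p. of_int (coeff p k) * x ^ k)"
    by (simp add: eq_neg_iff_add_eq_0)
  also have "\<dots> = (\<Sum>k<degree p. of_int (- coeff p k) * x ^ k)"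
    by (simp add: sum_negf)
  finally show ?thesis by (rule that[OF d])
qed

text \<open>The products \<open>x ^ i * y ^ j\<close> with \<open>i < a\<close>,
  \<open>j < b\<close> span a module that is stable under multiplication by \<open>x\<close> and by
  \<open>y\<close>, hence also by \<open>x + y\<close> and \<open>x * y\<close>.\<close>

lemma algebraic_int_add_mult:
  fixes x y :: complex
  assumes "algebraic_int x" "algebraic_int y"
  shows "algebraic_int (x + y) \<and> algebraic_int (x * y)"
proof -
  obtain a c where a: "a > 0" "x ^ a = (\<Sum>k<a. of_int (c k) * x ^ k)"
    using algebraic_int_power_reduce[OF assms(1)] .
  obtain b d where b: "b > 0" "y ^ b = (\<Sum>k<b. of_int (d k) * y ^ k)"
    using algebraic_int_power_reduce[OF assms(2)] .
  define I where "I = {..<a} \<times> {..<b}"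
  define f where "f = (\<lambda>(i,j). x ^ i * y ^ j)"
  have fin: "finite I" by (simp add: I_def)
  have X: "x * f ij \<in> zspan f I" if ijI: "ij \<in> I" for ij
  proof -
    obtain i j where ij: "ij = (i,j)" "i < a" "j < b" using ijI by (auto simp: I_def)
    show ?thesis
    proof (cases "Suc i < a")
      case True
      thus ?thesis using zspan_base[OF fin, of "(Suc i, j)" f] ij by (simp add: f_def I_def algebra_simps)
    next
      case False
      \<comment> \<open>At the edge of the exponent range the monic relation for \<open>x\<close>
        brings the power back into range.\<close>
      hence "Suc i = a" using ij by simp
      hence "x * f ij = x ^ a * y ^ j" using ij by (auto simp: f_def)
      also have "\<dots> = (\<Sum>k<a. of_int (c k) * f (k,j))"
        by (simp add: a(2) f_def sum_distrib_right mult.assoc)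
      also have "\<dots> \<in> zspan f I"
        using ij by (intro zspan_sum zspan_scale zspan_base[OF fin]) (auto simp: I_def)
      finally show ?thesis .
    qed
  qed
  have Y: "y * f ij \<in> zspan f I" if ijI: "ij \<in> I" for ij
  proof -
    obtain i j where ij: "ij = (i,j)" "i < a" "j < b" using ijI by (auto simp: I_def)
    show ?thesis
    proof (cases "Suc j < b")
      case True
      thus ?thesis using zspan_base[OF fin, of "(i, Suc j)" f] ij by (simp add: f_def I_def algebra_simps)
    next
      case False
      hence "Suc j = b" using ij by simp
      hence "y * f ij = x ^ i * y ^ b" using ij by (auto simp: f_def)
      also have "\<dots> = (\<Sum>k<b. of_int (d k) * f (i,k))"
        by (simp add: b(2) f_def sum_distrib_left mult.left_commute)
      also have "\<dots> \<in> zspan f I"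
        using ij by (intro zspan_sum zspan_scale zspan_base[OF fin]) (auto simp: I_def)
      finally show ?thesis .
    qed
  qed
  have nz: "(0,0) \<in> I" "f (0,0) \<noteq> 0" using a b by (auto simp: I_def f_def)
  show ?thesis
  proof
    show "algebraic_int (x + y)"
      by (rule algebraic_int_zspan[of I "(0,0)" f, OF fin nz]) (simp add: ring_distribs zspan_add X Y)
    show "algebraic_int (x * y)"
      by (rule algebraic_int_zspan[of I "(0,0)" f, OF fin nz])
         (simp only: mult.assoc, rule zspan_mult_closed[OF X], assumption, rule Y)
  qed
qed

lemmas algebraic_int_plus = algebraic_int_add_mult[THEN conjunct1]
lemmas algebraic_int_times = algebraic_int_add_mult[THEN conjunct2]

lemma algebraic_int_diff: "algebraic_int (x::complex) \<Longrightarrow> algebraic_int y \<Longrightarrow> algebraic_int (x - y)"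
  using algebraic_int_plus[of x "-y"] by simp

lemma algebraic_int_power: "algebraic_int (x::complex) \<Longrightarrow> algebraic_int (x ^ n)"
  by (induction n) (auto intro: algebraic_int_times)

lemma algebraic_int_sum: "(\<And>i. i \<in> I \<Longrightarrow> algebraic_int (f i :: complex)) \<Longrightarrow> algebraic_int (sum f I)"
  by (induction I rule: infinite_finite_induct) (auto intro: algebraic_int_plus)

lemma algebraic_int_prod: "(\<And>i. i \<in> I \<Longrightarrow> algebraic_int (f i :: complex)) \<Longrightarrow> algebraic_int (prod f I)"
  by (induction I rule: infinite_finite_induct) (auto intro: algebraic_int_times)

lemmas algebraic_int_intros = algebraic_int_plus algebraic_int_times algebraic_int_diff
  algebraic_int_power algebraic_int_sum algebraic_int_prod

text \<open>The ideal lives in the ring of all algebraic integers, so one \<open>P\<close> serves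
  every polynomial and every root of unity at once, without the choice of a number field.\<close>

locale prime_above =
  fixes l :: nat and P :: "complex set"
  assumes prime_l: "prime l"
    and P_int: "x \<in> P \<Longrightarrow> algebraic_int x"
    and P_add: "x \<in> P \<Longrightarrow> y \<in> P \<Longrightarrow> x + y \<in> P"
    and P_mult: "algebraic_int a \<Longrightarrow> x \<in> P \<Longrightarrow> a * x \<in> P"
    and P_l: "of_nat l \<in> P"
    and P_1: "1 \<notin> P"
    and P_prime: "algebraic_int x \<Longrightarrow> algebraic_int y \<Longrightarrow> x * y \<in> P \<Longrightarrow> x \<in> P \<or> y \<in> P"

text \<open>Zorn's lemma gives a maximal ideal among those containing \<open>l\<close> but not 1,
  starting from the ideal generated by \<open>l\<close>; maximal ideals are prime.\<close>

lemma exists_prime_above: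
  assumes l: "prime l"
  shows "\<exists>P. prime_above l P"
proof -
  define ideal where "ideal = (\<lambda>P::complex set. (\<forall>x\<in>P. algebraic_int x) \<and> (\<forall>x\<in>P. \<forall>y\<in>P. x + y \<in> P) \<and>
     (\<forall>a. \<forall>x\<in>P. algebraic_int a \<longrightarrow> a * x \<in> P) \<and> of_nat l \<in> P \<and> 1 \<notin> P)"
  define I0 :: "complex set" where "I0 = {of_nat l * a | a. algebraic_int a}"
  have I0: "ideal I0"
    unfolding ideal_def
  proof (intro conjI)
    show "\<forall>x\<in>I0. algebraic_int x" by (auto simp: I0_def intro!: algebraic_int_times)
    show "\<forall>x\<in>I0. \<forall>y\<in>I0. x + y \<in> I0"
      unfolding I0_def by clarify (metis algebraic_int_plus distrib_left)
    show "\<forall>a. \<forall>x\<in>I0. algebraic_int a \<longrightarrow> a * x \<in> I0"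
      unfolding I0_def by clarify (metis algebraic_int_times mult.left_commute)
    show "of_nat l \<in> I0" unfolding I0_def by (rule CollectI, rule exI[of _ 1]) auto
    \<comment> \<open>Otherwise \<open>1 / l\<close> would be an algebraic integer and, being
      rational, an integer.\<close>
    show "(1::complex) \<notin> I0"
    proof
      assume "1 \<in> I0"
      then obtain a :: complex where a: "1 = of_nat l * a" "algebraic_int a" by (auto simp: I0_def)
      have l0: "(of_nat l :: complex) \<noteq> 0" using l prime_gt_0_nat by auto
      hence "a = 1 / of_nat l" using a(1) by (auto simp: field_simps)
      hence "a \<in> \<rat>" by auto
      hence "a \<in> \<int>" using rational_algebraic_int_is_int a(2) by blast
      then obtain k where k: "a = of_int k" by (auto elim: Ints_cases)
      have "of_int (int l * k) = (1 :: complex)" using a(1) k by simp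
      hence "int l * k = 1" by (metis of_int_eq_1_iff)
      hence "int l dvd 1" by (metis dvd_triv_left)
      thus False using l by (simp add: not_prime_unit)
    qed
  qed
  have chains: "\<exists>U\<in>{P. ideal P}. \<forall>X\<in>C. X \<subseteq> U" if C: "subset.chain {P. ideal P} C" for C
    proof (cases "C = {}")
      case True thus ?thesis using I0 by auto
    next
      case False
      have ch: "\<And>X. X \<in> C \<Longrightarrow> ideal X" "\<And>X Y. X \<in> C \<Longrightarrow> Y \<in> C \<Longrightarrow> X \<subseteq> Y \<or> Y \<subseteq> X"
        using C by (auto simp: subset.chain_def)
      have "ideal (\<Union>C)"
        unfolding ideal_def
      proof (intro conjI)
        show "\<forall>x\<in>\<Union>C. algebraic_int x" using ch(1) by (auto simp: ideal_def)
        show "\<forall>x\<in>\<Union>C. \<forall>y\<in>\<Union>C. x + y \<in> \<Union>C"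
        proof (intro ballI)
          fix x y assume "x \<in> \<Union>C" "y \<in> \<Union>C"
          then obtain X Y where XY: "X \<in> C" "Y \<in> C" "x \<in> X" "y \<in> Y" by auto
          thus "x + y \<in> \<Union>C" using ch(2)[OF XY(1,2)] ch(1)[OF XY(1)] ch(1)[OF XY(2)]
            unfolding ideal_def by (metis UnionI subsetD)
        qed
        show "\<forall>a. \<forall>x\<in>\<Union>C. algebraic_int a \<longrightarrow> a * x \<in> \<Union>C" using ch(1) unfolding ideal_def by blast
        show "of_nat l \<in> \<Union>C" using False ch(1) unfolding ideal_def by blast
        show "1 \<notin> \<Union>C" using ch(1) unfolding ideal_def by blast
      qed
      thus ?thesis by auto
    qed
  have "\<exists>M\<in>{P. ideal P}. \<forall>X\<in>{P. ideal P}. M \<subseteq> X \<longrightarrow> X = M"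
    by (rule subset_Zorn[OF chains])
  then obtain M where M: "ideal M" and Mmax: "\<forall>X. ideal X \<longrightarrow> M \<subseteq> X \<longrightarrow> X = M"
    by (elim bexE) (simp only: mem_Collect_eq Ball_def)
  have Mmax: "X = M" if "ideal X" "M \<subseteq> X" for X using Mmax that by simp
  have "prime_above l M"
  proof
    show "prime l" by fact
    fix x y assume xy: "algebraic_int x" "algebraic_int y" "x * y \<in> M"
    show "x \<in> M \<or> y \<in> M"
    proof (rule ccontr)
      assume n: "\<not> (x \<in> M \<or> y \<in> M)"
      \<comment> \<open>\<open>X\<close> is the ideal generated by \<open>M\<close> and
        \<open>x\<close>. It is larger than \<open>M\<close>, so by maximality it contains 1, and
        multiplying \<open>1 = m + a * x\<close> by \<open>y\<close> puts \<open>y\<close> into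
        \<open>M\<close>.\<close>
      define X where "X = {m + a * x | m a. m \<in> M \<and> algebraic_int a}"
      have sub: "M \<subseteq> X"
      proof
        fix m assume "m \<in> M"
        thus "m \<in> X" unfolding X_def by (intro CollectI exI[of _ m] exI[of _ "0::complex"]) auto
      qed
      have "0 \<in> M" using M unfolding ideal_def by (metis algebraic_int_0 mult_zero_left)
      hence "x \<in> X" unfolding X_def by (intro CollectI exI[of _ 0] exI[of _ 1]) auto
      hence "X \<noteq> M" using n by auto
      hence nX: "\<not> ideal X" using Mmax[OF _ sub] by auto
      have X1: "\<forall>x\<in>X. algebraic_int x"
        using M xy(1) unfolding X_def ideal_def by (auto intro!: algebraic_int_intros)
      have X2: "\<forall>x\<in>X. \<forall>y\<in>X. x + y \<in> X"
      proof (intro ballI)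
        fix u v assume "u \<in> X" "v \<in> X"
        then obtain m a m' a' where u: "u = m + a * x" "v = m' + a' * x" "m \<in> M" "m' \<in> M" "algebraic_int a" "algebraic_int a'"
          unfolding X_def by auto
        hence "u + v = (m + m') + (a + a') * x" "m + m' \<in> M" "algebraic_int (a + a')"
          using M unfolding ideal_def by (auto simp: algebra_simps intro: algebraic_int_intros)
        thus "u + v \<in> X" unfolding X_def by blast
      qed
      have X3: "\<forall>a. \<forall>x\<in>X. algebraic_int a \<longrightarrow> a * x \<in> X"
      proof (intro allI ballI impI)
        fix b u :: complex assume "u \<in> X" "algebraic_int b"
        then obtain m a where u: "u = m + a * x" "m \<in> M" "algebraic_int a" "algebraic_int b"
          unfolding X_def by auto
        hence "b * u = b * m + (b * a) * x" "b * m \<in> M" "algebraic_int (b * a)"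
          using M unfolding ideal_def by (auto simp: algebra_simps intro: algebraic_int_intros)
        thus "b * u \<in> X" unfolding X_def by blast
      qed
      have "1 \<in> X" using nX X1 X2 X3 sub M unfolding ideal_def by blast
      then obtain m a where m: "1 = m + a * x" "m \<in> M" "algebraic_int a" unfolding X_def by auto
      have "y = y * m + a * (x * y)"
      proof -
        have "y = y * (m + a * x)" using m(1) by simp
        thus ?thesis by (simp add: algebra_simps)
      qed
      moreover have "y * m \<in> M" "a * (x * y) \<in> M" using m xy M unfolding ideal_def by auto
      ultimately have "y \<in> M" using M unfolding ideal_def by metis
      thus False using n by auto
    qed
  qed (use M in \<open>auto simp: ideal_def\<close>)
  thus ?thesis by blast
qed

section \<open>Polynomial functions of the roots and Galois theory\<close>

text \<open>Integer polynomials in \<open>n\<close> variables, kept as functions: only their values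
  at the roots and at permutations of the roots matter, and induction on the build-up replaces a
  formal type of multivariate polynomials.\<close>

inductive_set polyfun :: "nat \<Rightarrow> ((nat \<Rightarrow> complex) \<Rightarrow> complex) set" for n :: nat where
  polyfun_const: "(\<lambda>a. of_int c) \<in> polyfun n"
| polyfun_var: "i < n \<Longrightarrow> (\<lambda>a. a i) \<in> polyfun n"
| polyfun_add: "f \<in> polyfun n \<Longrightarrow> g \<in> polyfun n \<Longrightarrow> (\<lambda>a. f a + g a) \<in> polyfun n"
| polyfun_mult: "f \<in> polyfun n \<Longrightarrow> g \<in> polyfun n \<Longrightarrow> (\<lambda>a. f a * g a) \<in> polyfun n"

lemma polyfun_0: "(\<lambda>a. 0) \<in> polyfun n" and polyfun_1: "(\<lambda>a. 1) \<in> polyfun n"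
  using polyfun_const[of 0 n] polyfun_const[of 1 n] by simp_all

lemma polyfun_uminus: "f \<in> polyfun n \<Longrightarrow> (\<lambda>a. - f a) \<in> polyfun n"
  using polyfun_mult[OF polyfun_const[of "-1"]] by simp

lemma polyfun_diff: "f \<in> polyfun n \<Longrightarrow> g \<in> polyfun n \<Longrightarrow> (\<lambda>a. f a - g a) \<in> polyfun n"
  using polyfun_add[OF _ polyfun_uminus, of f n g] by simp

lemma polyfun_power: "f \<in> polyfun n \<Longrightarrow> (\<lambda>a. f a ^ k) \<in> polyfun n"
  by (induction k) (auto intro: polyfun_1 polyfun_mult)

lemma polyfun_sum: "(\<And>i. i \<in> I \<Longrightarrow> f i \<in> polyfun n) \<Longrightarrow> (\<lambda>a. \<Sum>i\<in>I. f i a) \<in> polyfun n"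
  by (induction I rule: infinite_finite_induct) (auto intro: polyfun_0 polyfun_add)

lemma polyfun_prod: "(\<And>i. i \<in> I \<Longrightarrow> f i \<in> polyfun n) \<Longrightarrow> (\<lambda>a. \<Prod>i\<in>I. f i a) \<in> polyfun n"
  by (induction I rule: infinite_finite_induct) (auto intro: polyfun_1 polyfun_mult)

lemma polyfun_permute:
  assumes "g \<in> polyfun n" and s: "\<And>i. i < n \<Longrightarrow> s i < n"
  shows "(\<lambda>a. g (a \<circ> s)) \<in> polyfun n"
  using assms(1)
  by induction (auto intro: polyfun.intros s)

lemma polyfun_cong:
  assumes "g \<in> polyfun n" "\<And>i. i < n \<Longrightarrow> a i = b i"
  shows "g a = g b"
  using assms(1) by induction (auto simp: assms(2))

lemma polyfun_algebraic_int:
  assumes "g \<in> polyfun n" "\<And>i. i < n \<Longrightarrow> algebraic_int (a i)"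
  shows "algebraic_int (g a)"
  using assms(1) by induction (auto simp: assms(2) intro: algebraic_int_plus algebraic_int_times)

text \<open>The expanded form is wanted because sums over all index maps factor monomial by
  monomial. Monomials may repeat in the list.\<close>

lemma polyfun_monomials:
  assumes "g \<in> polyfun n"
  shows "\<exists>xs :: (int \<times> (nat \<Rightarrow> nat)) list. \<forall>a. g a = (\<Sum>(c,e)\<leftarrow>xs. of_int c * (\<Prod>i<n. a i ^ e i))"
  using assms
proof induction
  case (polyfun_const c)
  show ?case by (rule exI[of _ "[(c, \<lambda>_. 0)]"]) auto
next
  case (polyfun_var i)
  have "(\<Prod>j<n. a j ^ (if j = i then 1 else 0)) = a i" for a :: "nat \<Rightarrow> complex"
  proof -
    have "(\<Prod>j<n. a j ^ (if j = i then 1 else 0)) = (\<Prod>j<n. if j = i then a j else 1)"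
      by (rule prod.cong) auto
    thus ?thesis using polyfun_var by simp
  qed
  thus ?case by (intro exI[of _ "[(1, \<lambda>j. if j = i then 1 else 0)]"]) simp
next
  case (polyfun_add f g)
  then obtain xs ys where "\<And>a. f a = (\<Sum>(c,e)\<leftarrow>xs. of_int c * (\<Prod>i<n. a i ^ e i))"
    "\<And>a. g a = (\<Sum>(c,e)\<leftarrow>ys. of_int c * (\<Prod>i<n. a i ^ e i))" by auto
  thus ?case by (intro exI[of _ "xs @ ys"]) simp
next
  case (polyfun_mult f g)
  then obtain xs ys where f: "\<And>a. f a = (\<Sum>(c,e)\<leftarrow>xs. of_int c * (\<Prod>i<n. a i ^ e i))"
    and g: "\<And>a. g a = (\<Sum>(c,e)\<leftarrow>ys. of_int c * (\<Prod>i<n. a i ^ e i))" by auto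
  have h: "(\<Sum>(c,e)\<leftarrow>xs. of_int c * (\<Prod>i<n. a i ^ e i)) * (\<Sum>(c,e)\<leftarrow>ys. of_int c * (\<Prod>i<n. a i ^ e i))
     = (\<Sum>(c,e)\<leftarrow>concat (map (\<lambda>(c,e). map (\<lambda>(d,e'). (c * d, \<lambda>i. e i + e' i)) ys) xs). of_int c * (\<Prod>i<n. a i ^ e i))"
    for a :: "nat \<Rightarrow> complex"
  proof (induction xs)
    case (Cons x xs)
    obtain c e where x: "x = (c, e)" by (cases x)
    have "of_int c * (\<Prod>i<n. a i ^ e i) * (\<Sum>(c,e)\<leftarrow>ys. of_int c * (\<Prod>i<n. a i ^ e i))
        = (\<Sum>(c,e)\<leftarrow>map (\<lambda>(d,e'). (c * d, \<lambda>i. e i + e' i)) ys. of_int c * (\<Prod>i<n. a i ^ e i))"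
      by (induction ys) (auto simp: power_add prod.distrib ring_distribs mult_ac)
    thus ?case using Cons x by (simp add: ring_distribs)
  qed simp
  show ?case
    by (intro exI[of _ "concat (map (\<lambda>(c,e). map (\<lambda>(d,e'). (c * d, \<lambda>i. e i + e' i)) ys) xs)"])
       (simp only: f g h, simp)
qed

text \<open>Up to sign the discriminant: with ordered pairs every difference occurs with both signs,
  which makes the product symmetric rather than alternating.\<close>

definition disc_fun :: "nat \<Rightarrow> (nat \<Rightarrow> complex) \<Rightarrow> complex" where
  "disc_fun n a = (\<Prod>(i,j)\<in>{(i,j). i < n \<and> j < n \<and> i \<noteq> j}. a i - a j)"

lemma finite_offdiag: "finite {(i,j). i < n \<and> j < n \<and> i \<noteq> (j::nat)}"
  by (rule finite_subset[of _ "{..<n} \<times> {..<n}"]) auto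

lemma disc_fun_polyfun: "disc_fun n \<in> polyfun n"
proof -
  have "(\<lambda>a. \<Prod>ij\<in>{(i,j). i < n \<and> j < n \<and> i \<noteq> j}. (\<lambda>a. a (fst ij) - a (snd ij)) a) \<in> polyfun n"
    by (rule polyfun_prod) (auto intro!: polyfun_diff polyfun_var)
  thus ?thesis unfolding disc_fun_def[abs_def] by (simp add: case_prod_unfold)
qed

lemma disc_fun_eq_0_iff: "disc_fun n a = 0 \<longleftrightarrow> \<not> inj_on a {..<n}"
  unfolding disc_fun_def using finite_offdiag by (auto simp: prod_zero_iff inj_on_def)

lemma disc_fun_permute:
  assumes "s permutes {..<n}"
  shows "disc_fun n (a \<circ> s) = disc_fun n a"
proof -
  have lt: "s i < n \<longleftrightarrow> i < n" for i using permutes_in_image[OF assms, of i] by simp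
  have inj: "s i = s j \<longleftrightarrow> i = j" for i j using permutes_inj[OF assms] by (auto dest: injD)
  have "bij_betw (\<lambda>(i,j). (s i, s j)) {(i,j). i < n \<and> j < n \<and> i \<noteq> j} {(i,j). i < n \<and> j < n \<and> i \<noteq> j}"
    by (rule bij_betw_byWitness[of _ "\<lambda>(i,j). (Hilbert_Choice.inv s i, Hilbert_Choice.inv s j)"])
       (use assms lt inj in \<open>auto simp: permutes_inverses image_iff\<close>,
        (metis lt permutes_inverses(1))+)
  from prod.reindex_bij_betw[OF this, of "\<lambda>(i,j). a i - a j"]
  show ?thesis unfolding disc_fun_def by (simp add: case_prod_unfold)
qed

text \<open>The sum over all maps is accessible through power sums, while the sum over permutations
  is the one wanted; they agree once the summand kills the maps that are not injective. Extension by
  the identity turns an injective map into a permutation.\<close>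

lemma sum_injective_maps:
  fixes h :: "(nat \<Rightarrow> nat) \<Rightarrow> complex"
  assumes 0: "\<And>m. m \<in> {..<n} \<rightarrow>\<^sub>E {..<n} \<Longrightarrow> \<not> inj_on m {..<n} \<Longrightarrow> h m = 0"
    and cong: "\<And>m m'. (\<And>i. i < n \<Longrightarrow> m i = m' i) \<Longrightarrow> h m = h m'"
  shows "(\<Sum>m\<in>{..<n} \<rightarrow>\<^sub>E {..<n}. h m) = (\<Sum>s | s permutes {..<n}. h s)"
proof -
  let ?M = "{m \<in> {..<n} \<rightarrow>\<^sub>E {..<n}. inj_on m {..<n}}"
  have "(\<Sum>m\<in>{..<n} \<rightarrow>\<^sub>E {..<n}. h m) = (\<Sum>m\<in>?M. h m)"
    by (rule sum.mono_neutral_right) (auto simp: finite_PiE 0)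
  also have "\<dots> = (\<Sum>s | s permutes {..<n}. h (restrict s {..<n}))"
  proof (rule sum.reindex_bij_betw[symmetric])
    show "bij_betw (\<lambda>s. restrict s {..<n}) {s. s permutes {..<n}} ?M"
    proof (rule bij_betw_byWitness[of _ "\<lambda>m i. if i < n then m i else i"])
      show "\<forall>s\<in>{s. s permutes {..<n}}. (\<lambda>i. if i < n then restrict s {..<n} i else i) = s"
        by (auto simp: permutes_def)
      show "\<forall>m\<in>?M. restrict (\<lambda>i. if i < n then m i else i) {..<n} = m"
        by (auto simp: PiE_def extensional_def restrict_def)
      show "(\<lambda>s. restrict s {..<n}) ` {s. s permutes {..<n}} \<subseteq> ?M"
      proof
        fix m assume "m \<in> (\<lambda>s. restrict s {..<n}) ` {s. s permutes {..<n}}"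
        then obtain s where s: "s permutes {..<n}" "m = restrict s {..<n}" by auto
        have "s i < n" if "i < n" for i using permutes_in_image[OF s(1), of i] that by simp
        thus "m \<in> ?M" using s permutes_inj_on[OF s(1), of "{..<n}"] by (auto simp: inj_on_def)
      qed
      show "(\<lambda>m i. if i < n then m i else i) ` ?M \<subseteq> {s. s permutes {..<n}}"
      proof
        fix s assume "s \<in> (\<lambda>m i. if i < n then m i else i) ` ?M"
        then obtain m where m: "m \<in> {..<n} \<rightarrow>\<^sub>E {..<n}" "inj_on m {..<n}" "s = (\<lambda>i. if i < n then m i else i)"
          by auto
        have "m ` {..<n} = {..<n}"
          by (rule endo_inj_surj) (use m in auto)
        hence "bij_betw m {..<n} {..<n}" using m(2) by (simp add: bij_betw_def)
        hence "bij_betw s {..<n} {..<n}" using m(3) by (subst bij_betw_cong[of _ _ m]) auto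
        hence "s permutes {..<n}" by (rule bij_imp_permutes) (simp add: m(3))
        thus "s \<in> {s. s permutes {..<n}}" by simp
      qed
    qed
  qed
  also have "\<dots> = (\<Sum>s | s permutes {..<n}. h s)"
    by (rule sum.cong) (auto intro: cong)
  finally show ?thesis .
qed

section \<open>Power sums of the roots\<close>

locale int_roots =
  fixes n :: nat and a :: "nat \<Rightarrow> complex" and p :: "int poly"
  assumes p_roots: "of_int_poly p = (\<Prod>i<n. [:- a i, 1:])"
begin

definition cofac :: "nat \<Rightarrow> complex poly" where
  "cofac i = (\<Prod>j\<in>{..<n} - {i}. [:- a j, 1:])"

lemma cofac: "i < n \<Longrightarrow> of_int_poly p = [:- a i, 1:] * cofac i"
  unfolding p_roots cofac_def by (subst prod.remove[of _ i]) auto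

lemma coeff_cofac_top:
  assumes "i < n"
  shows "coeff (cofac i) (n - 1) = 1"
proof -
  have "lead_coeff (cofac i) = 1" unfolding cofac_def by (subst lead_coeff_prod) auto
  moreover have "degree (cofac i) = n - 1"
    unfolding cofac_def by (subst degree_prod_sum_eq) (use assms in auto)
  ultimately show ?thesis by simp
qed

text \<open>Newton's identities: the cofactors \<open>p / (X - a i)\<close> add up to the derivative of \<open>p\<close>.\<close>

lemma power_sum_cofac_Ints: "(\<Sum>i<n. a i ^ k * coeff (cofac i) j) \<in> \<int>"
proof (induction k arbitrary: j)
  case 0
  have "pderiv (of_int_poly p :: complex poly) = (\<Sum>i<n. cofac i)"
    unfolding p_roots cofac_def pderiv_prod by (simp add: pderiv_pCons)
  hence "(\<Sum>i<n. coeff (cofac i) j) = coeff (pderiv (of_int_poly p :: complex poly)) j"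
    by (simp add: coeff_sum)
  also have "\<dots> = of_int (int (Suc j) * coeff p (Suc j))" by (simp add: coeff_pderiv)
  finally show ?case by simp
next
  case (Suc k)
  \<comment> \<open>The coefficient of index \<open>n - 1\<close> of each cofactor is 1, so this
    instance of the induction hypothesis is the plain power sum.\<close>
  have pk: "(\<Sum>i<n. a i ^ k) \<in> \<int>"
  proof -
    have "(\<Sum>i<n. a i ^ k * coeff (cofac i) (n - 1)) = (\<Sum>i<n. a i ^ k)"
      by (rule sum.cong) (use coeff_cofac_top in auto)
    thus ?thesis using Suc[of "n - 1"] by simp
  qed
  show ?case
  proof (cases j)
    case 0
    have "a i * coeff (cofac i) 0 = - of_int (coeff p 0)" if "i < n" for i
      using arg_cong[OF cofac[OF that], of "\<lambda>q. coeff q 0"] by (simp add: coeff_mult)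
    hence "(\<Sum>i<n. a i ^ Suc k * coeff (cofac i) 0) = (\<Sum>i<n. a i ^ k * - of_int (coeff p 0))"
      by (intro sum.cong) (auto simp: mult.assoc mult.left_commute[of "a _" "a _ ^ k"])
    also have "\<dots> = - of_int (coeff p 0) * (\<Sum>i<n. a i ^ k)" by (simp add: sum_distrib_left mult.commute sum_negf)
    also have "\<dots> \<in> \<int>" using pk by simp
    finally show ?thesis using 0 by simp
  next
    case (Suc j')
    \<comment> \<open>Comparing coefficients in \<open>p = (X - a i) * cofac i\<close> trades a
      factor \<open>a i\<close> for a lower coefficient of the cofactor.\<close>
    have "a i * coeff (cofac i) (Suc j') = coeff (cofac i) j' - of_int (coeff p (Suc j'))" if "i < n" for i
      using arg_cong[OF cofac[OF that], of "\<lambda>q. coeff q (Suc j')"] by simp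
    hence "(\<Sum>i<n. a i ^ Suc k * coeff (cofac i) (Suc j'))
        = (\<Sum>i<n. a i ^ k * (coeff (cofac i) j' - of_int (coeff p (Suc j'))))"
      by (intro sum.cong) (auto simp: mult.assoc mult.left_commute)
    also have "\<dots> = (\<Sum>i<n. a i ^ k * coeff (cofac i) j') - of_int (coeff p (Suc j')) * (\<Sum>i<n. a i ^ k)"
      by (simp add: algebra_simps sum_subtractf sum_distrib_left)
    also have "\<dots> \<in> \<int>" using pk Suc.IH[of j'] by simp
    finally show ?thesis using Suc by simp
  qed
qed

lemma power_sum_Ints: "(\<Sum>i<n. a i ^ k) \<in> \<int>"
proof -
  have "(\<Sum>i<n. a i ^ k * coeff (cofac i) (n - 1)) = (\<Sum>i<n. a i ^ k)"
      by (rule sum.cong) (use coeff_cofac_top in auto)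
  thus ?thesis using power_sum_cofac_Ints[of k "n - 1"] by simp
qed

text \<open>For a monomial the sum over all maps factors into a product of power sums, by
  distributivity.\<close>

lemma sum_maps_Ints:
  assumes g: "g \<in> polyfun n"
  shows "(\<Sum>m\<in>{..<n} \<rightarrow>\<^sub>E {..<n}. g (\<lambda>i. a (m i))) \<in> \<int>"
proof -
  obtain xs :: "(int \<times> (nat \<Rightarrow> nat)) list" where
    xs: "\<And>a. g a = (\<Sum>(c,e)\<leftarrow>xs. of_int c * (\<Prod>i<n. a i ^ e i))"
    using polyfun_monomials[OF g] by blast
  have "(\<Sum>m\<in>{..<n} \<rightarrow>\<^sub>E {..<n}. \<Sum>(c,e)\<leftarrow>xs. of_int c * (\<Prod>i<n. a (m i) ^ e i)) \<in> \<int>"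
  proof (induction xs)
    case (Cons x xs)
    obtain c e where x: "x = (c,e)" by (cases x)
    have "(\<Sum>m\<in>{..<n} \<rightarrow>\<^sub>E {..<n}. of_int c * (\<Prod>i<n. a (m i) ^ e i))
        = of_int c * (\<Prod>i<n. \<Sum>j<n. a j ^ e i)"
      by (subst prod_sum_PiE) (auto simp: sum_distrib_left)
    also have "\<dots> \<in> \<int>" by (intro Ints_mult Ints_prod power_sum_Ints) auto
    finally show ?case using Cons by (simp add: x sum.distrib)
  qed simp
  thus ?thesis by (simp add: xs)
qed

lemma algebraic_int_roots: "i < n \<Longrightarrow> algebraic_int (a i)"
proof -
  assume i: "i < n"
  have "poly (of_int_poly p) (a i) = 0" unfolding cofac[OF i] by simp
  moreover have "lead_coeff p = 1"
  proof -
    have "lead_coeff (of_int_poly p :: complex poly) = 1" unfolding p_roots by (subst lead_coeff_prod) auto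
    thus ?thesis by simp
  qed
  ultimately show ?thesis unfolding algebraic_int_altdef_ipoly by blast
qed

end

section \<open>Rationality and integrality of Galois invariants\<close>

definition polyfun_poly :: "nat \<Rightarrow> ((nat \<Rightarrow> complex) \<Rightarrow> complex poly) set" where
  "polyfun_poly n = {F. \<forall>k. (\<lambda>a. coeff (F a) k) \<in> polyfun n}"

lemma polyfun_poly_coeff: "F \<in> polyfun_poly n \<Longrightarrow> (\<lambda>a. coeff (F a) k) \<in> polyfun n"
  by (simp add: polyfun_poly_def)

lemma polyfun_poly_1: "(\<lambda>a. 1) \<in> polyfun_poly n"
  unfolding polyfun_poly_def by (auto simp: coeff_1 intro: polyfun_0 polyfun_1)

lemma polyfun_poly_mult: "F \<in> polyfun_poly n \<Longrightarrow> G \<in> polyfun_poly n \<Longrightarrow> (\<lambda>a. F a * G a) \<in> polyfun_poly n"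
  unfolding polyfun_poly_def by (auto simp: coeff_mult intro!: polyfun_sum polyfun_mult)

lemma polyfun_poly_uminus: "F \<in> polyfun_poly n \<Longrightarrow> (\<lambda>a. - F a) \<in> polyfun_poly n"
  unfolding polyfun_poly_def by (auto intro!: polyfun_uminus)

lemma polyfun_poly_sum: "(\<And>i. i \<in> I \<Longrightarrow> F i \<in> polyfun_poly n) \<Longrightarrow> (\<lambda>a. \<Sum>i\<in>I. F i a) \<in> polyfun_poly n"
  unfolding polyfun_poly_def by (auto simp: coeff_sum intro!: polyfun_sum)

lemma polyfun_poly_prod: "(\<And>i. i \<in> I \<Longrightarrow> F i \<in> polyfun_poly n) \<Longrightarrow> (\<lambda>a. \<Prod>i\<in>I. F i a) \<in> polyfun_poly n"
  by (induction I rule: infinite_finite_induct) (auto intro: polyfun_poly_1 polyfun_poly_mult)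

lemma polyfun_poly_linear: "g \<in> polyfun n \<Longrightarrow> (\<lambda>a. [:- g a, 1:]) \<in> polyfun_poly n"
proof -
  assume g: "g \<in> polyfun n"
  have "(\<lambda>a. coeff [:- g a, 1:] k) \<in> polyfun n" for k
    by (cases k; cases "k - 1") (auto intro: polyfun_0 polyfun_1 polyfun_uminus g)
  thus ?thesis by (simp add: polyfun_poly_def)
qed

lemma fact_Rats: "fact n \<in> (\<rat> :: complex set)"
  by (metis Rats_of_nat of_nat_fact)

locale int_roots_inj = int_roots +
  assumes inj_a: "inj_on a {..<n}"
begin

definition Perms :: "(nat \<Rightarrow> nat) set" where "Perms = {s. s permutes {..<n}}"

text \<open>The Galois group, as the permutations of the indices that preserve every polynomial relation
  between the roots; no field automorphism is needed to define it.\<close>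

definition Gal :: "(nat \<Rightarrow> nat) set" where
  "Gal = {s \<in> Perms. \<forall>g\<in>polyfun n. g a = 0 \<longrightarrow> g (a \<circ> s) = 0}"

lemma Perms_lt: "s \<in> Perms \<Longrightarrow> s i < n \<longleftrightarrow> i < n"
  unfolding Perms_def using permutes_in_image[of s "{..<n}" i] by simp

lemma finite_Perms: "finite Perms"
  unfolding Perms_def by (rule finite_permutations) simp

lemma finite_Gal: "finite Gal"
  unfolding Gal_def by (rule finite_subset[OF _ finite_Perms]) auto

lemma Gal_Perms: "s \<in> Gal \<Longrightarrow> s \<in> Perms" by (simp add: Gal_def)

lemma id_Gal: "id \<in> Gal"
  by (simp add: Gal_def Perms_def permutes_id)

lemma comp_Perms: "s \<in> Perms \<Longrightarrow> t \<in> Perms \<Longrightarrow> s \<circ> t \<in> Perms"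
  unfolding Perms_def using permutes_compose by auto

lemma polyfun_Perms: "g \<in> polyfun n \<Longrightarrow> s \<in> Perms \<Longrightarrow> (\<lambda>a. g (a \<circ> s)) \<in> polyfun n"
  by (rule polyfun_permute) (auto simp: Perms_lt)

lemma comp_Gal:
  assumes "s \<in> Gal" "t \<in> Gal"
  shows "s \<circ> t \<in> Gal"
  unfolding Gal_def
proof (intro CollectI conjI ballI impI)
  show "s \<circ> t \<in> Perms" using assms comp_Perms by (auto simp: Gal_def)
  fix g assume g: "g \<in> polyfun n" "g a = 0"
  have "(\<lambda>a. g (a \<circ> t)) \<in> polyfun n" using polyfun_Perms g assms by (auto simp: Gal_def)
  moreover have "g (a \<circ> t) = 0" using g assms by (auto simp: Gal_def)
  ultimately have "g ((a \<circ> s) \<circ> t) = 0" using assms(1) by (auto simp: Gal_def)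
  thus "g (a \<circ> (s \<circ> t)) = 0" by (simp add: comp_assoc)
qed

text \<open>Translation is injective on a finite set closed under composition, hence onto; this is
  how inverses in \<open>Gal\<close> are obtained.\<close>

lemma Gal_right_surj:
  assumes "t \<in> Gal"
  shows "(\<lambda>u. u \<circ> t) ` Gal = Gal"
proof (rule endo_inj_surj[OF finite_Gal])
  show "(\<lambda>u. u \<circ> t) ` Gal \<subseteq> Gal" using comp_Gal assms by auto
  have "surj t" using assms permutes_surj by (auto simp: Gal_def Perms_def)
  thus "inj_on (\<lambda>u. u \<circ> t) Gal" by (auto simp: inj_on_def fun_eq_iff surj_def) metis
qed

lemma Gal_left_surj:
  assumes "t \<in> Gal"
  shows "(\<lambda>u. t \<circ> u) ` Gal = Gal"
proof (rule endo_inj_surj[OF finite_Gal])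
  show "(\<lambda>u. t \<circ> u) ` Gal \<subseteq> Gal" using comp_Gal assms by auto
  have "inj t" using assms permutes_inj by (auto simp: Gal_def Perms_def)
  thus "inj_on (\<lambda>u. t \<circ> u) Gal" by (auto simp: inj_on_def fun_eq_iff)
qed

lemma Gal_inv:
  assumes "t \<in> Gal"
  shows "Hilbert_Choice.inv t \<in> Gal"
proof -
  obtain u where u: "u \<in> Gal" "id = u \<circ> t" using Gal_right_surj[OF assms] id_Gal by (auto simp: image_iff)
  have "t permutes {..<n}" using assms by (simp add: Gal_def Perms_def)
  hence "Hilbert_Choice.inv t = u" using u(2)
    by (metis comp_id fun.map_id comp_assoc permutes_inv_o(1))
  thus ?thesis using u by simp
qed

text \<open>\<open>Gal\<close> is defined by one implication, and applying it to an inverse gives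
  the other. Thus denominators stay nonzero when \<open>s\<close> acts on fractions.\<close>

lemma Gal_zero_iff:
  assumes "s \<in> Gal" "g \<in> polyfun n"
  shows "g (a \<circ> s) = 0 \<longleftrightarrow> g a = 0"
proof
  assume 0: "g (a \<circ> s) = 0"
  obtain u where u: "u \<in> Gal" "id = u \<circ> s" using Gal_right_surj[OF assms(1)] id_Gal by (auto simp: image_iff)
  have "(\<lambda>a. g (a \<circ> s)) \<in> polyfun n" using polyfun_Perms assms by (auto simp: Gal_def)
  hence "g ((a \<circ> u) \<circ> s) = 0" using u 0 by (auto simp: Gal_def)
  thus "g a = 0" using u(2) by (simp add: comp_assoc flip: u(2))
qed (use assms in \<open>auto simp: Gal_def\<close>)

text \<open>The sum over all maps \<open>m\<close> of \<open>g (a \<circ> m)\<close> is an integer because it is a combination of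
  products of power sums; the factor \<open>disc_fun\<close> removes the maps that are not permutations.\<close>

lemma sum_Perms_Rats:
  assumes g: "g \<in> polyfun n"
  shows "(\<Sum>s\<in>Perms. g (a \<circ> s)) \<in> \<rat>"
proof -
  have *: "(\<Sum>s\<in>Perms. g (a \<circ> s)) * disc_fun n a \<in> \<int>" if g: "g \<in> polyfun n" for g
  proof -
    let ?h = "\<lambda>b. g b * disc_fun n b"
    have h: "?h \<in> polyfun n" by (intro polyfun_mult g disc_fun_polyfun)
    have "(\<Sum>m\<in>{..<n} \<rightarrow>\<^sub>E {..<n}. ?h (\<lambda>i. a (m i))) = (\<Sum>s | s permutes {..<n}. ?h (\<lambda>i. a (s i)))"
    proof (rule sum_injective_maps)
      fix m assume m: "m \<in> {..<n} \<rightarrow>\<^sub>E {..<n}" "\<not> inj_on m {..<n}"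
      hence "\<not> inj_on (\<lambda>i. a (m i)) {..<n}" by (auto simp: inj_on_def)
      thus "?h (\<lambda>i. a (m i)) = 0" by (simp add: disc_fun_eq_0_iff)
    next
      fix m m' :: "nat \<Rightarrow> nat" assume "\<And>i. i < n \<Longrightarrow> m i = m' i"
      thus "?h (\<lambda>i. a (m i)) = ?h (\<lambda>i. a (m' i))" by (intro polyfun_cong[OF h]) auto
    qed
    also have "\<dots> = (\<Sum>s\<in>Perms. g (a \<circ> s) * disc_fun n a)"
      unfolding Perms_def by (rule sum.cong) (auto simp: comp_def dest: disc_fun_permute[of _ n a])
    finally show ?thesis using sum_maps_Ints[OF h] by (simp add: sum_distrib_right)
  qed
  \<comment> \<open>With \<open>g = 1\<close> the claim says that \<open>fact n\<close> times
    \<open>disc_fun n a\<close> is an integer. So \<open>disc_fun n a\<close> is a nonzero rational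
    and can be divided out again.\<close>
  have "card Perms = fact n" unfolding Perms_def by (rule card_permutations) auto
  hence "fact n * disc_fun n a \<in> \<int>" using *[OF polyfun_1] by simp
  hence "(fact n * disc_fun n a) / fact n \<in> \<rat>" by (intro Rats_divide fact_Rats) (auto elim: Ints_cases)
  hence D: "disc_fun n a \<in> \<rat>" by simp
  have nz: "disc_fun n a \<noteq> 0" using inj_a by (simp add: disc_fun_eq_0_iff)
  have "(\<Sum>s\<in>Perms. g (a \<circ> s)) * disc_fun n a / disc_fun n a \<in> \<rat>"
    using *[OF g] D by (intro Rats_divide) (auto elim: Ints_cases)
  thus ?thesis using nz by simp
qed

lemma symmetric_Rats:
  assumes g: "g \<in> polyfun n" and sym: "\<And>s. s \<in> Perms \<Longrightarrow> g (a \<circ> s) = g a"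
  shows "g a \<in> \<rat>"
proof -
  have "card Perms = fact n" unfolding Perms_def by (rule card_permutations) auto
  hence "(\<Sum>s\<in>Perms. g (a \<circ> s)) = fact n * g a" using sym by simp
  hence "fact n * g a \<in> \<rat>" using sum_Perms_Rats[OF g] by simp
  hence "fact n * g a / fact n \<in> \<rat>" by (intro Rats_divide fact_Rats)
  thus ?thesis by simp
qed

text \<open>Permutations outside \<open>Gal\<close> are treated one at a time: for \<open>t\<close>
  there is a relation \<open>q\<close> broken by \<open>t\<close>, and \<open>r + c * q\<close>,
  with an integer \<open>c\<close> avoiding finitely many bad values, still vanishes on
  \<open>Gal\<close> and is nonzero at \<open>t\<close> and at all permutations treated
  before.\<close>

lemma separating_function:
  "\<exists>r\<in>polyfun n. (\<forall>s\<in>Gal. r (a \<circ> s) = 0) \<and> (\<forall>s\<in>Perms - Gal. r (a \<circ> s) \<noteq> 0)"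
proof -
  have "\<exists>r\<in>polyfun n. (\<forall>s\<in>Gal. r (a \<circ> s) = 0) \<and> (\<forall>s\<in>B. r (a \<circ> s) \<noteq> 0)"
    if "finite B" "B \<subseteq> Perms - Gal" for B
    using that
  proof (induction B)
    case empty
    show ?case by (rule bexI[OF _ polyfun_0]) auto
  next
    case (insert t B)
    then obtain r where r: "r \<in> polyfun n" "\<forall>s\<in>Gal. r (a \<circ> s) = 0" "\<forall>s\<in>B. r (a \<circ> s) \<noteq> 0" by blast
    obtain q where q: "q \<in> polyfun n" "q a = 0" "q (a \<circ> t) \<noteq> 0" using insert.prems by (auto simp: Gal_def)
    define bad where "bad = (\<lambda>s. - (r (a \<circ> s) / q (a \<circ> s))) ` insert t B"
    have "finite bad" using insert.hyps by (simp add: bad_def)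
    moreover have "infinite (range (of_int :: int \<Rightarrow> complex))"
      using finite_imageD[of "of_int :: int \<Rightarrow> complex" UNIV] infinite_UNIV_int by (auto simp: inj_on_def)
    ultimately have "\<not> range (of_int :: int \<Rightarrow> complex) \<subseteq> bad" using finite_subset by blast
    then obtain c :: int where c: "of_int c \<notin> bad" by auto
    show ?case
    proof (intro bexI[of _ "\<lambda>b. r b + of_int c * q b"] conjI ballI)
      show "(\<lambda>b. r b + of_int c * q b) \<in> polyfun n" using r q by (auto intro!: polyfun.intros)
      show "r (a \<circ> s) + of_int c * q (a \<circ> s) = 0" if "s \<in> Gal" for s
        using that r q by (auto simp: Gal_def)
      show "r (a \<circ> s) + of_int c * q (a \<circ> s) \<noteq> 0" if s: "s \<in> insert t B" for s
      proof (cases "q (a \<circ> s) = 0")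
        case True thus ?thesis using s r q by auto
      next
        case False
        have "of_int c \<noteq> - (r (a \<circ> s) / q (a \<circ> s))" using c s by (auto simp: bad_def)
        thus ?thesis using False by (auto simp: field_simps add_eq_0_iff)
      qed
    qed
  qed
  from this[of "Perms - Gal"] show ?thesis using finite_Perms by auto
qed

lemma bij_Perms_comp: "t \<in> Perms \<Longrightarrow> bij_betw (\<lambda>s. t \<circ> s) Perms Perms"
proof -
  assume t: "t \<in> Perms"
  have "inj t" using t permutes_inj by (auto simp: Perms_def)
  hence i: "inj_on (\<lambda>u. t \<circ> u) Perms" by (auto simp: inj_on_def fun_eq_iff)
  have "(\<lambda>u. t \<circ> u) ` Perms = Perms"
    by (rule endo_inj_surj[OF finite_Perms _ i]) (use t comp_Perms in auto)
  with i show ?thesis by (simp add: bij_betw_def)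
qed

text \<open>Permuting the roots only permutes the factors, so each coefficient is a symmetric
  function.\<close>

lemma resolvent_Rats:
  assumes r: "r \<in> polyfun n"
  shows "coeff (\<Prod>s\<in>Perms. [:- r (a \<circ> s), 1:]) k \<in> \<rat>"
proof -
  define F where "F = (\<lambda>b. \<Prod>s\<in>Perms. [:- r (b \<circ> s), 1:])"
  have "F \<in> polyfun_poly n" unfolding F_def by (intro polyfun_poly_prod polyfun_poly_linear polyfun_Perms r)
  hence "(\<lambda>b. coeff (F b) k) \<in> polyfun n" by (rule polyfun_poly_coeff)
  moreover have "F (a \<circ> t) = F a" if "t \<in> Perms" for t
    using prod.reindex_bij_betw[OF bij_Perms_comp[OF that], of "\<lambda>s. [:- r (a \<circ> s), 1:]"]
    by (simp add: F_def comp_assoc)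
  ultimately have "coeff (F a) k \<in> \<rat>" by (intro symmetric_Rats[of "\<lambda>b. coeff (F b) k"]) auto
  thus ?thesis by (simp add: F_def)
qed

text \<open>If \<open>r\<close> vanishes at \<open>a \<circ> s\<close> exactly for \<open>s \<in> Gal\<close>, then \<open>Q (r (a \<circ> s)) / Q 0\<close> is the indicator function
  of \<open>Gal\<close>, so averaging over \<open>Gal\<close> becomes an average over all permutations.\<close>

lemma fixed_Rats:
  assumes g: "g \<in> polyfun n" and fixed: "\<And>s. s \<in> Gal \<Longrightarrow> g (a \<circ> s) = g a"
  shows "g a \<in> \<rat>"
proof -
  obtain r where r: "r \<in> polyfun n" "\<forall>s\<in>Gal. r (a \<circ> s) = 0" "\<forall>s\<in>Perms - Gal. r (a \<circ> s) \<noteq> 0"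
    using separating_function by auto
  define Q where "Q = (\<Prod>s\<in>Perms - Gal. [:- r (a \<circ> s), 1:])"
  have sub: "Gal \<subseteq> Perms" by (auto simp: Gal_def)
  have "(\<Prod>s\<in>Perms. [:- r (a \<circ> s), 1:]) = Q * (\<Prod>s\<in>Gal. [:- r (a \<circ> s), 1:])"
    unfolding Q_def by (rule prod.subset_diff[OF sub finite_Perms])
  also have "(\<Prod>s\<in>Gal. [:- r (a \<circ> s), 1:]) = monom 1 (card Gal)"
    using r(2) by (simp add: monom_altdef)
  \<comment> \<open>The factors with \<open>s \<in> Gal\<close> are all equal to \<open>X\<close>,
    so \<open>Q\<close> is the resolvent shifted down by \<open>card Gal\<close> places and inherits
    rational coefficients.\<close>
  finally have RQ: "(\<Prod>s\<in>Perms. [:- r (a \<circ> s), 1:]) = Q * monom 1 (card Gal)" .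
  have Qrat: "coeff Q k \<in> \<rat>" for k
    using resolvent_Rats[OF r(1), of "k + card Gal"] unfolding RQ mult.commute[of Q] by (simp add: coeff_monom_mult)
  have Q0: "poly Q 0 \<noteq> 0" unfolding Q_def using r(3) finite_Perms by (auto simp: poly_prod)
  have Qs: "poly Q (r (a \<circ> s)) = 0" if "s \<in> Perms - Gal" for s
    unfolding Q_def poly_prod using finite_Perms that by (intro prod_zero) (auto intro!: bexI[of _ s])
  \<comment> \<open>Expanding \<open>Q\<close> in powers reduces the weighted sum to sums over all
    permutations of the integer polynomials \<open>g * r ^ k\<close>.\<close>
  have "(\<Sum>s\<in>Perms. g (a \<circ> s) * poly Q (r (a \<circ> s)))
      = (\<Sum>k\<le>degree Q. coeff Q k * (\<Sum>s\<in>Perms. g (a \<circ> s) * r (a \<circ> s) ^ k))"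
    by (simp add: poly_altdef sum_distrib_left sum_distrib_right mult_ac)
       (subst sum.swap, simp add: mult_ac)
  also have "\<dots> \<in> \<rat>"
    by (intro Rats_sum Rats_mult Qrat sum_Perms_Rats[of "\<lambda>b. g b * r b ^ _"] polyfun_mult polyfun_power g r)
  finally have "(\<Sum>s\<in>Perms. g (a \<circ> s) * poly Q (r (a \<circ> s))) \<in> \<rat>" .
  also have "(\<Sum>s\<in>Perms. g (a \<circ> s) * poly Q (r (a \<circ> s))) = (\<Sum>s\<in>Gal. g (a \<circ> s) * poly Q (r (a \<circ> s)))"
    by (rule sum.mono_neutral_right[OF finite_Perms sub]) (auto simp: Qs)
  also have "\<dots> = of_nat (card Gal) * poly Q 0 * g a" using r(2) fixed by simp
  finally have "of_nat (card Gal) * poly Q 0 * g a / (of_nat (card Gal) * poly Q 0) \<in> \<rat>"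
    using Qrat[of 0] by (intro Rats_divide) (auto simp: poly_0_coeff_0)
  moreover have "card Gal \<noteq> 0" using finite_Gal id_Gal by auto
  ultimately show ?thesis using Q0 by simp
qed

lemma fixed_Ints:
  assumes g: "g \<in> polyfun n" and fixed: "\<And>s. s \<in> Gal \<Longrightarrow> g (a \<circ> s) = g a"
  shows "g a \<in> \<int>"
  using rational_algebraic_int_is_int[OF polyfun_algebraic_int[OF g algebraic_int_roots] fixed_Rats[OF g fixed]] .

end

section \<open>Automorphisms of the splitting field\<close>

lemma is_subfield_0: "is_subfield K \<Longrightarrow> 0 \<in> K"
  and is_subfield_1: "is_subfield K \<Longrightarrow> 1 \<in> K"
  and is_subfield_add: "is_subfield K \<Longrightarrow> x \<in> K \<Longrightarrow> y \<in> K \<Longrightarrow> x + y \<in> K"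
  and is_subfield_diff: "is_subfield K \<Longrightarrow> x \<in> K \<Longrightarrow> y \<in> K \<Longrightarrow> x - y \<in> K"
  and is_subfield_mult: "is_subfield K \<Longrightarrow> x \<in> K \<Longrightarrow> y \<in> K \<Longrightarrow> x * y \<in> K"
  and is_subfield_inverse: "is_subfield K \<Longrightarrow> x \<in> K \<Longrightarrow> inverse x \<in> K"
  unfolding is_subfield_def by (blast, blast, blast, blast, blast, cases "x = 0", auto)

lemma is_subfield_of_int:
  assumes "is_subfield K"
  shows "of_int c \<in> K"
proof (induction c rule: int_induct[of _ 0])
  case base show ?case using is_subfield_0[OF assms] by simp
next
  case (step1 i) thus ?case using is_subfield_add[OF assms _ is_subfield_1[OF assms]] by simp
next
  case (step2 i) thus ?case using is_subfield_diff[OF assms _ is_subfield_1[OF assms]] by simp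
qed

lemma polyfun_subfield:
  assumes "g \<in> polyfun n" "is_subfield K" "\<And>i. i < n \<Longrightarrow> a i \<in> K"
  shows "g a \<in> K"
  using assms(1)
  by induction (auto intro: is_subfield_of_int is_subfield_add is_subfield_mult assms(2,3))

lemma gen_subfield_subfield: "is_subfield (gen_subfield R)"
  unfolding gen_subfield_def is_subfield_def by blast

lemma gen_subfield_base: "R \<subseteq> gen_subfield R"
  unfolding gen_subfield_def by blast

lemma gen_subfield_least: "R \<subseteq> K \<Longrightarrow> is_subfield K \<Longrightarrow> gen_subfield R \<subseteq> K"
  unfolding gen_subfield_def by blast

text \<open>\<open>field_aut_on\<close> asks for compatibility with sum and product only. That 1 is
  fixed comes from injectivity: \<open>\<phi> 1\<close> is a nonzero idempotent.\<close>

lemma field_aut_on_props: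
  assumes K: "is_subfield K" and phi: "field_aut_on K \<phi>"
  shows "\<phi> 0 = 0" "\<phi> 1 = 1" "inj_on \<phi> K"
    "\<And>x y. x \<in> K \<Longrightarrow> y \<in> K \<Longrightarrow> \<phi> (x + y) = \<phi> x + \<phi> y"
    "\<And>x y. x \<in> K \<Longrightarrow> y \<in> K \<Longrightarrow> \<phi> (x * y) = \<phi> x * \<phi> y"
    "\<phi> (of_int c) = of_int c"
proof -
  show add: "\<phi> (x + y) = \<phi> x + \<phi> y" if "x \<in> K" "y \<in> K" for x y
    using phi that by (auto simp: field_aut_on_def)
  show mult: "\<phi> (x * y) = \<phi> x * \<phi> y" if "x \<in> K" "y \<in> K" for x y
    using phi that by (auto simp: field_aut_on_def)
  show inj: "inj_on \<phi> K" using phi by (auto simp: field_aut_on_def bij_betw_def)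
  note K0 = is_subfield_0[OF K] and K1 = is_subfield_1[OF K]
  show 0: "\<phi> 0 = 0" using add[OF K0 K0] by simp
  have "\<phi> 1 \<noteq> 0" using inj_onD[OF inj _ K1 K0] 0 by auto
  thus 1: "\<phi> 1 = 1" using mult[OF K1 K1] by simp
  show "\<phi> (of_int c) = of_int c"
  proof (induction c rule: int_induct[of _ 0])
    case base show ?case using 0 by simp
  next
    case (step1 i) thus ?case using add[OF is_subfield_of_int[OF K, of i] K1] 1 by simp
  next
    case (step2 i)
    have "\<phi> (of_int (i - 1) + 1) = \<phi> (of_int (i - 1)) + 1"
      using add[OF is_subfield_of_int[OF K, of "i - 1"] K1] 1 by simp
    thus ?case using step2 by (simp add: eq_diff_eq)
  qed
qed

lemma field_aut_on_poly:
  fixes q :: "int poly"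
  assumes K: "is_subfield K" and phi: "field_aut_on K \<phi>" and x: "x \<in> K"
  shows "\<phi> (poly (of_int_poly q) x) = poly (of_int_poly q) (\<phi> x) \<and> poly (of_int_poly q) x \<in> K"
proof (induction q)
  case 0
  show ?case using field_aut_on_props(1)[OF K phi] is_subfield_0[OF K] by simp
next
  case (pCons c q)
  note pr = field_aut_on_props[OF K phi]
  have 1: "x * poly (of_int_poly q) x \<in> K" using is_subfield_mult[OF K x] pCons by auto
  have 2: "of_int c \<in> K" by (rule is_subfield_of_int[OF K])
  show ?case using pr(4)[OF 2 1] pr(5)[OF x, of "poly (of_int_poly q) x"] pCons pr(6)[of c] is_subfield_add[OF K 2 1]
    by simp
qed

text \<open>An automorphism fixes the integer coefficients of \<open>p\<close>, so it maps roots to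
  roots; since there are finitely many, injectivity suffices.\<close>

lemma galois_perms_permutes:
  assumes "p \<noteq> 0" and s: "\<sigma> \<in> galois_perms p"
  shows "\<sigma> permutes complex_roots p"
proof -
  let ?Z = "complex_roots p" and ?K = "gen_subfield (complex_roots p)"
  obtain \<phi> where phi: "field_aut_on ?K \<phi>" "\<And>z. z \<in> ?Z \<Longrightarrow> \<sigma> z = \<phi> z" "\<And>z. z \<notin> ?Z \<Longrightarrow> \<sigma> z = z"
    using s unfolding galois_perms_def by auto
  note K = gen_subfield_subfield[of ?Z]
  have fin: "finite ?Z" unfolding complex_roots_def by (rule poly_roots_finite) (use assms in simp)
  have "\<sigma> z \<in> ?Z" if "z \<in> ?Z" for z
  proof -
    have "z \<in> ?K" using gen_subfield_base that by auto
    from field_aut_on_poly[OF K phi(1) this, of p]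
    have "poly (of_int_poly p) (\<phi> z) = \<phi> 0" using that by (simp add: complex_roots_def)
    thus ?thesis using phi(2)[OF that] field_aut_on_props(1)[OF K phi(1)] by (simp add: complex_roots_def)
  qed
  hence "\<sigma> ` ?Z \<subseteq> ?Z" by auto
  moreover have "inj_on \<sigma> ?Z"
    using field_aut_on_props(3)[OF K phi(1)] gen_subfield_base[of ?Z] phi(2)
    by (auto simp: inj_on_def)
  ultimately have "bij_betw \<sigma> ?Z ?Z" using endo_inj_surj[OF fin] by (auto simp: bij_betw_def)
  thus ?thesis by (rule bij_imp_permutes) (use phi(3) in auto)
qed

context int_roots
begin

lemma p_nonzero: "p \<noteq> 0"
proof
  assume "p = 0"
  hence "(\<Prod>i<n. [:- a i, 1:]) = 0" using p_roots by simp
  thus False by (simp add: prod_zero_iff)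
qed

lemma degree_p: "degree p = n"
proof -
  have "degree (of_int_poly p :: complex poly) = n"
    unfolding p_roots by (subst degree_prod_sum_eq) auto
  thus ?thesis by simp
qed

lemma complex_roots_eq: "complex_roots p = a ` {..<n}"
  unfolding complex_roots_def p_roots by (auto simp: poly_prod)

end

context int_roots_inj
begin

text \<open>The splitting field in explicit form: a fraction of integer polynomials in the roots
  shows at once where a permutation of the roots has to send it.\<close>

definition Frac :: "complex set" where
  "Frac = {g a / h a | g h. g \<in> polyfun n \<and> h \<in> polyfun n \<and> h a \<noteq> 0}"

lemma FracI: "g \<in> polyfun n \<Longrightarrow> h \<in> polyfun n \<Longrightarrow> h a \<noteq> 0 \<Longrightarrow> g a / h a \<in> Frac"
  by (auto simp: Frac_def)

lemma FracE:
  assumes "x \<in> Frac"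
  obtains g h where "g \<in> polyfun n" "h \<in> polyfun n" "h a \<noteq> 0" "x = g a / h a"
  using assms by (auto simp: Frac_def)

lemma Frac_subfield: "is_subfield Frac"
  unfolding is_subfield_def
proof (intro conjI ballI impI)
  show "0 \<in> Frac" using FracI[OF polyfun_0 polyfun_1] by simp
  show "1 \<in> Frac" using FracI[OF polyfun_1 polyfun_1] by simp
next
  fix x y assume "x \<in> Frac" "y \<in> Frac"
  then obtain g h g' h' where *: "g \<in> polyfun n" "h \<in> polyfun n" "h a \<noteq> 0" "x = g a / h a"
    "g' \<in> polyfun n" "h' \<in> polyfun n" "h' a \<noteq> 0" "y = g' a / h' a"
    by (elim FracE)
  have h: "(\<lambda>a. h a * h' a) \<in> polyfun n" by (intro polyfun_mult *)
  have "(\<lambda>a. g a * h' a + g' a * h a) \<in> polyfun n" by (intro polyfun_mult polyfun_add *)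
  from FracI[OF this h] show "x + y \<in> Frac" using *(3,7) unfolding *(4,8) by (simp add: add_frac_eq)
  have "(\<lambda>a. g a * h' a - g' a * h a) \<in> polyfun n" by (intro polyfun_mult polyfun_diff *)
  from FracI[OF this h] show "x - y \<in> Frac" using *(3,7) unfolding *(4,8) by (simp add: diff_frac_eq)
  have "(\<lambda>a. g a * g' a) \<in> polyfun n" by (intro polyfun_mult *)
  from FracI[OF this h] show "x * y \<in> Frac" using *(3,7) unfolding *(4,8) by simp
next
  fix x assume "x \<in> Frac" "x \<noteq> 0"
  thus "inverse x \<in> Frac" using FracI by (elim FracE) auto
qed

lemma gen_subfield_roots: "gen_subfield (complex_roots p) = Frac"
proof
  show "gen_subfield (complex_roots p) \<subseteq> Frac"
  proof (rule gen_subfield_least[OF _ Frac_subfield])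
    show "complex_roots p \<subseteq> Frac"
      unfolding complex_roots_eq using FracI[OF polyfun_var polyfun_1] by auto
  qed
  show "Frac \<subseteq> gen_subfield (complex_roots p)"
  proof
    fix x assume "x \<in> Frac"
    then obtain g h where *: "g \<in> polyfun n" "h \<in> polyfun n" "h a \<noteq> 0" "x = g a / h a" by (elim FracE)
    have r: "a i \<in> gen_subfield (complex_roots p)" if "i < n" for i
      using gen_subfield_base[of "complex_roots p"] that unfolding complex_roots_eq by auto
    note sf = gen_subfield_subfield[of "complex_roots p"]
    show "x \<in> gen_subfield (complex_roots p)"
      unfolding * divide_inverse
      by (intro is_subfield_mult is_subfield_inverse sf polyfun_subfield[OF *(1) sf] polyfun_subfield[OF *(2) sf] r)
  qed
qed

definition galmap :: "(nat \<Rightarrow> nat) \<Rightarrow> complex \<Rightarrow> complex" where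
  "galmap s x = (SOME y. \<exists>g h. g \<in> polyfun n \<and> h \<in> polyfun n \<and> h a \<noteq> 0 \<and> x = g a / h a \<and> y = g (a \<circ> s) / h (a \<circ> s))"

text \<open>The value is independent of the chosen fraction: \<open>g / h = g' / h'\<close> amounts
  to the relation \<open>g * h' - g' * h = 0\<close> between the roots, which \<open>s\<close>
  preserves.\<close>

lemma galmap_eq:
  assumes s: "s \<in> Gal" and b: "b = a \<circ> s" and *: "g \<in> polyfun n" "h \<in> polyfun n" "h a \<noteq> 0"
  shows "galmap s (g a / h a) = g b / h b"
proof -
  have "\<exists>y g' h'. g' \<in> polyfun n \<and> h' \<in> polyfun n \<and> h' a \<noteq> 0 \<and> g a / h a = g' a / h' a \<and> y = g' (a \<circ> s) / h' (a \<circ> s)"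
    using * by blast
  from someI_ex[OF this] obtain g' h' where g': "g' \<in> polyfun n" "h' \<in> polyfun n" "h' a \<noteq> 0"
    "g a / h a = g' a / h' a" "galmap s (g a / h a) = g' (a \<circ> s) / h' (a \<circ> s)"
    unfolding galmap_def by blast
  have nz: "h b \<noteq> 0" "h' b \<noteq> 0" using Gal_zero_iff[OF s] * g' unfolding b by auto
  have "(\<lambda>a. g a * h' a - g' a * h a) \<in> polyfun n" by (intro polyfun_mult polyfun_diff * g')
  from Gal_zero_iff[OF s this] g'(3,4) *(3)
  have "g b * h' b - g' b * h b = 0" unfolding b by (simp add: frac_eq_eq)
  thus ?thesis using nz unfolding g'(5)[folded b] by (simp add: frac_eq_eq)
qed

lemma galmap_aut:
  assumes s: "s \<in> Gal"
  shows "field_aut_on Frac (galmap s)"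
proof -
  define b where b: "b = a \<circ> s"
  note gm = galmap_eq[OF s b]
  have ops: "galmap s (x + y) = galmap s x + galmap s y \<and> galmap s (x * y) = galmap s x * galmap s y"
    if "x \<in> Frac" "y \<in> Frac" for x y
  proof -
    obtain g h g' h' where *: "g \<in> polyfun n" "h \<in> polyfun n" "h a \<noteq> 0" "x = g a / h a"
      "g' \<in> polyfun n" "h' \<in> polyfun n" "h' a \<noteq> 0" "y = g' a / h' a"
      using \<open>x \<in> Frac\<close> \<open>y \<in> Frac\<close> by (elim FracE)
    have nz: "h b \<noteq> 0" "h' b \<noteq> 0" using Gal_zero_iff[OF s] * unfolding b by auto
    have h: "(\<lambda>a. h a * h' a) \<in> polyfun n" by (intro polyfun_mult *)
    have "(\<lambda>a. g a * h' a + g' a * h a) \<in> polyfun n" by (intro polyfun_mult polyfun_add *)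
    from gm[OF this h] gm[OF *(1-3)] gm[OF *(5-7)]
    have 1: "galmap s (x + y) = galmap s x + galmap s y" using *(3,7) nz unfolding *(4,8) by (simp add: add_frac_eq)
    have "(\<lambda>a. g a * g' a) \<in> polyfun n" by (intro polyfun_mult *)
    from gm[OF this h] gm[OF *(1-3)] gm[OF *(5-7)]
    have "galmap s (x * y) = galmap s x * galmap s y" using *(3,7) nz unfolding *(4,8) by simp
    with 1 show ?thesis ..
  qed
  have "bij_betw (galmap s) Frac Frac"
    unfolding bij_betw_def
  proof
    show "inj_on (galmap s) Frac"
    proof (rule inj_onI)
      fix x y assume "x \<in> Frac" "y \<in> Frac" and eq: "galmap s x = galmap s y"
      then obtain g h g' h' where *: "g \<in> polyfun n" "h \<in> polyfun n" "h a \<noteq> 0" "x = g a / h a"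
        "g' \<in> polyfun n" "h' \<in> polyfun n" "h' a \<noteq> 0" "y = g' a / h' a"
        by (elim FracE)
      have nz: "h b \<noteq> 0" "h' b \<noteq> 0" using Gal_zero_iff[OF s] * unfolding b by auto
      have "g b * h' b - g' b * h b = 0"
        using eq nz unfolding *(4,8) gm[OF *(1-3)] gm[OF *(5-7)] by (simp add: frac_eq_eq)
      moreover have "(\<lambda>a. g a * h' a - g' a * h a) \<in> polyfun n" by (intro polyfun_mult polyfun_diff *)
      ultimately have "g a * h' a - g' a * h a = 0" using Gal_zero_iff[OF s] unfolding b by blast
      thus "x = y" using *(3,7) unfolding *(4,8) by (simp add: frac_eq_eq)
    qed
    show "galmap s ` Frac = Frac"
    proof
      show "galmap s ` Frac \<subseteq> Frac"
      proof
        fix y assume "y \<in> galmap s ` Frac"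
        then obtain x where x: "x \<in> Frac" "y = galmap s x" by auto
        then obtain g h where *: "g \<in> polyfun n" "h \<in> polyfun n" "h a \<noteq> 0" "x = g a / h a" by (elim FracE)
        have P: "(\<lambda>a. g (a \<circ> s)) \<in> polyfun n" "(\<lambda>a. h (a \<circ> s)) \<in> polyfun n"
          using polyfun_Perms[OF _ Gal_Perms[OF s]] * by auto
        have "h (a \<circ> s) \<noteq> 0" using Gal_zero_iff[OF s] * by auto
        from FracI[OF P this] show "y \<in> Frac" unfolding x(2) *(4) gm[OF *(1-3)] b .
      qed
      show "Frac \<subseteq> galmap s ` Frac"
      proof
        fix x assume "x \<in> Frac"
        then obtain g h where *: "g \<in> polyfun n" "h \<in> polyfun n" "h a \<noteq> 0" "x = g a / h a" by (elim FracE)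
        \<comment> \<open>\<open>u\<close> is inverse to \<open>s\<close>, so precomposing numerator
          and denominator with \<open>u\<close> gives a preimage.\<close>
        obtain u where u: "u \<in> Gal" "id = s \<circ> u" using Gal_left_surj[OF s] id_Gal by (auto simp: image_iff)
        have P: "(\<lambda>a. g (a \<circ> u)) \<in> polyfun n" "(\<lambda>a. h (a \<circ> u)) \<in> polyfun n"
          using polyfun_Perms[OF _ Gal_Perms[OF u(1)]] * by auto
        have nz: "h (a \<circ> u) \<noteq> 0" using Gal_zero_iff[OF u(1)] * by auto
        have "galmap s (g (a \<circ> u) / h (a \<circ> u)) = x"
          unfolding gm[OF P nz] b *(4) comp_assoc u(2)[symmetric] by simp
        thus "x \<in> galmap s ` Frac" using FracI[OF P nz] by blast
      qed
    qed
  qed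
  thus ?thesis using ops by (simp add: field_aut_on_def)
qed

lemma Gal_galois_perms:
  assumes s: "s \<in> Gal" and \<sigma>: "\<And>i. i < n \<Longrightarrow> \<sigma> (a i) = a (s i)" "\<And>z. z \<notin> a ` {..<n} \<Longrightarrow> \<sigma> z = z"
  shows "\<sigma> \<in> galois_perms p"
proof -
  have "galmap s (a i) = a (s i)" if "i < n" for i
    using galmap_eq[OF s refl polyfun_var[OF that] polyfun_1] by simp
  thus ?thesis unfolding galois_perms_def gen_subfield_roots
    using galmap_aut[OF s] \<sigma> by (intro CollectI exI[of _ "galmap s"]) (auto simp: complex_roots_eq)
qed

text \<open>The passage from index permutations to \<open>galois_perms\<close>. A permutation of the
  roots becomes one of the indices through the inverse of the bijection \<open>a\<close>, and
  membership in \<open>Gal\<close> then extends it to the splitting field.\<close>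

lemma galois_full_symmetricI:
  assumes full: "Gal = Perms"
  shows "galois_full_symmetric p"
  unfolding galois_full_symmetric_def
proof (intro conjI)
  show "p \<noteq> 0" by (rule p_nonzero)
  show "card (complex_roots p) = degree p"
    unfolding complex_roots_eq degree_p using card_image[OF inj_a] by simp
  show "{\<sigma>. \<sigma> permutes complex_roots p} = galois_perms p"
  proof
    show "galois_perms p \<subseteq> {\<sigma>. \<sigma> permutes complex_roots p}"
      using galois_perms_permutes[OF p_nonzero] by auto
    show "{\<sigma>. \<sigma> permutes complex_roots p} \<subseteq> galois_perms p"
    proof
      fix \<sigma> assume "\<sigma> \<in> {\<sigma>. \<sigma> permutes complex_roots p}"
      hence \<sigma>: "\<sigma> permutes a ` {..<n}" by (simp add: complex_roots_eq)
      define s where "s = (\<lambda>i. if i < n then the_inv_into {..<n} a (\<sigma> (a i)) else i)"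
      have bij: "bij_betw a {..<n} (a ` {..<n})" using inj_a by (simp add: bij_betw_def)
      have as: "a (s i) = \<sigma> (a i)" if "i < n" for i
        using f_the_inv_into_f_bij_betw[OF bij] permutes_in_image[OF \<sigma>, of "a i"] that by (auto simp: s_def)
      have "bij_betw (\<lambda>i. the_inv_into {..<n} a (\<sigma> (a i))) {..<n} {..<n}"
        using bij_betw_trans[OF bij_betw_trans[OF bij permutes_imp_bij[OF \<sigma>]] bij_betw_the_inv_into[OF bij]]
        by (simp add: comp_def)
      hence "bij_betw s {..<n} {..<n}" by (subst bij_betw_cong[of _ s]) (auto simp: s_def)
      hence "s permutes {..<n}" by (rule bij_imp_permutes) (auto simp: s_def)
      hence "s \<in> Gal" using full by (simp add: Perms_def)
      thus "\<sigma> \<in> galois_perms p"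
        by (rule Gal_galois_perms) (use as permutes_not_in[OF \<sigma>] in auto)
    qed
  qed
qed

end

section \<open>Frobenius elements\<close>

context prime_above
begin

lemma P_0: "0 \<in> P" using P_mult[of 0, OF _ P_l] by simp
lemma P_uminus: "x \<in> P \<Longrightarrow> - x \<in> P" using P_mult[of "-1" x] by simp
lemma P_diff: "x \<in> P \<Longrightarrow> y \<in> P \<Longrightarrow> x - y \<in> P" using P_add[of x "-y"] P_uminus[of y] by simp
lemma P_sum: "(\<And>i. i \<in> I \<Longrightarrow> f i \<in> P) \<Longrightarrow> sum f I \<in> P"
  by (induction I rule: infinite_finite_induct) (auto intro: P_0 P_add)
lemma P_mult_right: "algebraic_int a \<Longrightarrow> x \<in> P \<Longrightarrow> x * a \<in> P"
  using P_mult by (simp add: mult.commute)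

lemma P_prod_prime:
  "finite I \<Longrightarrow> (\<And>i. i \<in> I \<Longrightarrow> algebraic_int (f i)) \<Longrightarrow> prod f I \<in> P \<Longrightarrow> \<exists>i\<in>I. f i \<in> P"
proof (induction I rule: finite_induct)
  case empty thus ?case using P_1 by simp
next
  case (insert x I)
  hence "f x * prod f I \<in> P" "algebraic_int (f x)" "algebraic_int (prod f I)"
    by (auto intro: algebraic_int_prod)
  from P_prime[OF this(2,3,1)] insert show ?case by auto
qed

text \<open>An integer prime to \<open>l\<close> in \<open>P\<close> would put 1 into
  \<open>P\<close> by Bezout. So the prime field embeds into the quotient by
  \<open>P\<close>.\<close>

lemma P_of_int_iff: "of_int k \<in> P \<longleftrightarrow> int l dvd k"
proof
  assume "int l dvd k"
  then obtain c where "k = c * int l" by (auto simp: dvd_def mult.commute)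
  thus "of_int k \<in> P" using P_mult[OF _ P_l, of "of_int c"] by simp
next
  assume k: "of_int k \<in> P"
  show "int l dvd k"
  proof (rule ccontr)
    assume "\<not> int l dvd k"
    hence "coprime (int l) k" using prime_l by (simp add: prime_imp_coprime)
    then obtain u v where "u * int l + v * k = 1" by (metis bezout_int coprime_iff_gcd_eq_1)
    hence "of_int u * of_nat l + of_int v * of_int k = (1::complex)"
      by (metis of_int_1 of_int_add of_int_mult of_int_of_nat_eq)
    moreover have "of_int u * of_nat l + of_int v * of_int k \<in> P" by (intro P_add P_mult P_l k) auto
    ultimately show False using P_1 by simp
  qed
qed

definition congP :: "complex \<Rightarrow> complex \<Rightarrow> bool" where "congP x y \<longleftrightarrow> x - y \<in> P"

lemma congP_refl [simp]: "congP x x" by (simp add: congP_def P_0)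
lemma congP_sym: "congP x y \<Longrightarrow> congP y x" unfolding congP_def using P_uminus by fastforce
lemma congP_trans [trans]: "congP x y \<Longrightarrow> congP y z \<Longrightarrow> congP x z" unfolding congP_def using P_add[of "x - y" "y - z"] by simp
lemma congP_add: "congP x y \<Longrightarrow> congP x' y' \<Longrightarrow> congP (x + x') (y + y')"
  unfolding congP_def using P_add[of "x - y" "x' - y'"] by (simp add: algebra_simps)
lemma congP_sum: "(\<And>i. i \<in> I \<Longrightarrow> congP (f i) (g i)) \<Longrightarrow> congP (sum f I) (sum g I)"
  by (induction I rule: infinite_finite_induct) (auto intro: congP_add)
lemma congP_mult: "congP x y \<Longrightarrow> congP x' y' \<Longrightarrow> algebraic_int x' \<Longrightarrow> algebraic_int y \<Longrightarrow> congP (x * x') (y * y')"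
proof -
  assume *: "congP x y" "congP x' y'" "algebraic_int x'" "algebraic_int y"
  have "(x - y) * x' + y * (x' - y') \<in> P"
    using * by (intro P_add P_mult P_mult_right) (auto simp: congP_def)
  thus ?thesis by (simp add: congP_def algebra_simps)
qed
lemma congP_power: "congP x y \<Longrightarrow> algebraic_int x \<Longrightarrow> algebraic_int y \<Longrightarrow> congP (x ^ k) (y ^ k)"
  by (induction k) (auto intro!: congP_mult algebraic_int_power)

lemma l_pos: "l > 0" using prime_l prime_gt_0_nat by blast

lemma frob_add:
  assumes "algebraic_int x" "algebraic_int y"
  shows "congP ((x + y) ^ l) (x ^ l + y ^ l)"
proof -
  have "(x + y) ^ l = (\<Sum>k\<le>l. of_nat (l choose k) * x ^ k * y ^ (l - k))" by (rule binomial_ring)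
  also have "\<dots> = (\<Sum>k\<in>{0,l} \<union> {0<..<l}. of_nat (l choose k) * x ^ k * y ^ (l - k))"
    by (rule sum.cong) auto
  also have "\<dots> = (\<Sum>k\<in>{0,l}. of_nat (l choose k) * x ^ k * y ^ (l - k)) +
                  (\<Sum>k\<in>{0<..<l}. of_nat (l choose k) * x ^ k * y ^ (l - k))"
    by (rule sum.union_disjoint) auto
  also have "(\<Sum>k\<in>{0,l}. of_nat (l choose k) * x ^ k * y ^ (l - k)) = x ^ l + y ^ l"
    using l_pos by simp
  finally have "(x + y) ^ l - (x ^ l + y ^ l) = (\<Sum>k\<in>{0<..<l}. of_nat (l choose k) * x ^ k * y ^ (l - k))"
    by simp
  also have "\<dots> \<in> P"
  proof (rule P_sum)
    fix k assume "k \<in> {0<..<l}"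
    hence "l dvd (l choose k)" using prime_l by (intro dvd_choose_prime) auto
    hence "of_int (int (l choose k)) \<in> P" unfolding P_of_int_iff by simp
    hence "of_nat (l choose k) \<in> P" by simp
    thus "of_nat (l choose k) * x ^ k * y ^ (l - k) \<in> P"
      using assms by (intro P_mult_right algebraic_int_power)
  qed
  finally show ?thesis by (simp add: congP_def)
qed

lemma frob_sum:
  "(\<And>i. i \<in> I \<Longrightarrow> algebraic_int (f i)) \<Longrightarrow> congP (sum f I ^ l) (\<Sum>i\<in>I. f i ^ l)"
proof (induction I rule: infinite_finite_induct)
  case (insert x I)
  have "congP ((f x + sum f I) ^ l) (f x ^ l + sum f I ^ l)"
    using insert by (intro frob_add algebraic_int_sum) auto
  also have "congP (f x ^ l + sum f I ^ l) (f x ^ l + (\<Sum>i\<in>I. f i ^ l))"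
    using insert by (intro congP_add) auto
  finally show ?case using insert by simp
qed (use l_pos in \<open>auto simp: zero_power\<close>)

text \<open>Fermat's little theorem, applied to the natural number
  \<open>nat (c mod int l)\<close>.\<close>

lemma frob_Ints:
  assumes "x \<in> \<int>"
  shows "congP (x ^ l) x"
proof -
  obtain c where c: "x = of_int c" using assms by (auto elim: Ints_cases)
  have "[c ^ l = c] (mod int l)"
  proof (cases "int l dvd c")
    case True
    hence "int l dvd c ^ l" using l_pos by (simp add: dvd_power_iff_le dvd_trans)
    thus ?thesis using True by (simp add: cong_iff_dvd_diff)
  next
    case False
    have ge: "c mod int l \<ge> 0" using l_pos by simp
    have nd: "\<not> l dvd nat (c mod int l)"
    proof
      assume "l dvd nat (c mod int l)"
      hence "int l dvd int (nat (c mod int l))" by (simp only: int_dvd_int_iff)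
      hence "int l dvd c mod int l" unfolding int_nat_eq using ge by simp
      thus False using False by (simp add: dvd_mod_iff)
    qed
    have "[nat (c mod int l) ^ (l - 1) = 1] (mod l)" by (rule fermat_theorem[OF prime_l nd])
    hence "[int (nat (c mod int l)) ^ (l - 1) = 1] (mod int l)" by (metis cong_int_iff of_nat_1 of_nat_power)
    moreover have "[c = int (nat (c mod int l))] (mod int l)" using ge by (simp add: cong_def)
    ultimately have "[c ^ (l - 1) = 1] (mod int l)" using cong_pow cong_trans by blast
    hence "[c * c ^ (l - 1) = c * 1] (mod int l)" by (rule cong_scalar_left)
    thus ?thesis using l_pos by (simp flip: power_Suc)
  qed
  hence "int l dvd c ^ l - c" by (simp add: cong_iff_dvd_diff)
  hence "of_int (c ^ l - c) \<in> P" by (simp only: P_of_int_iff)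
  thus ?thesis by (simp add: c congP_def)
qed

definition integral_poly :: "complex poly \<Rightarrow> bool" where "integral_poly q \<longleftrightarrow> (\<forall>i. algebraic_int (coeff q i))"
definition poly_in_P :: "complex poly \<Rightarrow> bool" where "poly_in_P q \<longleftrightarrow> (\<forall>i. coeff q i \<in> P)"
definition pcongP :: "complex poly \<Rightarrow> complex poly \<Rightarrow> bool" where "pcongP q r \<longleftrightarrow> (\<forall>i. congP (coeff q i) (coeff r i))"
text \<open>Frobenius on the coefficients alone, with the indeterminate left in place; modulo
  \<open>P\<close> this is additive and multiplicative.\<close>

definition frob_poly :: "complex poly \<Rightarrow> complex poly" where "frob_poly q = map_poly (\<lambda>x. x ^ l) q"

lemma coeff_frob_poly: "coeff (frob_poly q) i = coeff q i ^ l"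
  unfolding frob_poly_def using l_pos by (simp add: coeff_map_poly)

lemma integral_poly_1: "integral_poly 1" by (simp add: integral_poly_def coeff_1)
lemma integral_poly_mult: "integral_poly q \<Longrightarrow> integral_poly r \<Longrightarrow> integral_poly (q * r)"
  by (auto simp: integral_poly_def coeff_mult intro!: algebraic_int_sum algebraic_int_times)
lemma integral_poly_diff: "integral_poly q \<Longrightarrow> integral_poly r \<Longrightarrow> integral_poly (q - r)"
  by (auto simp: integral_poly_def intro!: algebraic_int_diff)
lemma integral_poly_prod: "(\<And>i. i \<in> I \<Longrightarrow> integral_poly (f i)) \<Longrightarrow> integral_poly (prod f I)"
  by (induction I rule: infinite_finite_induct) (auto intro: integral_poly_1 integral_poly_mult)
lemma integral_poly_power: "integral_poly q \<Longrightarrow> integral_poly (q ^ k)"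
  by (induction k) (auto intro: integral_poly_1 integral_poly_mult)
lemma integral_poly_frob_poly: "integral_poly q \<Longrightarrow> integral_poly (frob_poly q)"
  by (auto simp: integral_poly_def coeff_frob_poly intro: algebraic_int_power)
lemma integral_poly_linear: "algebraic_int x \<Longrightarrow> integral_poly [:- x, 1:]"
  by (auto simp: integral_poly_def coeff_pCons split: nat.splits)

lemma pcongP_refl: "pcongP q q" by (simp add: pcongP_def)
lemma pcongP_sym: "pcongP q r \<Longrightarrow> pcongP r q" by (auto simp: pcongP_def intro: congP_sym)
lemma pcongP_trans [trans]: "pcongP q r \<Longrightarrow> pcongP r s \<Longrightarrow> pcongP q s"
  unfolding pcongP_def using congP_trans by blast
lemma pcongP_add: "pcongP q r \<Longrightarrow> pcongP q' r' \<Longrightarrow> pcongP (q + q') (r + r')"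
  by (auto simp: pcongP_def intro: congP_add)
lemma pcongP_sum: "(\<And>i. i \<in> I \<Longrightarrow> pcongP (f i) (g i)) \<Longrightarrow> pcongP (sum f I) (sum g I)"
  by (induction I rule: infinite_finite_induct) (auto intro: pcongP_refl pcongP_add)
lemma pcongP_mult: "pcongP q r \<Longrightarrow> pcongP q' r' \<Longrightarrow> integral_poly q' \<Longrightarrow> integral_poly r \<Longrightarrow> pcongP (q * q') (r * r')"
  unfolding pcongP_def integral_poly_def coeff_mult by (intro allI congP_sum congP_mult) auto
lemma frob_poly_mult: "integral_poly q \<Longrightarrow> integral_poly r \<Longrightarrow> pcongP (frob_poly (q * r)) (frob_poly q * frob_poly r)"
  unfolding pcongP_def coeff_frob_poly coeff_mult integral_poly_def power_mult_distrib[symmetric]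
  by (intro allI frob_sum algebraic_int_times) auto

lemma frob_poly_sum: "(\<And>i. i \<in> I \<Longrightarrow> integral_poly (f i)) \<Longrightarrow> pcongP (frob_poly (sum f I)) (\<Sum>i\<in>I. frob_poly (f i))"
  unfolding pcongP_def coeff_frob_poly coeff_sum integral_poly_def by (intro allI frob_sum) auto

lemma frob_poly_1: "frob_poly 1 = 1" using l_pos by (intro poly_eqI) (auto simp: coeff_frob_poly coeff_1)
lemma frob_poly_0: "frob_poly 0 = 0" using l_pos by (intro poly_eqI) (auto simp: coeff_frob_poly)

lemma frob_poly_prod:
  "(\<And>i. i \<in> I \<Longrightarrow> integral_poly (f i)) \<Longrightarrow> pcongP (frob_poly (prod f I)) (\<Prod>i\<in>I. frob_poly (f i))"
proof (induction I rule: infinite_finite_induct)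
  case (insert x I)
  have "pcongP (frob_poly (f x * prod f I)) (frob_poly (f x) * frob_poly (prod f I))"
    using insert by (intro frob_poly_mult integral_poly_prod) auto
  also have "pcongP (frob_poly (f x) * frob_poly (prod f I)) (frob_poly (f x) * (\<Prod>i\<in>I. frob_poly (f i)))"
    using insert by (intro pcongP_mult pcongP_refl integral_poly_frob_poly integral_poly_prod) auto
  finally show ?case using insert by simp
qed (auto simp: frob_poly_1 intro: pcongP_refl)

lemma frob_poly_power: "integral_poly q \<Longrightarrow> pcongP (frob_poly (q ^ k)) (frob_poly q ^ k)"
  using frob_poly_prod[of "{..<k}" "\<lambda>_. q"] by simp

lemma frob_poly_Ints: "(\<And>i. coeff q i \<in> \<int>) \<Longrightarrow> pcongP (frob_poly q) q"
  by (auto simp: pcongP_def coeff_frob_poly intro: frob_Ints)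

text \<open>Gauss's lemma for \<open>P\<close>: if \<open>i\<close> and \<open>j\<close> are the
  least indices of coefficients outside \<open>P\<close>, the coefficient of \<open>q * r\<close> of
  index \<open>i + j\<close> is congruent to the product of these two coefficients, hence outside
  \<open>P\<close>.\<close>

lemma poly_in_P_prime:
  assumes q: "integral_poly q" and r: "integral_poly r" and qr: "poly_in_P (q * r)"
  shows "poly_in_P q \<or> poly_in_P r"
proof (rule ccontr)
  assume "\<not> (poly_in_P q \<or> poly_in_P r)"
  then obtain i0 j0 where "coeff q i0 \<notin> P" "coeff r j0 \<notin> P" by (auto simp: poly_in_P_def)
  hence "\<exists>i. coeff q i \<notin> P" "\<exists>j. coeff r j \<notin> P" by blast+
  then obtain i j where "coeff q i \<notin> P \<and> (\<forall>k<i. \<not> coeff q k \<notin> P)" "coeff r j \<notin> P \<and> (\<forall>k<j. \<not> coeff r k \<notin> P)"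
    by (subst (asm) (1 2) exists_least_iff) blast
  hence i: "coeff q i \<notin> P" "\<And>k. k < i \<Longrightarrow> coeff q k \<in> P"
    and j: "coeff r j \<notin> P" "\<And>k. k < j \<Longrightarrow> coeff r k \<in> P" by auto
  have "coeff (q * r) (i + j) = coeff q i * coeff r j + (\<Sum>k\<in>{..i+j} - {i}. coeff q k * coeff r (i + j - k))"
    unfolding coeff_mult by (subst sum.remove[of _ i]) auto
  moreover have "(\<Sum>k\<in>{..i+j} - {i}. coeff q k * coeff r (i + j - k)) \<in> P"
  proof (rule P_sum)
    fix k assume k: "k \<in> {..i+j} - {i}"
    show "coeff q k * coeff r (i + j - k) \<in> P"
    proof (cases "k < i")
      case True thus ?thesis using i r by (intro P_mult_right) (auto simp: integral_poly_def)
    next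
      case False
      hence "i + j - k < j" using k by auto
      thus ?thesis using j q by (intro P_mult) (auto simp: integral_poly_def)
    qed
  qed
  moreover have "coeff (q * r) (i + j) \<in> P" using qr by (simp add: poly_in_P_def)
  ultimately have "(coeff q i * coeff r j + (\<Sum>k\<in>{..i+j} - {i}. coeff q k * coeff r (i + j - k)))
      - (\<Sum>k\<in>{..i+j} - {i}. coeff q k * coeff r (i + j - k)) \<in> P" by (intro P_diff) auto
  hence "coeff q i * coeff r j \<in> P" by simp
  moreover have "algebraic_int (coeff q i)" "algebraic_int (coeff r j)" using q r by (auto simp: integral_poly_def)
  ultimately show False using P_prime i(1) j(1) by blast
qed

lemma poly_in_P_prod_prime:
  "finite I \<Longrightarrow> (\<And>i. i \<in> I \<Longrightarrow> integral_poly (f i)) \<Longrightarrow> poly_in_P (prod f I) \<Longrightarrow> \<exists>i\<in>I. poly_in_P (f i)"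
proof (induction I rule: finite_induct)
  case empty
  hence "coeff (1 :: complex poly) 0 \<in> P" unfolding poly_in_P_def prod.empty by blast
  thus ?case using P_1 by simp
next
  case (insert x I)
  hence "poly_in_P (f x * prod f I)" "integral_poly (f x)" "integral_poly (prod f I)" by (auto intro: integral_poly_prod)
  from poly_in_P_prime[OF this(2,3,1)] insert show ?case by auto
qed

lemma pcongP_0: "pcongP q 0 \<longleftrightarrow> poly_in_P q" by (simp add: pcongP_def poly_in_P_def congP_def)

end

text \<open>A second indeterminate appears because the roots of the resolvent below are themselves
  polynomials in \<open>u\<close>.\<close>

definition polyfun_bipoly :: "nat \<Rightarrow> ((nat \<Rightarrow> complex) \<Rightarrow> complex poly poly) set" where
  "polyfun_bipoly n = {F. \<forall>k. (\<lambda>a. coeff (F a) k) \<in> polyfun_poly n}"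

lemma polyfun_poly_const_0: "(\<lambda>a. 0) \<in> polyfun_poly n" by (simp add: polyfun_poly_def polyfun_0)

lemma polyfun_bipoly_1: "(\<lambda>a. 1) \<in> polyfun_bipoly n"
  unfolding polyfun_bipoly_def by (auto simp: coeff_1 intro: polyfun_poly_const_0 polyfun_poly_1)

lemma polyfun_bipoly_mult: "F \<in> polyfun_bipoly n \<Longrightarrow> G \<in> polyfun_bipoly n \<Longrightarrow> (\<lambda>a. F a * G a) \<in> polyfun_bipoly n"
  unfolding polyfun_bipoly_def by (auto simp: coeff_mult intro!: polyfun_poly_sum polyfun_poly_mult)

lemma polyfun_bipoly_prod: "(\<And>i. i \<in> I \<Longrightarrow> F i \<in> polyfun_bipoly n) \<Longrightarrow> (\<lambda>a. \<Prod>i\<in>I. F i a) \<in> polyfun_bipoly n"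
  by (induction I rule: infinite_finite_induct) (auto intro: polyfun_bipoly_1 polyfun_bipoly_mult)

lemma polyfun_bipoly_linear:
  assumes "F \<in> polyfun_poly n"
  shows "(\<lambda>a. [:- F a, 1:]) \<in> polyfun_bipoly n"
proof -
  have "(\<lambda>a. coeff [:- F a, 1:] k) \<in> polyfun_poly n" for k
    by (cases k; cases "k - 1") (auto intro: polyfun_poly_const_0 polyfun_poly_1 polyfun_poly_uminus assms)
  thus ?thesis by (simp add: polyfun_bipoly_def)
qed

text \<open>The Frobenius element: with the indeterminate \<open>u\<close> and \<open>\<Theta>(s) = \<Sum>i. a (s i) u^i\<close>,
  the polynomial \<open>\<Prod>s\<in>Gal. (X - \<Theta>(s))\<close> has integer coefficients, so raising coefficients to the
  \<open>l\<close>-th power maps its root \<open>\<Theta>(id)\<close> to another root modulo \<open>P\<close>.\<close>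

locale frobenius = int_roots_inj n a p + prime_above l P for n a p l P
begin

definition Theta :: "(nat \<Rightarrow> complex) \<Rightarrow> complex poly" where
  "Theta b = (\<Sum>i<n. monom (b i) i)"

lemma coeff_Theta: "coeff (Theta b) i = (if i < n then b i else 0)"
  by (simp add: Theta_def coeff_sum)

lemma Theta_polyfun_poly: "s \<in> Perms \<Longrightarrow> (\<lambda>b. Theta (b \<circ> s)) \<in> polyfun_poly n"
proof -
  assume s: "s \<in> Perms"
  have "(\<lambda>b. coeff (Theta (b \<circ> s)) i) \<in> polyfun n" for i
    by (cases "i < n") (auto simp: coeff_Theta Perms_lt[OF s] intro: polyfun_var polyfun_0)
  thus ?thesis by (simp add: polyfun_poly_def)
qed

definition Resol :: "(nat \<Rightarrow> complex) \<Rightarrow> complex poly poly" where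
  "Resol b = (\<Prod>s\<in>Gal. [:- Theta (b \<circ> s), 1:])"

lemma Resol_polyfun_bipoly: "Resol \<in> polyfun_bipoly n"
  unfolding Resol_def[abs_def] by (intro polyfun_bipoly_prod polyfun_bipoly_linear Theta_polyfun_poly Gal_Perms)

lemma Resol_Gal:
  assumes t: "t \<in> Gal"
  shows "Resol (a \<circ> t) = Resol a"
proof -
  have "inj t" using Gal_Perms[OF t] permutes_inj by (auto simp: Perms_def)
  hence "inj_on (\<lambda>u. t \<circ> u) Gal" by (auto simp: inj_on_def fun_eq_iff)
  hence "bij_betw (\<lambda>u. t \<circ> u) Gal Gal" using Gal_left_surj[OF t] by (simp add: bij_betw_def)
  from prod.reindex_bij_betw[OF this, of "\<lambda>s. [:- Theta (a \<circ> s), 1:]"]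
  show ?thesis by (simp add: Resol_def comp_assoc)
qed

lemma coeff_Resol_Ints: "coeff (coeff (Resol a) k) j \<in> \<int>"
proof -
  have "(\<lambda>b. coeff (coeff (Resol b) k) j) \<in> polyfun n"
    using Resol_polyfun_bipoly by (auto simp: polyfun_bipoly_def polyfun_poly_def)
  from fixed_Ints[OF this] show ?thesis by (simp add: Resol_Gal)
qed

text \<open>The indeterminate \<open>u\<close> carries all roots at once, so a single
  \<open>s\<close> works for every index. \<open>poly_in_P_prod_prime\<close> finds a factor of the
  resolvent that vanishes modulo \<open>P\<close>, and its coefficient of \<open>u ^ i\<close> is
  the congruence for \<open>a i\<close>.\<close>

lemma frobenius_element: "\<exists>s\<in>Gal. \<forall>i<n. congP (a (s i)) (a i ^ l)"
proof -
  define C where "C = (\<lambda>k. coeff (Resol a) k)"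
  define T where "T = Theta a"
  define d where "d = degree (Resol a)"
  have CI: "coeff (C k) j \<in> \<int>" for k j by (simp add: C_def coeff_Resol_Ints)
  have PCC: "integral_poly (C k)" for k using CI by (auto simp: integral_poly_def int_imp_algebraic_int)
  have PCTh: "integral_poly (Theta (a \<circ> s))" if "s \<in> Gal" for s
    using algebraic_int_roots Perms_lt[OF Gal_Perms[OF that]] by (auto simp: integral_poly_def coeff_Theta)
  have PCT: "integral_poly T" using algebraic_int_roots by (auto simp: integral_poly_def T_def coeff_Theta)
  have "poly (Resol a) T = (\<Prod>s\<in>Gal. T - Theta (a \<circ> s))" by (simp add: Resol_def poly_prod)
  also have "\<dots> = 0" by (rule prod_zero[OF finite_Gal]) (auto simp: T_def intro!: bexI[OF _ id_Gal])
  finally have 0: "(\<Sum>k\<le>d. C k * T ^ k) = 0" by (simp add: poly_altdef C_def d_def)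
  have "pcongP (frob_poly (\<Sum>k\<le>d. C k * T ^ k)) (\<Sum>k\<le>d. frob_poly (C k * T ^ k))"
    by (intro frob_poly_sum integral_poly_mult PCC integral_poly_power PCT)
  also have "pcongP (\<Sum>k\<le>d. frob_poly (C k * T ^ k)) (\<Sum>k\<le>d. frob_poly (C k) * frob_poly (T ^ k))"
    by (intro pcongP_sum frob_poly_mult PCC integral_poly_power PCT)
  also have "pcongP (\<Sum>k\<le>d. frob_poly (C k) * frob_poly (T ^ k)) (\<Sum>k\<le>d. C k * frob_poly T ^ k)"
    by (intro pcongP_sum pcongP_mult frob_poly_Ints frob_poly_power PCT integral_poly_frob_poly integral_poly_power PCC CI)
  also have "(\<Sum>k\<le>d. C k * frob_poly T ^ k) = poly (Resol a) (frob_poly T)"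
    by (simp add: poly_altdef C_def d_def)
  also have "\<dots> = (\<Prod>s\<in>Gal. frob_poly T - Theta (a \<circ> s))" by (simp add: Resol_def poly_prod)
  finally have "pcongP 0 (\<Prod>s\<in>Gal. frob_poly T - Theta (a \<circ> s))" unfolding 0 frob_poly_0 .
  hence "poly_in_P (\<Prod>s\<in>Gal. frob_poly T - Theta (a \<circ> s))" using pcongP_sym pcongP_0 by blast
  moreover have "integral_poly (frob_poly T - Theta (a \<circ> s))" if "s \<in> Gal" for s
    by (intro integral_poly_diff integral_poly_frob_poly PCT PCTh that)
  ultimately obtain s where s: "s \<in> Gal" "poly_in_P (frob_poly T - Theta (a \<circ> s))"
    using poly_in_P_prod_prime[OF finite_Gal] by meson
  have "congP (a i ^ l) (a (s i))" if "i < n" for i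
  proof -
    have "coeff (frob_poly T - Theta (a \<circ> s)) i \<in> P" using s(2) by (simp add: poly_in_P_def)
    thus ?thesis using that by (simp add: congP_def coeff_frob_poly T_def coeff_Theta)
  qed
  with s(1) show ?thesis by (intro bexI[of _ s]) (auto intro: congP_sym)
qed

end

section \<open>Factorization patterns modulo a prime\<close>

definition zeta :: "nat \<Rightarrow> complex" where "zeta n = cis (2 * pi / real n)"

lemma zeta_power: "zeta n ^ k = cis (2 * pi * real k / real n)"
  by (simp add: zeta_def DeMoivre mult_ac)

lemma zeta_power_n [simp]: "n > 0 \<Longrightarrow> zeta n ^ n = 1"
  by (simp add: zeta_power)

lemma zeta_power_mod:
  assumes "n > 0"
  shows "zeta n ^ (k mod n) = zeta n ^ k"
proof -
  have "zeta n ^ k = zeta n ^ (n * (k div n) + k mod n)" by simp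
  also have "\<dots> = zeta n ^ (k mod n)" unfolding power_add power_mult using assms by simp
  finally show ?thesis by simp
qed

lemma zeta_power_inj:
  assumes "a < n" "b < n" "zeta n ^ a = zeta n ^ b"
  shows "a = b"
proof -
  have "bij_betw (\<lambda>k. cis (2 * pi * real k / real n)) {..<n} {z. z ^ n = 1}"
    by (rule bij_betw_roots_unity) (use assms in auto)
  thus ?thesis using assms by (auto simp: bij_betw_def inj_on_def zeta_power)
qed

lemma algebraic_int_zeta: "n > 0 \<Longrightarrow> algebraic_int (zeta n ^ k)"
proof -
  assume n: "n > 0"
  have "algebraic_int (zeta n)"
    by (rule algebraic_int_root[where y = 1 and p = "monom 1 n"]) (use n in \<open>auto simp: poly_monom degree_monom_eq\<close>)
  thus ?thesis by (rule algebraic_int_power)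
qed

context prime_above
begin

text \<open>If \<open>x \<noteq> 1\<close>, the sum of the powers of \<open>x\<close> is 0, yet
  modulo \<open>P\<close> it is \<open>n\<close>, which is prime to \<open>l\<close>.\<close>

lemma root_unity_congP_1:
  assumes n: "n > 0" "\<not> l dvd n" and x: "x ^ n = 1" "algebraic_int x" "congP x 1"
  shows "x = 1"
proof (rule ccontr)
  assume "x \<noteq> 1"
  hence "(\<Sum>k<n. x ^ k) = 0" using x(1) by (simp add: sum_gp_strict)
  moreover have "congP (\<Sum>k<n. x ^ k) (\<Sum>k<n. 1)"
    by (rule congP_sum) (use congP_power[OF x(3,2)] in auto)
  ultimately have "congP 0 (of_nat n)" by simp
  hence "- of_nat n \<in> P" by (simp add: congP_def)
  hence "of_int (int n) \<in> P" using P_uminus by fastforce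
  thus False using n by (simp only: P_of_int_iff int_dvd_int_iff)
qed

lemma zeta_congP_inj:
  assumes n: "\<not> l dvd n" and ab: "a < n" "b < n" and congP: "congP (zeta n ^ a) (zeta n ^ b)"
  shows "a = b"
proof -
  have *: "a = b" if ab: "a < n" "b < n" "congP (zeta n ^ a) (zeta n ^ b)" "a \<le> b" for a b
  proof -
    have n0: "n > 0" using ab by simp
    \<comment> \<open>Multiplying by the inverse of \<open>zeta n ^ a\<close> reduces to a root of
      unity congruent to 1.\<close>
    have "congP (zeta n ^ (n - a) * zeta n ^ b) (zeta n ^ (n - a) * zeta n ^ a)"
      by (intro congP_mult congP_refl congP_sym[OF ab(3)] algebraic_int_zeta n0)
    moreover have "zeta n ^ (n - a) * zeta n ^ a = 1"
      using ab n0 by (simp flip: power_add)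
    moreover have "zeta n ^ (n - a) * zeta n ^ b = zeta n ^ (b - a)"
    proof -
      have "n - a + b = n + (b - a)" using ab by simp
      hence "zeta n ^ (n - a) * zeta n ^ b = zeta n ^ n * zeta n ^ (b - a)"
        by (simp only: power_add[symmetric])
      thus ?thesis using n0 by simp
    qed
    ultimately have "congP (zeta n ^ (b - a)) 1" by simp
    moreover have "(zeta n ^ (b - a)) ^ n = 1"
      using n0 by (metis mult.commute power_mult power_one zeta_power_n)
    ultimately have "zeta n ^ (b - a) = 1" using root_unity_congP_1[OF n0 n] algebraic_int_zeta[OF n0] by blast
    hence "zeta n ^ (b - a) = zeta n ^ 0" by simp
    hence "b - a = 0" using ab by (intro zeta_power_inj) auto
    thus ?thesis using ab by simp
  qed
  show ?thesis using *[of a b] *[of b a] ab congP congP_sym by (cases "a \<le> b") auto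
qed

lemma poly_in_P_poly: "poly_in_P q \<Longrightarrow> algebraic_int x \<Longrightarrow> poly q x \<in> P"
  unfolding poly_altdef poly_in_P_def by (intro P_sum P_mult_right algebraic_int_power) auto

lemma pcongP_poly:
  assumes "pcongP q r" "algebraic_int x"
  shows "congP (poly q x) (poly r x)"
proof -
  have "poly_in_P (q - r)" using assms(1) by (simp add: poly_in_P_def pcongP_def congP_def)
  from poly_in_P_poly[OF this assms(2)] show ?thesis by (simp add: congP_def)
qed

text \<open>Each \<open>b j\<close> is a root of the first product modulo \<open>P\<close>, so the
  prime ideal \<open>P\<close> contains some \<open>b j - a i\<close>. As the \<open>b j\<close> are
  incongruent, the choice of \<open>i\<close> is injective, hence a permutation.\<close>

lemma root_matching:
  fixes n :: nat and a b :: "nat \<Rightarrow> complex"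
  assumes a: "\<And>i. i < n \<Longrightarrow> algebraic_int (a i)" and b: "\<And>i. i < n \<Longrightarrow> algebraic_int (b i)"
    and ab: "pcongP (\<Prod>i<n. [:- a i, 1:]) (\<Prod>i<n. [:- b i, 1:])"
    and inj: "\<And>i j. i < n \<Longrightarrow> j < n \<Longrightarrow> congP (b i) (b j) \<Longrightarrow> i = j"
  obtains r where "r permutes {..<n}" "\<And>j. j < n \<Longrightarrow> congP (a (r j)) (b j)"
proof -
  have "\<exists>i<n. congP (a i) (b j)" if j: "j < n" for j
  proof -
    have "congP (poly (\<Prod>i<n. [:- a i, 1:]) (b j)) (poly (\<Prod>i<n. [:- b i, 1:]) (b j))"
      using pcongP_poly[OF ab b[OF j]] .
    moreover have "poly (\<Prod>i<n. [:- b i, 1:]) (b j) = 0"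
      unfolding poly_prod by (rule prod_zero) (use j in auto)
    ultimately have "poly (\<Prod>i<n. [:- a i, 1:]) (b j) \<in> P" by (simp add: congP_def)
    hence "(\<Prod>i<n. b j - a i) \<in> P" by (simp add: poly_prod)
    hence "\<exists>i\<in>{..<n}. b j - a i \<in> P" by (intro P_prod_prime) (auto intro: algebraic_int_diff a b j)
    thus ?thesis using congP_sym by (auto simp: congP_def[symmetric])
  qed
  then obtain r0 where r0: "\<And>j. j < n \<Longrightarrow> r0 j < n \<and> congP (a (r0 j)) (b j)" by metis
  have "inj_on r0 {..<n}"
  proof (rule inj_onI)
    fix i j assume "i \<in> {..<n}" "j \<in> {..<n}" "r0 i = r0 j"
    thus "i = j" using r0[of i] r0[of j] inj[of i j] congP_trans[OF congP_sym, of "a (r0 i)" "b i" "b j"] by auto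
  qed
  hence "bij_betw r0 {..<n} {..<n}"
    using endo_inj_surj[of "{..<n}" r0] r0 by (auto simp: bij_betw_def)
  hence bij: "bij_betw (\<lambda>i. if i < n then r0 i else i) {..<n} {..<n}"
    by (subst bij_betw_cong[of _ _ r0]) auto
  show ?thesis
  proof (rule that)
    show "(\<lambda>i. if i < n then r0 i else i) permutes {..<n}" by (rule bij_imp_permutes[OF bij]) auto
    show "congP (a (if j < n then r0 j else j)) (b j)" if "j < n" for j using r0 that by simp
  qed
qed

lemma integral_poly_synthetic_div:
  assumes q: "integral_poly q" and b: "algebraic_int b"
  shows "integral_poly (synthetic_div q b)"
proof -
  define s where "s = synthetic_div q b"
  have eq: "q + Polynomial.smult b s = pCons (poly q b) s"
    unfolding s_def by (rule synthetic_div_correct)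
  have rec: "coeff s k = coeff q (Suc k) + b * coeff s (Suc k)" for k
    using arg_cong[OF eq, of "\<lambda>q. coeff q (Suc k)"] by simp
  \<comment> \<open>Downward induction on the index, starting at \<open>degree s + 1\<close>, where
    the coefficient is 0.\<close>
  have "algebraic_int (coeff s (degree s + 1 - k))" for k
  proof (induction k)
    case 0 show ?case by (simp add: coeff_eq_0)
  next
    case (Suc k)
    show ?case
    proof (cases "k \<le> degree s")
      case True
      hence "Suc (degree s + 1 - Suc k) = degree s + 1 - k" by simp
      thus ?thesis using Suc q b unfolding rec[of "degree s + 1 - Suc k"]
        by (auto simp: integral_poly_def intro!: algebraic_int_plus algebraic_int_times)
    next
      case False
      thus ?thesis using Suc by simp
    qed
  qed
  from this[of "degree s + 1 - _"] have "algebraic_int (coeff s k)" if "k \<le> degree s + 1" for k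
    using that by (metis diff_diff_cancel)
  moreover have "algebraic_int (coeff s k)" if "k > degree s + 1" for k using that by (simp add: coeff_eq_0)
  ultimately show ?thesis unfolding integral_poly_def s_def by (meson not_le)
qed

text \<open>The usual bound for roots over an integral domain, here modulo \<open>P\<close>: after
  division by \<open>X - b\<close> the other elements of \<open>B\<close> stay roots, because
  \<open>P\<close> is prime and does not contain \<open>x - b\<close>.\<close>

lemma card_roots_mod:
  assumes "integral_poly q" "lead_coeff q = 1" "finite B"
    "\<And>b. b \<in> B \<Longrightarrow> algebraic_int b \<and> poly q b \<in> P"
    "\<And>b b'. b \<in> B \<Longrightarrow> b' \<in> B \<Longrightarrow> congP b b' \<Longrightarrow> b = b'"
  shows "card B \<le> degree q"
  using assms
proof (induction "degree q" arbitrary: q B)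
  case 0
  hence "q = 1" by (metis degree_0_id one_pCons of_nat_1 of_nat_poly)
  hence "B = {}" using 0(5) P_1 by fastforce
  thus ?case by simp
next
  case (Suc d)
  show ?case
  proof (cases "B = {}")
    case False
    then obtain b where b: "b \<in> B" by auto
    define s where "s = synthetic_div q b"
    have q: "q = [:- b, 1:] * s + [:poly q b:]" unfolding s_def by (rule synthetic_div_correct'[symmetric])
    have ds: "degree s = d" using Suc(2) by (simp add: s_def degree_synthetic_div)
    have lead: "lead_coeff s = 1"
    proof -
      have "coeff q (Suc d) = coeff s d"
        by (subst q) (simp add: coeff_eq_0 ds)
      thus ?thesis using Suc(2,4) ds by simp
    qed
    have "card (B - {b}) \<le> degree s"
    proof (rule Suc.hyps(1))
      show "d = degree s" using ds by simp
      show "integral_poly s" unfolding s_def using integral_poly_synthetic_div Suc.prems b by blast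
      show "lead_coeff s = 1" by (rule lead)
      show "finite (B - {b})" using Suc by simp
      show "x = y" if "x \<in> B - {b}" "y \<in> B - {b}" "congP x y" for x y using that Suc by blast
      fix x assume x: "x \<in> B - {b}"
      have "poly q x = (x - b) * poly s x + poly q b"
        using arg_cong[OF q, of "\<lambda>q. poly q x"] by (simp add: algebra_simps)
      moreover have "poly q x \<in> P" "poly q b \<in> P" using Suc.prems b x by auto
      ultimately have "(x - b) * poly s x \<in> P" using P_diff[of "poly q x" "poly q b"] by simp
      moreover have ai: "algebraic_int (poly s x)"
        using \<open>integral_poly s\<close> x Suc.prems unfolding poly_altdef integral_poly_def
        by (intro algebraic_int_sum algebraic_int_times algebraic_int_power) auto
      moreover have "algebraic_int (x - b)" using x b Suc.prems by (intro algebraic_int_diff) auto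
      moreover have "x - b \<notin> P" using Suc.prems(5)[of x b] x b by (auto simp: congP_def)
      ultimately show "algebraic_int x \<and> poly s x \<in> P" using P_prime x Suc.prems by blast
    qed
    thus ?thesis using b Suc(2) ds Suc.prems(3) by (simp add: card_Diff_singleton)
  qed simp
qed

text \<open>The classes of 0, ..., l - 1 are already \<open>l\<close> roots of
  \<open>X ^ l - X\<close> modulo \<open>P\<close>, and a further one would exceed the degree. So
  Frobenius fixes only the prime field.\<close>

lemma frob_fixed:
  assumes y: "algebraic_int y" "congP (y ^ l) y"
  shows "\<exists>c<l. congP y (of_nat c)"
proof (rule ccontr)
  assume neg: "\<not> (\<exists>c<l. congP y (of_nat c))"
  define q :: "complex poly" where "q = monom 1 l + [:0,-1:]"
  define B where "B = insert y (of_nat ` {..<l})"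
  have l2: "l \<ge> 2" using prime_l by (rule prime_ge_2_nat)
  have deg: "degree q = l"
    unfolding q_def using l2 by (subst degree_add_eq_left) (auto simp: degree_monom_eq)
  have lead: "lead_coeff q = 1" unfolding deg unfolding q_def using l2 by (simp add: coeff_pCons split: nat.split)
  have inj: "c = d" if "c < l" "d < l" "congP (of_nat c) (of_nat d)" for c d
  proof -
    have "of_int (int c - int d) \<in> P" using that(3) by (simp add: congP_def)
    hence "int l dvd int c - int d" by (simp only: P_of_int_iff)
    thus ?thesis using that(1,2) by (metis mod_eq_dvd_iff mod_less nat_int of_nat_mod)
  qed
  have "card B \<le> degree q"
  proof (rule card_roots_mod[OF _ lead])
    show "integral_poly q" unfolding q_def integral_poly_def by (auto simp: coeff_pCons split: nat.split intro!: algebraic_int_plus)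
    show "finite B" by (simp add: B_def)
    show "algebraic_int b \<and> poly q b \<in> P" if "b \<in> B" for b
      using that y frob_Ints[of b] by (auto simp: B_def q_def poly_monom congP_def)
    show "b = b'" if "b \<in> B" "b' \<in> B" "congP b b'" for b b'
      using that neg inj congP_sym unfolding B_def by blast
  qed
  moreover have "card B = Suc l"
  proof -
    have "card ((of_nat :: nat \<Rightarrow> complex) ` {..<l}) = l" by (subst card_image) (auto simp: inj_on_def)
    moreover have "y \<notin> of_nat ` {..<l}" using neg congP_refl by auto
    ultimately show ?thesis by (simp add: B_def)
  qed
  ultimately show False using deg by simp
qed

section \<open>Polynomials over the prime field with prescribed roots\<close>

definition rootpoly :: "nat \<Rightarrow> nat \<Rightarrow> (nat \<Rightarrow> nat) \<Rightarrow> complex poly" where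
  "rootpoly N n c = (\<Prod>i<N. [:- (zeta n ^ c i), 1:])"

lemma integral_poly_rootpoly: "n > 0 \<Longrightarrow> integral_poly (rootpoly N n c)"
  unfolding rootpoly_def by (intro integral_poly_prod integral_poly_linear algebraic_int_zeta)

text \<open>Frobenius on the coefficients permutes the roots by \<open>\<pi>\<close> and so fixes
  the polynomial; by \<open>frob_fixed\<close> its coefficients lie in the prime field.\<close>

lemma rootpoly_coeff_congP:
  assumes n: "n > 0" and "odd l" and pi: "\<pi> permutes {..<N}" "\<And>i. i < N \<Longrightarrow> (l * c i) mod n = c (\<pi> i)"
  shows "\<exists>m<l. congP (coeff (rootpoly N n c) k) (of_nat m)"
proof -
  let ?R = "rootpoly N n c"
  have "pcongP (frob_poly ?R) (\<Prod>i<N. frob_poly [:- (zeta n ^ c i), 1:])"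
    unfolding rootpoly_def by (intro frob_poly_prod integral_poly_linear algebraic_int_zeta n)
  also have "(\<Prod>i<N. frob_poly [:- (zeta n ^ c i), 1:]) = (\<Prod>i<N. [:- (zeta n ^ c (\<pi> i)), 1:])"
  proof (rule prod.cong[OF refl])
    fix i assume i: "i \<in> {..<N}"
    have "(zeta n ^ c i) ^ l = zeta n ^ (l * c i)" by (simp add: mult.commute flip: power_mult)
    also have "\<dots> = zeta n ^ c (\<pi> i)" using pi(2)[of i] i zeta_power_mod[OF n, of "l * c i"] by simp
    finally show "frob_poly [:- (zeta n ^ c i), 1:] = [:- (zeta n ^ c (\<pi> i)), 1:]"
      using \<open>odd l\<close> l_pos by (intro poly_eqI) (auto simp: coeff_frob_poly coeff_pCons power_minus_odd split: nat.split)
  qed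
  also have "\<dots> = ?R" unfolding rootpoly_def
    using prod.permute[OF pi(1), of "\<lambda>i. [:- (zeta n ^ c i), 1:]"] by (simp add: comp_def)
  finally have "congP (coeff ?R k ^ l) (coeff ?R k)" by (simp add: pcongP_def coeff_frob_poly)
  thus ?thesis using frob_fixed integral_poly_rootpoly[OF n] by (auto simp: integral_poly_def)
qed

end

text \<open>\<open>c\<close> lists the exponents of the roots \<open>zeta n ^ c i\<close> of a polynomial modulo \<open>P\<close>. Frobenius permutes
  them by \<open>\<pi>\<close>, so the polynomial is defined over the prime field, and the vanishing exponent sum
  makes its constant coefficient \<open>(-1)^N\<close>, as it must be for matrices of determinant 1.\<close>

definition admissible :: "nat \<Rightarrow> nat \<Rightarrow> nat \<Rightarrow> (nat \<Rightarrow> nat) \<Rightarrow> (nat \<Rightarrow> nat) \<Rightarrow> bool" where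
  "admissible l N n \<pi> c \<longleftrightarrow> n > 0 \<and> \<not> l dvd n \<and> odd l \<and> (\<forall>i<N. c i < n) \<and> inj_on c {..<N} \<and>
     \<pi> permutes {..<N} \<and> (\<forall>i<N. (l * c i) mod n = c (\<pi> i)) \<and> n dvd (\<Sum>i<N. c i)"

context prime_above
begin

text \<open>For admissible exponents this is the lift of \<open>rootpoly\<close> to integer
  coefficients in \<open>{0..<l}\<close>. The range makes the lift unique, so that distinct lifts
  are incongruent modulo \<open>l\<close> and can be counted.\<close>

definition redpoly :: "nat \<Rightarrow> nat \<Rightarrow> (nat \<Rightarrow> nat) \<Rightarrow> int poly" where
  "redpoly N n c = (\<Sum>k\<le>N. monom (int (SOME m. m < l \<and> congP (coeff (rootpoly N n c) k) (of_nat m))) k)"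

lemma congP_of_int_iff: "congP (of_int i) (of_int j) \<longleftrightarrow> int l dvd i - j"
  using P_of_int_iff[of "i - j"] by (simp add: congP_def)

lemma degree_rootpoly: "degree (rootpoly N n c) = N"
  unfolding rootpoly_def by (subst degree_prod_sum_eq) auto

lemma coeff_rootpoly_top: "coeff (rootpoly N n c) N = 1"
proof -
  have "lead_coeff (rootpoly N n c) = 1" unfolding rootpoly_def by (subst lead_coeff_prod) auto
  thus ?thesis by (simp add: degree_rootpoly)
qed

lemma coeff_redpoly:
  assumes "admissible l N n \<pi> c" "k \<le> N"
  shows "0 \<le> coeff (redpoly N n c) k" "coeff (redpoly N n c) k < int l"
    "congP (coeff (rootpoly N n c) k) (of_int (coeff (redpoly N n c) k))"
proof -
  have "\<exists>m<l. congP (coeff (rootpoly N n c) k) (of_nat m)"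
    using assms by (intro rootpoly_coeff_congP[of n \<pi>]) (auto simp: admissible_def)
  from someI_ex[OF this] have "(SOME m. m < l \<and> congP (coeff (rootpoly N n c) k) (of_nat m)) < l"
    "congP (coeff (rootpoly N n c) k) (of_nat (SOME m. m < l \<and> congP (coeff (rootpoly N n c) k) (of_nat m)))" by auto
  thus "0 \<le> coeff (redpoly N n c) k" "coeff (redpoly N n c) k < int l"
    "congP (coeff (rootpoly N n c) k) (of_int (coeff (redpoly N n c) k))"
    using assms(2) by (auto simp: redpoly_def coeff_sum)
qed

lemma coeff_redpoly_gt: "k > N \<Longrightarrow> coeff (redpoly N n c) k = 0"
  by (auto simp: redpoly_def coeff_sum)

lemma coeff_redpoly_top:
  assumes "admissible l N n \<pi> c"
  shows "coeff (redpoly N n c) N = 1"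
proof -
  have "congP (of_int 1) (of_int (coeff (redpoly N n c) N))"
    using coeff_redpoly(3)[OF assms order.refl] by (simp add: coeff_rootpoly_top)
  hence "int l dvd 1 - coeff (redpoly N n c) N" by (simp only: congP_of_int_iff)
  hence "1 mod int l = coeff (redpoly N n c) N mod int l" by (simp add: mod_eq_dvd_iff)
  moreover have "l > 1" using prime_l by (rule prime_gt_1_nat)
  ultimately show ?thesis using coeff_redpoly(1,2)[OF assms order.refl] by simp
qed

lemma degree_redpoly:
  assumes "admissible l N n \<pi> c"
  shows "degree (redpoly N n c) = N"
proof (rule antisym)
  show "degree (redpoly N n c) \<le> N" by (rule degree_le) (auto simp: coeff_redpoly_gt)
  show "N \<le> degree (redpoly N n c)" by (rule le_degree) (simp add: coeff_redpoly_top[OF assms])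
qed

lemma pcongP_redpoly:
  assumes "admissible l N n \<pi> c"
  shows "pcongP (of_int_poly (redpoly N n c)) (rootpoly N n c)"
  unfolding pcongP_def
proof
  fix k
  show "congP (coeff (of_int_poly (redpoly N n c)) k) (coeff (rootpoly N n c) k)"
  proof (cases "k \<le> N")
    case True thus ?thesis using coeff_redpoly(3)[OF assms True] congP_sym by simp
  next
    case False thus ?thesis by (simp add: coeff_redpoly_gt coeff_eq_0 degree_rootpoly)
  qed
qed

lemma coeff_redpoly_0:
  assumes "admissible l N n \<pi> c"
  shows "int l dvd coeff (redpoly N n c) 0 - (-1) ^ N"
proof -
  have n: "n > 0" and dv: "n dvd (\<Sum>i<N. c i)" using assms by (auto simp: admissible_def)
  obtain q where q: "(\<Sum>i<N. c i) = n * q" using dv by (auto simp: dvd_def)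
  have "coeff (rootpoly N n c) 0 = (\<Prod>i<N. - (zeta n ^ c i))"
    unfolding rootpoly_def by (simp add: poly_0_coeff_0[symmetric] poly_prod)
  also have "\<dots> = (\<Prod>i<N. - 1) * (\<Prod>i<N. zeta n ^ c i)" by (simp add: prod_uminus)
  also have "(\<Prod>i<N. zeta n ^ c i) = zeta n ^ (\<Sum>i<N. c i)" by (simp add: power_sum)
  also have "\<dots> = 1" using n by (simp add: q power_mult)
  finally have "coeff (rootpoly N n c) 0 = of_int ((-1) ^ N)" by simp
  hence "congP (of_int (coeff (redpoly N n c) 0)) (of_int ((-1) ^ N))"
    using coeff_redpoly(3)[OF assms, of 0] congP_sym by simp
  thus ?thesis by (simp only: congP_of_int_iff)
qed

text \<open>Equal polynomials have the same roots modulo \<open>P\<close>, and roots of unity of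
  order prime to \<open>l\<close> are told apart there. By symmetry the polynomial determines the
  set of exponents; only their order is lost.\<close>

lemma redpoly_eq_image:
  assumes c: "admissible l N n \<pi> c" and c': "admissible l N n \<pi>' c'" and eq: "redpoly N n c = redpoly N n c'"
  shows "c ` {..<N} \<subseteq> c' ` {..<N}"
proof
  fix x assume "x \<in> c ` {..<N}"
  then obtain i where i: "i < N" "x = c i" by auto
  have n: "n > 0" "\<not> l dvd n" "c i < n" using c i by (auto simp: admissible_def)
  have "pcongP (rootpoly N n c') (rootpoly N n c)"
    using pcongP_trans[OF pcongP_sym[OF pcongP_redpoly[OF c']]] pcongP_redpoly[OF c] eq by simp
  from pcongP_poly[OF this algebraic_int_zeta[OF n(1), of "c i"]]
  have "congP (poly (rootpoly N n c') (zeta n ^ c i)) (poly (rootpoly N n c) (zeta n ^ c i))" .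
  moreover have "poly (rootpoly N n c) (zeta n ^ c i) = 0"
    unfolding rootpoly_def poly_prod by (rule prod_zero) (use i in auto)
  ultimately have "poly (rootpoly N n c') (zeta n ^ c i) \<in> P" by (simp add: congP_def)
  hence "(\<Prod>j<N. zeta n ^ c i - zeta n ^ c' j) \<in> P" by (simp add: rootpoly_def poly_prod)
  hence "\<exists>j\<in>{..<N}. zeta n ^ c i - zeta n ^ c' j \<in> P"
    by (intro P_prod_prime) (auto intro: algebraic_int_diff algebraic_int_zeta n)
  then obtain j where j: "j < N" "congP (zeta n ^ c i) (zeta n ^ c' j)" by (auto simp: congP_def)
  have "c' j < n" using c' j by (auto simp: admissible_def)
  from zeta_congP_inj[OF n(2,3) this j(2)] show "x \<in> c' ` {..<N}" using i j by auto
qed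

end

section \<open>Complex roots of an integer polynomial with prescribed reduction\<close>

locale int_roots_mod = int_roots N a p + prime_above l P for N a p l P +
  fixes n \<pi> c
  assumes adm: "admissible l N n \<pi> c"
    and p_cong: "\<And>k. int l dvd coeff p k - coeff (redpoly N n c) k"
begin

lemma n_props: "n > 0" "\<not> l dvd n" "i < N \<Longrightarrow> c i < n" "inj_on c {..<N}" "\<pi> permutes {..<N}"
  "i < N \<Longrightarrow> (l * c i) mod n = c (\<pi> i)"
  using adm by (auto simp: admissible_def)

lemma roots_pcongP: "pcongP (\<Prod>i<N. [:- a i, 1:]) (\<Prod>i<N. [:- (zeta n ^ c i), 1:])"
proof -
  have "pcongP (of_int_poly p) (of_int_poly (redpoly N n c))"
    unfolding pcongP_def using p_cong by (simp add: congP_of_int_iff)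
  also have "pcongP (of_int_poly (redpoly N n c)) (rootpoly N n c)" by (rule pcongP_redpoly[OF adm])
  finally show ?thesis by (simp add: p_roots rootpoly_def)
qed

lemma matching:
  "\<exists>r. r permutes {..<N} \<and> (\<forall>j<N. congP (a (r j)) (zeta n ^ c j))"
proof (rule root_matching[OF _ _ roots_pcongP])
  show "algebraic_int (a i)" if "i < N" for i by (rule algebraic_int_roots[OF that])
  show "algebraic_int (zeta n ^ c i)" for i by (rule algebraic_int_zeta[OF n_props(1)])
  show "i = j" if "i < N" "j < N" "congP (zeta n ^ c i) (zeta n ^ c j)" for i j
    using zeta_congP_inj[OF n_props(2) n_props(3)[OF that(1)] n_props(3)[OF that(2)] that(3)] n_props(4) that
    by (auto simp: inj_on_def)
qed blast

text \<open>The matching carries the incongruence of the \<open>zeta n ^ c i\<close> over to the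
  roots \<open>a i\<close>. This shows that the complex roots are distinct, and it lets a congruence
  between roots be read as an equality of indices.\<close>

lemma roots_incongruent:
  assumes "i < N" "j < N" "congP (a i) (a j)"
  shows "i = j"
proof -
  obtain r where r0: "r permutes {..<N} \<and> (\<forall>j<N. congP (a (r j)) (zeta n ^ c j))" using matching by blast
  note r = conjunct1[OF r0] conjunct2[OF r0, rule_format]
  obtain i' j' where ij: "i' < N" "j' < N" "i = r i'" "j = r j'"
    using permutes_surj[OF r(1)] permutes_in_image[OF r(1)] assms
    by (metis lessThan_iff surjE)
  have "congP (zeta n ^ c i') (a (r i'))" by (rule congP_sym[OF r(2)[OF ij(1)]])
  also have "congP (a (r i')) (a (r j'))" using assms(3) ij by simp
  also have "congP (a (r j')) (zeta n ^ c j')" by (rule r(2)[OF ij(2)])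
  finally have "c i' = c j'"
    by (rule zeta_congP_inj[OF n_props(2) n_props(3)[OF ij(1)] n_props(3)[OF ij(2)]])
  thus ?thesis using ij n_props(4) by (auto simp: inj_on_def)
qed

lemma roots_inj: "inj_on a {..<N}"
  using roots_incongruent by (intro inj_onI) auto

text \<open>The hypothesis on \<open>c\<close> says that no \<open>zeta n ^ c i\<close> is 1 or -1.
  If \<open>a i\<close> squares to 1, then \<open>n\<close> divides \<open>2 * c j\<close> for the
  matching \<open>j\<close>, and \<open>c j < n\<close> leaves only \<open>2 * c j = 0\<close> or
  \<open>2 * c j = n\<close>.\<close>

lemma roots_not_unit:
  assumes c: "\<And>i. i < N \<Longrightarrow> c i \<noteq> 0 \<and> 2 * c i \<noteq> n" and i: "i < N"
  shows "a i \<noteq> 1 \<and> a i \<noteq> -1"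
proof -
  obtain r where r0: "r permutes {..<N} \<and> (\<forall>j<N. congP (a (r j)) (zeta n ^ c j))" using matching by blast
  note r = conjunct1[OF r0] conjunct2[OF r0, rule_format]
  obtain j where j: "j < N" "i = r j"
    using permutes_surj[OF r(1)] permutes_in_image[OF r(1)] i by (metis lessThan_iff surjE)
  have False if "a i * a i = 1"
  proof -
    have "congP (a (r j) * a (r j)) (zeta n ^ c j * zeta n ^ c j)"
      using i j by (intro congP_mult r algebraic_int_roots algebraic_int_zeta n_props) auto
    hence "congP (zeta n ^ 0) (zeta n ^ ((c j + c j) mod n))"
      using that j by (simp add: zeta_power_mod[OF n_props(1)] power_add)
    hence "0 = (c j + c j) mod n" by (intro zeta_congP_inj[OF n_props(2)]) (auto simp: n_props(1))
    hence "n dvd c j + c j" by auto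
    then obtain k where k: "c j + c j = n * k" by (auto simp: dvd_def)
    have "k < 2"
    proof (rule ccontr)
      assume "\<not> k < 2"
      hence "n * 2 \<le> n * k" by (intro mult_le_mono2) simp
      thus False using k n_props(3)[OF j(1)] by linarith
    qed
    hence "k = 0 \<or> k = 1" by auto
    thus False using k c[OF j(1)] by auto
  qed
  thus ?thesis by auto
qed

text \<open>The Frobenius element sends the root congruent to \<open>zeta n ^ c i\<close> to the one
  congruent to \<open>zeta n ^ (l * c i)\<close>, that is, to \<open>zeta n ^ c (\<pi> i)\<close>.
  So the matching \<open>r\<close> conjugates \<open>\<pi>\<close> into \<open>s\<close>.\<close>

lemma cycle_type:
  "\<exists>s\<in>int_roots_inj.Gal N a. \<exists>r. r permutes {..<N} \<and> (\<forall>i<N. s (r i) = r (\<pi> i))"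
proof -
  interpret frobenius N a p l P
    by unfold_locales (rule roots_inj)
  obtain s where s: "s \<in> Gal" "\<forall>i<N. congP (a (s i)) (a i ^ l)" using frobenius_element by auto
  obtain r where r0: "r permutes {..<N} \<and> (\<forall>j<N. congP (a (r j)) (zeta n ^ c j))" using matching by blast
  note r = conjunct1[OF r0] conjunct2[OF r0, rule_format]
  have rN: "r i < N \<longleftrightarrow> i < N" for i using permutes_in_image[OF r(1), of i] by simp
  have pN: "\<pi> i < N \<longleftrightarrow> i < N" for i using permutes_in_image[OF n_props(5), of i] by simp
  have "s (r i) = r (\<pi> i)" if i: "i < N" for i
  proof (rule roots_incongruent)
    show "s (r i) < N" using Perms_lt[OF Gal_Perms[OF s(1)]] rN i by simp
    show "r (\<pi> i) < N" using rN pN i by simp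
    have "congP (a (s (r i))) (a (r i) ^ l)" using s(2) rN i by simp
    also have "congP (a (r i) ^ l) ((zeta n ^ c i) ^ l)"
      using rN i by (intro congP_power r algebraic_int_roots algebraic_int_zeta n_props) auto
    also have "(zeta n ^ c i) ^ l = zeta n ^ c (\<pi> i)"
      using n_props(6)[OF i] zeta_power_mod[OF n_props(1), of "l * c i"] by (simp add: mult.commute flip: power_mult)
    also have "congP (zeta n ^ c (\<pi> i)) (a (r (\<pi> i)))" using r(2) pN i congP_sym by auto
    finally show "congP (a (s (r i))) (a (r (\<pi> i)))" .
  qed
  thus ?thesis using s r by blast
qed

end

section \<open>Permutation groups containing a long cycle and a transposition\<close>

definition fix0_cycle :: "nat \<Rightarrow> nat \<Rightarrow> nat" where
  "fix0_cycle N i = (if 1 \<le> i \<and> i < N - 1 then i + 1 else if i = N - 1 then 1 else i)"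

context int_roots_inj
begin

lemma transpose_conj:
  assumes g: "g \<in> Gal" and t: "Transposition.transpose x y \<in> Gal"
  shows "Transposition.transpose (g x) (g y) \<in> Gal"
proof -
  have gp: "g permutes {..<n}" using Gal_Perms[OF g] by (simp add: Perms_def)
  have "Transposition.transpose (g x) (g y) z = (g \<circ> Transposition.transpose x y \<circ> Hilbert_Choice.inv g) z" for z
  proof -
    obtain w where w: "z = g w" using permutes_surj[OF gp] by (metis surjE)
    have i: "g u = g v \<longleftrightarrow> u = v" for u v using permutes_inj[OF gp] by (auto dest: injD)
    show ?thesis unfolding w by (simp add: permutes_inverses[OF gp] Transposition.transpose_def i)
  qed
  hence "Transposition.transpose (g x) (g y) = g \<circ> Transposition.transpose x y \<circ> Hilbert_Choice.inv g" by blast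
  thus ?thesis using comp_Gal Gal_inv g t by simp
qed

lemma Gal_full_transpositions:
  assumes "\<And>u v. u < n \<Longrightarrow> v < n \<Longrightarrow> u \<noteq> v \<Longrightarrow> Transposition.transpose u v \<in> Gal"
  shows "Gal = Perms"
proof
  show "Gal \<subseteq> Perms" using Gal_Perms by auto
  show "Perms \<subseteq> Gal"
  proof
    fix s assume "s \<in> Perms"
    hence "s permutes {..<n}" by (simp add: Perms_def)
    moreover have "finite {..<n}" by simp
    ultimately show "s \<in> Gal"
    proof (induction rule: permutes_induct)
      case id show ?case by (rule id_Gal)
    next
      case (swap u v q)
      hence "Transposition.transpose u v \<in> Gal" "q \<in> Gal" by (auto intro: assms)
      thus ?case by (rule comp_Gal)
    qed
  qed
qed

text \<open>A root fixed by \<open>Gal\<close> is an integer by \<open>fixed_Ints\<close> and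
  divides the constant coefficient, so it is 1 or -1.\<close>

lemma exists_moved:
  assumes c0: "coeff p 0 = 1 \<or> coeff p 0 = -1" and units: "\<And>i. i < n \<Longrightarrow> a i \<noteq> 1 \<and> a i \<noteq> -1" and b: "b < n"
  shows "\<exists>t\<in>Gal. t b \<noteq> b"
proof (rule ccontr)
  assume neg: "\<not> ?thesis"
  have "a b \<in> \<int>" by (rule fixed_Ints[OF polyfun_var[OF b]]) (use neg in auto)
  then obtain k where k: "a b = of_int k" by (auto elim: Ints_cases)
  have "a b \<in> complex_roots p" using b by (auto simp: complex_roots_eq)
  hence "(of_int (poly p k) :: complex) = 0" by (simp add: complex_roots_def k)
  hence "poly p k = 0" by simp
  moreover obtain c q where "p = pCons c q" by (cases p)
  ultimately have "coeff p 0 = k * - poly q k" by simp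
  hence "k dvd coeff p 0" by (rule dvdI)
  hence "k dvd 1" using c0 by auto
  hence "k = 1 \<or> k = -1" by auto
  thus False using units[OF b] k by auto
qed

text \<open>\<open>s2\<close> is a transposition and \<open>s1\<close> an
  \<open>(n - 1)\<close>-cycle fixing one index. For \<open>n = 2\<close> the transposition alone
  generates everything, hence the guard on \<open>s1\<close>.\<close>

lemma Gal_full:
  assumes n2: "n \<ge> 2" and c0: "coeff p 0 = 1 \<or> coeff p 0 = -1"
    and units: "\<And>i. i < n \<Longrightarrow> a i \<noteq> 1 \<and> a i \<noteq> -1"
    and s2: "s2 \<in> Gal" "r2 permutes {..<n}" "\<And>i. i < n \<Longrightarrow> s2 (r2 i) = r2 (Transposition.transpose 0 1 i)"
    and s1: "n \<ge> 3 \<Longrightarrow> s1 \<in> Gal \<and> r1 permutes {..<n} \<and> (\<forall>i<n. s1 (r1 i) = r1 (fix0_cycle n i))"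
  shows "Gal = Perms"
proof -
  define x where "x = r2 0"
  define y where "y = r2 1"
  have r2lt: "r2 i < n \<longleftrightarrow> i < n" for i using permutes_in_image[OF s2(2), of i] by simp
  have xy: "x < n" "y < n" "x \<noteq> y"
    using n2 r2lt[of 0] r2lt[of 1] permutes_inj[OF s2(2)] by (auto simp: x_def y_def dest: injD)
  have s2t: "s2 = Transposition.transpose x y"
  proof
    fix z
    have s2p: "s2 permutes {..<n}" using Gal_Perms[OF s2(1)] by (simp add: Perms_def)
    show "s2 z = Transposition.transpose x y z"
    proof (cases "z < n")
      case True
      then obtain i where i: "i < n" "z = r2 i" using permutes_surj[OF s2(2)] r2lt by (metis surjE)
      have "r2 u = r2 v \<longleftrightarrow> u = v" for u v using permutes_inj[OF s2(2)] by (auto dest: injD)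
      thus ?thesis using s2(3)[OF i(1)] i unfolding x_def y_def by (auto simp: Transposition.transpose_def)
    next
      case False
      thus ?thesis using permutes_not_in[OF s2p, of z] xy by (auto simp: Transposition.transpose_def)
    qed
  qed
  have t: "Transposition.transpose x y \<in> Gal" using s2(1) s2t by simp
  show ?thesis
  proof (cases "n \<ge> 3")
    case False
    hence "{x,y} = {0,1}" using xy n2 by auto
    moreover have "{u,v} = {0,1}" if "u < n" "v < n" "u \<noteq> v" for u v using that False by auto
    ultimately have "Transposition.transpose u v = Transposition.transpose x y" if "u < n" "v < n" "u \<noteq> v" for u v
      using that by (metis doubleton_eq_iff transpose_commute)
    thus ?thesis using t by (intro Gal_full_transpositions) simp
  next
    case True
    note s1 = s1[OF True]
    have r1p: "r1 permutes {..<n}" using s1 by blast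
    have r1lt: "r1 i < n \<longleftrightarrow> i < n" for i using permutes_in_image[OF r1p, of i] by simp
    define b where "b = r1 0"
    have bn: "b < n" using r1lt[of 0] True by (simp add: b_def)
    have r1_onto: "\<exists>k. 1 \<le> k \<and> k < n \<and> w = r1 k" if "w < n" "w \<noteq> b" for w
    proof -
      obtain k where k: "w = r1 k" using permutes_surj[OF r1p] by (metis surjE)
      hence "k < n" using that r1lt by simp
      moreover have "k \<noteq> 0"
      proof
        assume "k = 0"
        thus False using that k b_def by simp
      qed
      ultimately show ?thesis using k by (intro exI[of _ k]) auto
    qed
    have s1b: "s1 b = b" using s1 True by (auto simp: b_def fix0_cycle_def)
    \<comment> \<open>Powers of the cycle carry \<open>r1 1\<close> to every index other than
      \<open>b\<close> while fixing \<open>b\<close>.\<close>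
    have h: "\<exists>h\<in>Gal. h b = b \<and> h (r1 1) = r1 (Suc k)" if "Suc k < n" for k
      using that
    proof (induction k)
      case 0 show ?case by (rule bexI[OF _ id_Gal]) auto
    next
      case (Suc k)
      then obtain h where h: "h \<in> Gal" "h b = b" "h (r1 1) = r1 (Suc k)" by auto
      have "fix0_cycle n (Suc k) = Suc (Suc k)" using Suc.prems by (simp add: fix0_cycle_def)
      hence "s1 (r1 (Suc k)) = r1 (Suc (Suc k))" using s1 Suc.prems by auto
      thus ?case using h s1 s1b comp_Gal[of s1 h] by (intro bexI[of _ "s1 \<circ> h"]) auto
    qed
    have stab: "\<exists>h\<in>Gal. h b = b \<and> h z = w" if zw: "z < n" "z \<noteq> b" "w < n" "w \<noteq> b" for z w
    proof -
      obtain j k where "z = r1 (Suc j)" "Suc j < n" "w = r1 (Suc k)" "Suc k < n"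
        using r1_onto[OF zw(1,2)] r1_onto[OF zw(3,4)] by (metis Suc_le_D One_nat_def)
      then obtain g h where g: "g \<in> Gal" "g b = b" "g (r1 1) = z" and h: "h \<in> Gal" "h b = b" "h (r1 1) = w"
        using h[of j] h[of k] by auto
      have gp: "g permutes {..<n}" using Gal_Perms[OF g(1)] by (simp add: Perms_def)
      have "Hilbert_Choice.inv g b = b" "Hilbert_Choice.inv g z = r1 1"
        using g permutes_inverses(2)[OF gp] by metis+
      thus ?thesis using comp_Gal[OF h(1) Gal_inv[OF g(1)]] h
        by (intro bexI[of _ "h \<circ> Hilbert_Choice.inv g"]) auto
    qed
    \<comment> \<open>One element moving \<open>b\<close> joins the two orbits of the stabilizer of
      \<open>b\<close>, which makes the group transitive.\<close>
    obtain \<tau> where tau: "\<tau> \<in> Gal" "\<tau> b \<noteq> b" using exists_moved[OF c0 units bn] by auto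
    have taub: "\<tau> b < n" using Perms_lt[OF Gal_Perms[OF tau(1)]] bn by simp
    have trans: "\<exists>g\<in>Gal. g b = w" if wn: "w < n" for w
    proof (cases "w = b")
      case True thus ?thesis by (intro bexI[OF _ id_Gal]) auto
    next
      case False
      obtain h where "h \<in> Gal" "h (\<tau> b) = w" using stab[OF taub tau(2) wn False] by auto
      thus ?thesis using comp_Gal[of h \<tau>] tau by (intro bexI[of _ "h \<circ> \<tau>"]) auto
    qed
    have inv_pt: "\<exists>w. g w = v \<and> w < n" if "g \<in> Gal" "v < n" for g v
      using Perms_lt[OF Gal_Perms[OF that(1)]] Gal_Perms[OF that(1)] that(2) permutes_surj
      unfolding Perms_def by (metis mem_Collect_eq surjE)
    \<comment> \<open>Conjugation turns the given transposition into one of \<open>b\<close> and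
      some \<open>z\<close>. The stabilizer of \<open>b\<close> then yields all transpositions
      involving \<open>b\<close>, and transitivity yields the rest.\<close>
    obtain g where g: "g \<in> Gal" "g b = x" using trans[OF xy(1)] by auto
    obtain z where z: "g z = y" "z < n" using inv_pt[OF g(1) xy(2)] by auto
    have gp: "g permutes {..<n}" using Gal_Perms[OF g(1)] by (simp add: Perms_def)
    have "Transposition.transpose (Hilbert_Choice.inv g x) (Hilbert_Choice.inv g y) \<in> Gal"
      by (rule transpose_conj[OF Gal_inv[OF g(1)] t])
    hence tz: "Transposition.transpose b z \<in> Gal"
      using g(2) z(1) permutes_inverses(2)[OF gp] by metis
    have zb: "z \<noteq> b" using g z xy by auto
    have tb: "Transposition.transpose b w \<in> Gal" if w: "w < n" "w \<noteq> b" for w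
    proof -
      obtain h where "h \<in> Gal" "h b = b" "h z = w" using stab[OF z(2) zb w] by auto
      thus ?thesis using transpose_conj[OF _ tz, of h] by simp
    qed
    show ?thesis
    proof (rule Gal_full_transpositions)
      fix u v assume uv: "u < n" "v < n" "u \<noteq> v"
      obtain g where g: "g \<in> Gal" "g b = u" using trans[OF uv(1)] by auto
      obtain w where w: "g w = v" "w < n" using inv_pt[OF g(1) uv(2)] by auto
      have "w \<noteq> b" using w g uv by auto
      from transpose_conj[OF g(1) tb[OF w(2) this]] show "Transposition.transpose u v \<in> Gal"
        using g w by simp
    qed
  qed
qed

end

section \<open>Counting patterns\<close>

lemma card_le_image_fibres:
  assumes "finite A" "\<And>y. y \<in> f ` A \<Longrightarrow> card {x \<in> A. f x = y} \<le> b"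
  shows "card A \<le> card (f ` A) * b"
proof -
  have "card A = (\<Sum>y\<in>f ` A. card {x \<in> A. f x = y})"
    using sum.image_gen[OF assms(1), of "\<lambda>_. 1::nat" f] by simp
  also have "\<dots> \<le> (\<Sum>y\<in>f ` A. b)" by (rule sum_mono) (rule assms(2))
  finally show ?thesis by simp
qed

context prime_above
begin

text \<open>By \<open>redpoly_eq_image\<close> the lists in one fibre have their entries in a common
  set of at most \<open>N\<close> exponents, which leaves at most \<open>N ^ N\<close>
  lists.\<close>

lemma card_redpolys:
  assumes Cl: "finite Cl" "\<And>xs. xs \<in> Cl \<Longrightarrow> length xs = N \<and> admissible l N n \<pi> ((!) xs)"
  shows "card Cl \<le> card ((\<lambda>xs. redpoly N n ((!) xs)) ` Cl) * N ^ N"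
proof (rule card_le_image_fibres[OF Cl(1)])
  fix y assume "y \<in> (\<lambda>xs. redpoly N n ((!) xs)) ` Cl"
  then obtain xs where xs: "xs \<in> Cl" "y = redpoly N n ((!) xs)" by auto
  have im: "(!) ys ` {..<N} = set ys" if "length ys = N" for ys :: "nat list"
    using that by (auto simp: in_set_conv_nth)
  have "{ys \<in> Cl. redpoly N n ((!) ys) = y} \<subseteq> {ys. set ys \<subseteq> set xs \<and> length ys = N}"
  proof
    fix ys assume "ys \<in> {ys \<in> Cl. redpoly N n ((!) ys) = y}"
    hence ys: "ys \<in> Cl" "redpoly N n ((!) ys) = y" by simp_all
    have "(!) ys ` {..<N} \<subseteq> (!) xs ` {..<N}"
      using redpoly_eq_image[of N n \<pi> "(!) ys" \<pi> "(!) xs"] Cl(2)[OF xs(1)] Cl(2)[OF ys(1)] ys xs by auto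
    thus "ys \<in> {ys. set ys \<subseteq> set xs \<and> length ys = N}"
      using im[of ys] im[of xs] Cl(2)[OF xs(1)] Cl(2)[OF ys(1)] by simp
  qed
  hence "card {ys \<in> Cl. redpoly N n ((!) ys) = y} \<le> card {ys. set ys \<subseteq> set xs \<and> length ys = N}"
    by (intro card_mono finite_lists_length_eq) auto
  also have "\<dots> = card (set xs) ^ N" by (intro card_lists_length_eq) auto
  also have "\<dots> \<le> N ^ N" using card_length[of xs] Cl(2)[OF xs(1)] by (intro power_mono) auto
  finally show "card {ys \<in> Cl. redpoly N n ((!) ys) = y} \<le> N ^ N" .
qed

end

lemma fix0_cycle_permutes:
  assumes "N \<ge> 2"
  shows "fix0_cycle N permutes {..<N}"
proof (rule bij_imp_permutes)
  have "inj_on (fix0_cycle N) {..<N}" by (auto simp: inj_on_def fix0_cycle_def split: if_splits)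
  moreover have "fix0_cycle N ` {..<N} \<subseteq> {..<N}" using assms by (auto simp: fix0_cycle_def)
  ultimately show "bij_betw (fix0_cycle N) {..<N} {..<N}" using endo_inj_surj[of "{..<N}"] by (auto simp: bij_betw_def)
qed (use assms in \<open>auto simp: fix0_cycle_def\<close>)

text \<open>Roots of \<open>(X - b) g\<close> with \<open>g\<close> irreducible of degree \<open>d\<close>: the conjugates of a generator of the field
  with \<open>l^d\<close> elements, and the inverse \<open>b\<close> of its norm (written with exponent \<open>l^d - 2\<close>, which is
  \<open>-1\<close> modulo \<open>l^d - 1\<close>).\<close>

definition cycle_exponents :: "nat \<Rightarrow> nat \<Rightarrow> nat \<Rightarrow> nat list" where
  "cycle_exponents l d c = (((l ^ d - 2) * (c * (\<Sum>i<d. l ^ i))) mod (l ^ d - 1)) # map (\<lambda>i. (c * l ^ i) mod (l ^ d - 1)) [0..<d]"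

text \<open>For \<open>n = l ^ d - 1\<close>, the divisibility excluded here says that the
  \<open>j\<close>-th iterate of Frobenius fixes \<open>zeta n ^ c\<close>. Excluding it makes the
  \<open>d\<close> conjugates distinct, so the element lies in no proper subfield.\<close>

definition cycle_params :: "nat \<Rightarrow> nat \<Rightarrow> nat set" where
  "cycle_params l d = {c. c < l ^ d - 1 \<and> (\<forall>j\<in>{1..<d}. \<not> (l ^ d - 1) dvd c * (l ^ j - 1))}"

lemma geo_sum_nat: "(l - 1) * (\<Sum>i<d. l ^ i) = (l::nat) ^ d - 1"
proof (cases "l = 0")
  case False
  have "int ((l - 1) * (\<Sum>i<d. l ^ i)) = (int l - 1) * (\<Sum>i<d. int l ^ i)" using False by (simp add: of_nat_diff)
  also have "\<dots> = int l ^ d - 1" by (rule power_diff_1_eq[symmetric])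
  also have "\<dots> = int (l ^ d - 1)" using False by (simp add: of_nat_diff)
  finally show ?thesis by (simp only: of_nat_eq_iff)
qed (cases d, auto)

lemma admissible_cycle_exponents:
  assumes l: "odd l" "l \<ge> 3" and d: "d \<ge> 2" and c: "c \<in> cycle_params l d"
  shows "admissible l (Suc d) (l ^ d - 1) (fix0_cycle (Suc d)) ((!) (cycle_exponents l d c))"
proof -
  define n where "n = l ^ d - 1"
  define M where "M = (\<Sum>i<d. l ^ i)"
  define c0 where "c0 = ((n - 1) * (c * M)) mod n"
  have ld: "l ^ d \<ge> l" using l d by (simp add: self_le_power)
  have n0: "n > 0" "n \<ge> 2" "Suc n = l ^ d" using ld l by (auto simp: n_def)
  have nth0: "cycle_exponents l d c ! 0 = c0"
  proof -
    have "l ^ d - 2 = n - 1" by (simp add: n_def)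
    thus ?thesis by (simp add: cycle_exponents_def c0_def n_def M_def)
  qed
  have nthS: "cycle_exponents l d c ! Suc i = (c * l ^ i) mod n" if "i < d" for i
    using that by (simp add: cycle_exponents_def n_def)
  have ndvd: "\<not> l dvd n"
  proof
    assume "l dvd n"
    moreover have "l dvd Suc n" unfolding n0(3) using d by (intro dvd_power) auto
    ultimately have "l dvd Suc n - n" by (rule dvd_diff_nat[rotated])
    thus False using l by simp
  qed
  have cop: "coprime (l ^ i) n" for i
  proof -
    have "coprime (Suc n) n" by simp
    hence "coprime (l ^ d) n" unfolding n0(3) .
    hence "coprime l n" using d by simp
    thus ?thesis by simp
  qed
  have Mn: "(l - 1) * M = n" unfolding M_def n_def by (rule geo_sum_nat)
  have no: "\<not> [c * l ^ j = c] (mod n)" if "0 < j" "j < d" for j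
  proof
    assume "[c * l ^ j = c] (mod n)"
    hence "n dvd c * l ^ j - c" using l by (simp add: cong_def mod_eq_dvd_iff_nat)
    hence "n dvd c * (l ^ j - 1)" by (simp add: diff_mult_distrib2)
    thus False using c that by (auto simp: cycle_params_def n_def)
  qed
  have nin: "i = j" if ij: "i < d" "j < d" "(c * l ^ i) mod n = (c * l ^ j) mod n" for i j
  proof -
    have *: False if "i < j" "j < d" "(c * l ^ i) mod n = (c * l ^ j) mod n" for i j
    proof -
      have "[l ^ i * (c * l ^ (j - i)) = l ^ i * c] (mod n)"
        using that by (simp add: cong_def mult_ac flip: power_add)
      hence "[c * l ^ (j - i) = c] (mod n)" using cong_mult_lcancel_nat[OF cop] by blast
      thus False using no[of "j - i"] that by auto
    qed
    show ?thesis using *[of i j] *[of j i] ij by (metis linorder_neqE_nat)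
  qed
  \<comment> \<open>\<open>c0\<close> belongs to an element of the prime field: since
    \<open>(l - 1) * M = n\<close>, multiplying a multiple of \<open>M\<close> by \<open>l\<close>
    changes nothing modulo \<open>n\<close>.\<close>
  have c0fix: "(l * c0) mod n = c0"
  proof -
    have "[l * c0 = l * ((n - 1) * (c * M))] (mod n)" unfolding c0_def by (simp add: cong_def mod_mult_right_eq)
    also have "l * ((n - 1) * (c * M)) = (n - 1) * (c * M) + n * ((n - 1) * c)"
    proof -
      have "l * ((n - 1) * (c * M)) = (n - 1) * (c * M) + (l - 1) * ((n - 1) * (c * M))"
        using l by (cases l) auto
      also have "(l - 1) * ((n - 1) * (c * M)) = ((l - 1) * M) * ((n - 1) * c)" by (simp only: mult_ac)
      finally show ?thesis unfolding Mn .
    qed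
    also have "[(n - 1) * (c * M) + n * ((n - 1) * c) = (n - 1) * (c * M)] (mod n)" by (simp add: cong_def)
    finally show ?thesis by (simp add: cong_def c0_def)
  qed
  \<comment> \<open>If the extra root were one of the conjugates, Frobenius would fix that
    conjugate, against \<open>no\<close> for exponent 1; here \<open>d \<ge> 2\<close>
    enters.\<close>
  have c0ne: "c0 \<noteq> (c * l ^ i) mod n" if "i < d" for i
  proof
    assume "c0 = (c * l ^ i) mod n"
    hence "[l * (c * l ^ i) = c * l ^ i] (mod n)" using c0fix by (metis cong_def mod_mult_right_eq)
    hence "[l ^ i * (c * l ^ 1) = l ^ i * c] (mod n)" by (simp add: mult_ac)
    hence "[c * l ^ 1 = c] (mod n)" using cong_mult_lcancel_nat[OF cop] by blast
    thus False using no[of 1] d by auto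
  qed
  have n_lt: "cycle_exponents l d c ! i < n" if "i < Suc d" for i
    using that n0 by (cases i) (auto simp: nth0 nthS c0_def)
  have "inj_on ((!) (cycle_exponents l d c)) {..<Suc d}"
  proof (rule inj_onI)
    fix i j assume ij: "i \<in> {..<Suc d}" "j \<in> {..<Suc d}" "cycle_exponents l d c ! i = cycle_exponents l d c ! j"
    show "i = j"
    proof (cases i)
      case 0
      show ?thesis
      proof (cases j)
        case (Suc j')
        thus ?thesis using ij 0 c0ne[of j'] nth0 nthS[of j'] by simp
      qed (use 0 in simp)
    next
      case (Suc i')
      show ?thesis
      proof (cases j)
        case 0
        thus ?thesis using ij Suc c0ne[of i'] nth0 nthS[of i'] by simp
      next
        case j: (Suc j')
        thus ?thesis using ij Suc nin[of i' j'] nthS[of i'] nthS[of j'] by simp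
      qed
    qed
  qed
  moreover have "(l * cycle_exponents l d c ! i) mod n = cycle_exponents l d c ! (fix0_cycle (Suc d) i)" if i: "i < Suc d" for i
  proof (cases i)
    case 0
    thus ?thesis using d c0fix by (simp add: fix0_cycle_def nth0)
  next
    case (Suc j)
    show ?thesis
    proof (cases "Suc j < d")
      case True
      hence "(l * (c * l ^ j)) mod n = cycle_exponents l d c ! Suc (Suc j)" by (simp add: nthS mult_ac)
      thus ?thesis using Suc True by (simp add: fix0_cycle_def nthS mod_mult_right_eq)
    next
      case False
      hence j: "Suc j = d" using i Suc by simp
      have "(l * (c * l ^ j)) mod n = (c * l ^ d) mod n" using j by (auto simp: mult_ac)
      also have "\<dots> = (c + n * c) mod n" using n0(3) by (metis mult.commute mult_Suc)
      also have "\<dots> = c mod n" by simp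
      also have "c mod n = cycle_exponents l d c ! Suc 0" using d nthS[of 0] by simp
      also have "cycle_exponents l d c ! Suc 0 = cycle_exponents l d c ! (fix0_cycle (Suc d) i)" using Suc j d by (simp add: fix0_cycle_def)
      also have "(l * (c * l ^ j)) mod n = (l * cycle_exponents l d c ! i) mod n"
        using nthS[of j] Suc j by (simp add: mod_mult_right_eq)
      finally show ?thesis .
    qed
  qed
  moreover have "n dvd (\<Sum>i<Suc d. cycle_exponents l d c ! i)"
  proof -
    have "(\<Sum>i<Suc d. cycle_exponents l d c ! i) = c0 + (\<Sum>i<d. (c * l ^ i) mod n)"
      unfolding sum.lessThan_Suc_shift by (simp add: nth0 nthS)
    moreover have "[c0 + (\<Sum>i<d. (c * l ^ i) mod n) = (n - 1) * (c * M) + (\<Sum>i<d. c * l ^ i)] (mod n)"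
      by (intro cong_add cong_sum) (auto simp: c0_def)
    \<comment> \<open>The conjugates contribute \<open>c * M\<close> to the exponent sum and the
      extra root contributes \<open>n - 1\<close> times this.\<close>
    moreover have "(n - 1) * (c * M) + (\<Sum>i<d. c * l ^ i) = n * (c * M)"
    proof -
      have "(\<Sum>i<d. c * l ^ i) = c * M" by (simp add: M_def sum_distrib_left)
      thus ?thesis using n0(1) by (cases n) simp_all
    qed
    ultimately have "[(\<Sum>i<Suc d. cycle_exponents l d c ! i) = n * (c * M)] (mod n)" by simp
    thus ?thesis by (metis cong_dvd_iff dvd_triv_left)
  qed
  ultimately show ?thesis
    unfolding admissible_def n_def[symmetric]
    using n0 ndvd l n_lt fix0_cycle_permutes[of "Suc d"] d by auto
qed

text \<open>For each \<open>j\<close> at most \<open>l ^ j - 1\<close> values of \<open>c\<close>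
  are excluded: the quotient of \<open>c * (l ^ j - 1)\<close> by \<open>n\<close> determines such a
  \<open>c\<close> and is smaller than \<open>l ^ j - 1\<close>.\<close>

lemma card_cycle_params:
  assumes l: "l \<ge> 2" and d: "d \<ge> 1"
  shows "l ^ d \<le> card (cycle_params l d) + d * l ^ (d - 1)"
proof -
  define n where "n = l ^ d - 1"
  have n0: "n \<ge> 1" "Suc n = l ^ d"
  proof -
    have "l ^ d \<ge> l" using l d by (simp add: self_le_power)
    thus "n \<ge> 1" "Suc n = l ^ d" using l by (auto simp: n_def)
  qed
  define B where "B = (\<lambda>j. {c. c < n \<and> n dvd c * (l ^ j - 1)})"
  have cB: "card (B j) \<le> l ^ (d - 1)" if j: "j \<in> {1..<d}" for j
  proof -
    define a where "a = l ^ j - 1"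
    have "l ^ j \<ge> l" using l j by (simp add: self_le_power)
    hence a0: "a > 0" using l by (simp add: a_def)
    have inj: "inj_on (\<lambda>c. c * a div n) (B j)"
    proof (rule inj_onI)
      fix c c' assume c: "c \<in> B j" "c' \<in> B j" "c * a div n = c' * a div n"
      hence "n dvd c * a" "n dvd c' * a" by (auto simp: B_def a_def)
      hence "c * a = c' * a" using c(3) by (metis dvd_mult_div_cancel)
      thus "c = c'" using a0 by simp
    qed
    have "(\<lambda>c. c * a div n) ` B j \<subseteq> {..<a}"
    proof
      fix x assume "x \<in> (\<lambda>c. c * a div n) ` B j"
      then obtain c where c: "c \<in> B j" "x = c * a div n" by blast
      hence "c * a < n * a" using a0 by (simp add: B_def)
      thus "x \<in> {..<a}" using c(2) by (simp add: less_mult_imp_div_less mult.commute)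
    qed
    from card_inj_on_le[OF inj this] have "card (B j) \<le> a" by simp
    also have "a \<le> l ^ j" by (simp add: a_def)
    also have "\<dots> \<le> l ^ (d - 1)" using l j by (intro power_increasing) auto
    finally show ?thesis .
  qed
  have "{..<n} \<subseteq> cycle_params l d \<union> (\<Union>j\<in>{1..<d}. B j)" by (auto simp: cycle_params_def B_def n_def)
  moreover have "finite (cycle_params l d)" by (rule finite_subset[of _ "{..<n}"]) (auto simp: cycle_params_def n_def)
  moreover have "finite (\<Union>j\<in>{1..<d}. B j)" by (auto simp: B_def)
  ultimately have "card {..<n} \<le> card (cycle_params l d \<union> (\<Union>j\<in>{1..<d}. B j))" by (intro card_mono) auto
  also have "\<dots> \<le> card (cycle_params l d) + card (\<Union>j\<in>{1..<d}. B j)" by (rule card_Un_le)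
  also have "card (\<Union>j\<in>{1..<d}. B j) \<le> (\<Sum>j\<in>{1..<d}. card (B j))" by (rule card_UN_le) simp
  also have "\<dots> \<le> (\<Sum>j\<in>{1..<d}. l ^ (d - 1))" by (rule sum_mono) (rule cB)
  also have "\<dots> = (d - 1) * l ^ (d - 1)" by simp
  finally have "n \<le> card (cycle_params l d) + (d - 1) * l ^ (d - 1)" by simp
  \<comment> \<open>Passing from \<open>n\<close> to \<open>l ^ d\<close> costs 1, which is absorbed
    by replacing the factor \<open>d - 1\<close> with \<open>d\<close>.\<close>
  moreover have "(1::nat) \<le> l ^ (d - 1)" using l by simp
  moreover have "d * l ^ (d - 1) = (d - 1) * l ^ (d - 1) + l ^ (d - 1)" using d by (cases d) auto
  ultimately show ?thesis using n0(2) by linarith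
qed

lemma cycle_exponents_inj:
  assumes "d \<ge> 1"
  shows "inj_on (cycle_exponents l d) (cycle_params l d)"
proof (rule inj_onI)
  fix c c' assume c: "c \<in> cycle_params l d" "c' \<in> cycle_params l d" "cycle_exponents l d c = cycle_exponents l d c'"
  have "cycle_exponents l d c ! 1 = c" if "c \<in> cycle_params l d" for c using that assms by (simp add: cycle_exponents_def cycle_params_def)
  thus "c = c'" using c by metis
qed

lemma cycle_exponents_count:
  assumes l: "odd l" "l \<ge> 2 * (N + 3)" and N: "N \<ge> 3"
  shows "((l + 1) div 2) ^ (N - 1) \<le> card (cycle_exponents l (N - 1) ` cycle_params l (N - 1))"
proof -
  define d where "d = N - 1"
  have d: "d \<ge> 2" using N by (simp add: d_def)
  define h where "h = (l + 1) div 2"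
  \<comment> \<open>About half of \<open>l\<close> is given away to absorb the excluded parameters;
    the bound on \<open>l\<close> provides \<open>h + d \<le> l\<close>.\<close>
  have hl: "h \<le> l" "h + d \<le> l" using l N by (auto simp: h_def d_def)
  have "h ^ d + d * l ^ (d - 1) \<le> l ^ d"
  proof -
    have "h ^ d + d * l ^ (d - 1) = h * h ^ (d - 1) + d * l ^ (d - 1)" using d by (cases d) auto
    also have "\<dots> \<le> h * l ^ (d - 1) + d * l ^ (d - 1)" using hl by (intro add_mono mult_mono power_mono) auto
    also have "\<dots> = (h + d) * l ^ (d - 1)" by (simp add: algebra_simps)
    also have "\<dots> \<le> l * l ^ (d - 1)" using hl by (intro mult_right_mono) auto
    also have "\<dots> = l ^ d" using d by (cases d) auto
    finally show ?thesis .
  qed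
  moreover have "l ^ d \<le> card (cycle_params l d) + d * l ^ (d - 1)" using l d by (intro card_cycle_params) auto
  ultimately have "h ^ d \<le> card (cycle_params l d)" by linarith
  also have "\<dots> = card (cycle_exponents l d ` cycle_params l d)" using d by (intro card_image[symmetric] cycle_exponents_inj) auto
  finally show ?thesis by (simp add: d_def h_def)
qed

text \<open>A conjugate pair \<open>x, l x\<close> in the quadratic extension and distinct elements \<open>(l + 1) a\<close> of the prime
  field, none of them \<open>1\<close> or \<open>-1\<close>: Frobenius acts as a transposition, and a characteristic
  polynomial with these roots has no root \<open>1\<close> or \<open>-1\<close>, hence no rational root.\<close>

definition transp_exponents :: "nat \<Rightarrow> nat list \<Rightarrow> nat \<Rightarrow> nat list" where
  "transp_exponents l as x = x # (l * x) mod (l\<^sup>2 - 1) # map (\<lambda>a. (l + 1) * a) as"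

text \<open>An exponent that is not a multiple of \<open>l + 1\<close> lies outside the prime field.
  The congruence modulo \<open>l - 1\<close> makes the exponent sum vanish, as this sum is
  \<open>(l + 1) * (x + sum_list as)\<close> modulo \<open>l\<^sup>2 - 1\<close>.\<close>

definition transp_params :: "nat \<Rightarrow> nat list \<Rightarrow> nat set" where
  "transp_params l as = {x. x < l\<^sup>2 - 1 \<and> (l - 1) dvd x + sum_list as \<and> \<not> (l + 1) dvd x}"

text \<open>The value \<open>a = 0\<close> would give the root 1, and
  \<open>a = (l - 1) div 2\<close> the root -1.\<close>

definition transp_slots :: "nat \<Rightarrow> nat \<Rightarrow> nat list set" where
  "transp_slots l k = {as. length as = k \<and> distinct as \<and> set as \<subseteq> {1..<l - 1} - {(l - 1) div 2}}"

lemma square_minus_1: "(l::nat)\<^sup>2 - 1 = (l - 1) * (l + 1)"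
  by (cases l) (auto simp: power2_eq_square algebra_simps)

lemma transp_exponents_props:
  assumes l: "odd l" "l \<ge> 3" and as: "as \<in> transp_slots l k" and x: "x \<in> transp_params l as"
  shows "admissible l (k + 2) (l\<^sup>2 - 1) (Transposition.transpose 0 1) ((!) (transp_exponents l as x))"
    and "\<And>i. i < k + 2 \<Longrightarrow> transp_exponents l as x ! i \<noteq> 0 \<and> 2 * transp_exponents l as x ! i \<noteq> l\<^sup>2 - 1"
proof -
  define n where "n = l\<^sup>2 - 1"
  define w where "w = l + 1"
  have w0: "w > 0" by (simp add: w_def)
  define y where "y = (l * x) mod n"
  have n: "n = (l - 1) * w" unfolding n_def w_def by (rule square_minus_1)
  have ll: "l * l = n + 1"
    using l by (cases l) (auto simp: n w_def)
  have n0: "n > 0" using l w0 by (simp add: n)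
  have x': "x < n" "(l - 1) dvd x + sum_list as" "\<not> w dvd x"
    using x by (auto simp: transp_params_def n_def w_def)
  have as': "length as = k" "distinct as" "\<And>i. i < k \<Longrightarrow> as ! i \<ge> 1 \<and> as ! i < l - 1 \<and> as ! i \<noteq> (l - 1) div 2"
  proof -
    show len: "length as = k" and "distinct as" using as by (simp_all add: transp_slots_def)
    fix i assume "i < k"
    hence "as ! i \<in> set as" using len by simp
    moreover have "set as \<subseteq> {1..<l - 1} - {(l - 1) div 2}" using as by (simp add: transp_slots_def)
    ultimately have "as ! i \<in> {1..<l - 1} - {(l - 1) div 2}" by blast
    thus "as ! i \<ge> 1 \<and> as ! i < l - 1 \<and> as ! i \<noteq> (l - 1) div 2" by simp
  qed
  have nth0: "transp_exponents l as x ! 0 = x" and nth1: "transp_exponents l as x ! Suc 0 = y"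
    by (simp_all add: transp_exponents_def y_def n_def)
  have nthS: "transp_exponents l as x ! Suc (Suc i) = w * as ! i" if "i < k" for i
    using that as'(1) by (simp add: transp_exponents_def w_def)
  have transp_exponents: "transp_exponents l as x = x # y # map (\<lambda>a. w * a) as" by (simp add: transp_exponents_def w_def y_def n_def)
  have dn: "w dvd n" by (simp add: n)
  have y: "y < n" "\<not> w dvd y"
  proof -
    show "y < n" using n0 by (simp add: y_def)
    show "\<not> w dvd y"
    proof
      assume "w dvd y"
      hence "w dvd l * x" unfolding y_def using dn dvd_mod_iff by blast
      moreover have "coprime w l" by (simp add: w_def)
      ultimately have "w dvd x" using coprime_dvd_mult_right_iff by blast
      thus False using x' by simp
    qed
  qed
  \<comment> \<open>If Frobenius fixed the element, \<open>n\<close> would divide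
    \<open>(l - 1) * x\<close>, hence \<open>l + 1\<close> would divide \<open>x\<close>.\<close>
  have xy: "x \<noteq> y"
  proof
    assume "x = y"
    hence "(l * x) mod n = x mod n" using x'(1) by (simp add: y_def)
    hence "n dvd l * x - x" using l by (simp add: mod_eq_dvd_iff_nat)
    also have "l * x - x = (l - 1) * x" by (simp add: diff_mult_distrib)
    finally have "w dvd x" using l unfolding n by simp
    thus False using x' by simp
  qed
  have lt: "w * as ! i < n" if "i < k" for i
  proof -
    have "w * as ! i < w * (l - 1)" using as'(3)[OF that] w0 by simp
    thus ?thesis by (simp add: n mult.commute)
  qed
  have n_lt: "transp_exponents l as x ! i < n" if ik: "i < k + 2" for i
  proof -
    consider "i = 0" | "i = Suc 0" | j where "i = Suc (Suc j)" "j < k"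
      using ik by (cases i; cases "i - 1") auto
    thus ?thesis by cases (auto simp only: nth0 nth1 nthS x' y lt)
  qed
  have inj: "inj_on ((!) (transp_exponents l as x)) {..<k + 2}"
  proof -
    have "distinct (transp_exponents l as x)"
    proof -
      have "x \<notin> (\<lambda>a. w * a) ` set as" "y \<notin> (\<lambda>a. w * a) ` set as" using x'(3) y(2) by auto
      moreover have "distinct (map (\<lambda>a. w * a) as)" using as'(2) w0 by (auto simp: distinct_map inj_on_def)
      ultimately show ?thesis using xy unfolding transp_exponents by simp
    qed
    moreover have "length (transp_exponents l as x) = k + 2" using as' by (simp add: transp_exponents_def)
    ultimately show ?thesis by (auto simp: inj_on_def nth_eq_iff_index_eq)
  qed
  have step: "(l * transp_exponents l as x ! i) mod n = transp_exponents l as x ! (Transposition.transpose 0 1 i)" if ik: "i < k + 2" for i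
  proof -
    consider (a) "i = 0" | (b) "i = Suc 0" | (c) j where "i = Suc (Suc j)" "j < k"
      using ik by (cases i; cases "i - 1") auto
    thus ?thesis
    proof cases
      case a thus ?thesis using nth0 nth1 by (simp add: y_def)
    next
      case b
      have "(l * y) mod n = (l * l * x) mod n" by (simp add: y_def mod_mult_right_eq mult.assoc)
      also have "l * l * x = x + n * x" unfolding ll by simp
      also have "\<dots> mod n = x" using x'(1) by simp
      finally show ?thesis using b nth0 nth1 by simp
    next
      case c
      have "l * (w * as ! j) = w * as ! j + n * as ! j"
        using l unfolding n by (cases l) (auto simp: algebra_simps)
      hence "(l * (w * as ! j)) mod n = w * as ! j" using lt[OF c(2)] by simp
      thus ?thesis using c nthS[OF c(2)] by (simp add: Transposition.transpose_def)
    qed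
  qed
  have perm: "Transposition.transpose 0 1 permutes {..<k + 2}"
    by (rule permutes_swap_id) auto
  have sumdvd: "n dvd (\<Sum>i<k + 2. transp_exponents l as x ! i)"
  proof -
    have "(\<Sum>i<k + 2. transp_exponents l as x ! i) = sum_list (transp_exponents l as x)"
      unfolding sum_list_sum_nth using as'(1) by (simp add: transp_exponents_def atLeast0LessThan)
    also have "\<dots> = x + (y + w * sum_list as)"
      unfolding transp_exponents by (simp add: sum_list_const_mult)
    finally have eq: "(\<Sum>i<k + 2. transp_exponents l as x ! i) = x + (y + w * sum_list as)" .
    obtain q where q: "x + sum_list as = (l - 1) * q" using x'(2) by (elim dvdE)
    have "[x + (y + w * sum_list as) = x + (l * x + w * sum_list as)] (mod n)"
      by (intro cong_add cong_refl) (simp add: y_def)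
    also have "x + (l * x + w * sum_list as) = w * (x + sum_list as)" by (simp add: algebra_simps w_def)
    also have "\<dots> = n * q" unfolding q n by (simp add: mult_ac)
    finally show ?thesis unfolding eq by (metis cong_dvd_iff dvd_triv_left)
  qed
  have ndvd: "\<not> l dvd n"
  proof
    assume "l dvd n"
    moreover have "l dvd n + 1" using ll by (metis dvd_triv_left)
    ultimately have "l dvd n + 1 - n" by (rule dvd_diff_nat[rotated])
    thus False using l by simp
  qed
  show "admissible l (k + 2) (l\<^sup>2 - 1) (Transposition.transpose 0 1) ((!) (transp_exponents l as x))"
    unfolding admissible_def n_def[symmetric]
    by (intro conjI allI impI n0 ndvd l n_lt inj step perm sumdvd)
  \<comment> \<open>The exponents of 1 and -1 are 0 and \<open>n div 2\<close>, both multiples of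
    \<open>w = l + 1\<close> because \<open>l - 1\<close> is even.\<close>
  have nomult: "z \<noteq> 0 \<and> 2 * z \<noteq> n" if z: "\<not> w dvd z" for z
  proof (intro conjI notI)
    assume "z = 0" thus False using z by simp
  next
    assume "2 * z = n"
    moreover have "even (l - 1)" using l by simp
    then obtain q where "l - 1 = 2 * q" by (elim evenE)
    ultimately have "z = w * q" unfolding n by simp
    thus False using z by simp
  qed
  show "transp_exponents l as x ! i \<noteq> 0 \<and> 2 * transp_exponents l as x ! i \<noteq> l\<^sup>2 - 1" if ik: "i < k + 2" for i
  proof -
    consider (a) "i = 0" | (b) "i = Suc 0" | (c) j where "i = Suc (Suc j)" "j < k"
      using ik by (cases i; cases "i - 1") auto
    thus ?thesis unfolding n_def[symmetric]
    proof cases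
      case a thus "transp_exponents l as x ! i \<noteq> 0 \<and> 2 * transp_exponents l as x ! i \<noteq> n" using nomult[OF x'(3)] nth0 by simp
    next
      case b thus "transp_exponents l as x ! i \<noteq> 0 \<and> 2 * transp_exponents l as x ! i \<noteq> n" using nomult[OF y(2)] nth1 by simp
    next
      case c
      have "2 * (w * as ! j) \<noteq> n"
      proof
        assume "2 * (w * as ! j) = n"
        hence "w * (2 * as ! j) = w * (l - 1)" unfolding n by (simp add: mult_ac)
        hence "2 * as ! j = l - 1" using w0 by simp
        thus False using as'(3)[OF c(2)] by auto
      qed
      thus "transp_exponents l as x ! i \<noteq> 0 \<and> 2 * transp_exponents l as x ! i \<noteq> n"
        using c nthS[OF c(2)] as'(3)[OF c(2)] w0 by simp
    qed
  qed
qed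

text \<open>The congruence confines \<open>x\<close> to a progression with step
  \<open>l - 1\<close>. Of two consecutive terms at least one is not divisible by
  \<open>l + 1\<close>, since \<open>l + 1\<close> does not divide \<open>l - 1\<close>; so each of
  \<open>(l + 1) div 2\<close> pairs of terms contributes an \<open>x\<close>.\<close>

lemma card_transp_params:
  assumes l: "odd l" "l \<ge> 3"
  shows "(l + 1) div 2 \<le> card (transp_params l as)"
proof -
  define S where "S = sum_list as"
  \<comment> \<open>\<open>l - 2\<close> stands for -1 modulo \<open>l - 1\<close>, so
    \<open>s\<close> is the residue of \<open>- S\<close>.\<close>
  define s where "s = ((l - 2) * S) mod (l - 1)"
  define g where "g = (\<lambda>k. if (l + 1) dvd s + (l - 1) * (2 * k) then s + (l - 1) * (2 * k + 1) else s + (l - 1) * (2 * k))"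
  have s: "s < l - 1" using l by (simp add: s_def)
  have gdiv: "g k div (l - 1) div 2 = k" for k
  proof -
    have "(s + (l - 1) * (2 * k + 1)) div (l - 1) = 2 * k + 1"
      using s by (simp only: div_mult_self2) simp
    moreover have "(s + (l - 1) * (2 * k)) div (l - 1) = 2 * k"
      using s by (simp only: div_mult_self2) simp
    ultimately show ?thesis by (auto simp: g_def)
  qed
  have inj: "inj_on g {..<(l + 1) div 2}" by (rule inj_onI) (metis gdiv)
  have "g ` {..<(l + 1) div 2} \<subseteq> transp_params l as"
  proof
    fix x assume "x \<in> g ` {..<(l + 1) div 2}"
    then obtain k where k: "k < (l + 1) div 2" "x = g k" by auto
    have kl: "2 * k + 1 \<le> l" using k(1) l by presburger
    have "x \<le> s + (l - 1) * (2 * k + 1)" using k(2) by (simp add: g_def)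
    also have "\<dots> \<le> s + (l - 1) * l" using kl by (intro add_left_mono mult_left_mono) auto
    also have "\<dots> < (l - 1) + (l - 1) * l" using s by simp
    also have "\<dots> = l\<^sup>2 - 1" unfolding square_minus_1 by simp
    finally have 1: "x < l\<^sup>2 - 1" .
    have "\<exists>q. x = s + (l - 1) * q" unfolding k(2) g_def by (simp only: split: if_split) blast
    then obtain q where q: "x = s + (l - 1) * q" by blast
    have "[x + S = (l - 2) * S + S] (mod (l - 1))"
      unfolding q by (intro cong_add cong_refl) (simp add: cong_def s_def)
    also have "(l - 2) * S + S = (l - 1) * S"
    proof -
      have "l - 1 = Suc (l - 2)" using l by simp
      thus ?thesis by simp
    qed
    finally have 2: "(l - 1) dvd x + S" by (metis cong_dvd_iff dvd_triv_left)
    have 3: "\<not> (l + 1) dvd x"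
    proof (cases "(l + 1) dvd s + (l - 1) * (2 * k)")
      case True
      show ?thesis
      proof
        assume "(l + 1) dvd x"
        hence "(l + 1) dvd (s + (l - 1) * (2 * k)) + (l - 1)" using True k(2) by (simp add: g_def algebra_simps)
        hence "(l + 1) dvd l - 1" using True by (simp only: dvd_add_right_iff)
        thus False using l by (auto dest: dvd_imp_le)
      qed
    next
      case False thus ?thesis using k(2) by (simp add: g_def)
    qed
    show "x \<in> transp_params l as" using 1 2 3 by (simp add: transp_params_def S_def)
  qed
  moreover have "finite (transp_params l as)" by (rule finite_subset[of _ "{..<l\<^sup>2 - 1}"]) (auto simp: transp_params_def)
  ultimately have "card {..<(l + 1) div 2} \<le> card (transp_params l as)" by (rule card_inj_on_le[OF inj])
  thus ?thesis by simp
qed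

text \<open>The count is a falling factorial with \<open>k\<close> factors starting at
  \<open>l - 3\<close>. The bound on \<open>l\<close> keeps even the last factor,
  \<open>l - 2 - k\<close>, at least \<open>(l + 1) div 2\<close>.\<close>

lemma card_transp_slots:
  assumes l: "odd l" "l \<ge> 2 * (k + 5)"
  shows "((l + 1) div 2) ^ k \<le> card (transp_slots l k)"
proof -
  define A where "A = {1..<l - 1} - {(l - 1) div 2}"
  have "(l - 1) div 2 \<in> {1..<l - 1}" using l by auto
  hence cA: "card A = l - 3" using l by (simp add: A_def card_Diff_singleton)
  have "card (transp_slots l k) = \<Prod>{card A - k + 1 .. card A}"
    unfolding transp_slots_def A_def[symmetric]
    by (rule card_lists_distinct_length_eq) (use l cA in \<open>auto simp: A_def\<close>)
  also have "\<dots> \<ge> (\<Prod>i\<in>{card A - k + 1 .. card A}. (l + 1) div 2)"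
    by (rule prod_mono) (use l cA in auto)
  also have "(\<Prod>i\<in>{card A - k + 1 .. card A}. (l + 1) div 2) = ((l + 1) div 2) ^ k"
    using l cA by simp
  finally show ?thesis .
qed

definition transp_set :: "nat \<Rightarrow> nat \<Rightarrow> nat list set" where
  "transp_set l k = (\<lambda>(as, x). transp_exponents l as x) ` (SIGMA as:transp_slots l k. transp_params l as)"

lemma finite_transp_slots: "finite (transp_slots l k)"
  unfolding transp_slots_def
  by (rule finite_subset[OF _ finite_lists_length_eq[of "{1..<l-1}" k]]) auto

lemma finite_transp_params: "finite (transp_params l as)"
  by (rule finite_subset[of _ "{..<l\<^sup>2 - 1}"]) (auto simp: transp_params_def)

lemma finite_transp_set: "finite (transp_set l k)"
  unfolding transp_set_def using finite_transp_slots finite_transp_params by auto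

lemma card_transp_set:
  assumes l: "odd l" "l \<ge> 2 * (k + 5)"
  shows "((l + 1) div 2) ^ (k + 1) \<le> card (transp_set l k)"
proof -
  have "inj_on (\<lambda>(as, x). transp_exponents l as x) (SIGMA as:transp_slots l k. transp_params l as)"
  proof (rule inj_onI, clarify)
    fix as x as' x' assume "transp_exponents l as x = transp_exponents l as' x'"
    hence *: "x = x'" "map (\<lambda>a. (l + 1) * a) as = map (\<lambda>a. (l + 1) * a) as'" by (simp_all only: transp_exponents_def list.inject)
    have "inj (\<lambda>a. (l + 1) * a)" by (rule injI) (simp only: mult_cancel1, simp)
    thus "as = as' \<and> x = x'" using * by (simp only: inj_map_eq_map)
  qed
  hence "card (transp_set l k) = card (SIGMA as:transp_slots l k. transp_params l as)"
    unfolding transp_set_def by (rule card_image)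
  also have "\<dots> = (\<Sum>as\<in>transp_slots l k. card (transp_params l as))"
    using finite_transp_slots finite_transp_params by (intro card_SigmaI) auto
  also have "\<dots> \<ge> (\<Sum>as\<in>transp_slots l k. (l + 1) div 2)"
    by (rule sum_mono) (use l in \<open>intro card_transp_params, auto\<close>)
  also have "(\<Sum>as\<in>transp_slots l k. (l + 1) div 2) = card (transp_slots l k) * ((l + 1) div 2)" by simp
  finally have "card (transp_slots l k) * ((l + 1) div 2) \<le> card (transp_set l k)" .
  moreover have "((l + 1) div 2) ^ k * ((l + 1) div 2) \<le> card (transp_slots l k) * ((l + 1) div 2)"
    using card_transp_slots[OF l] by (rule mult_right_mono) simp
  ultimately show ?thesis unfolding power_add power_one_right by (rule order_trans[rotated])
qed

section \<open>Matrices modulo an integer\<close>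

lemma dvd_diff_mult:
  fixes m :: "'a :: comm_ring_1"
  assumes "m dvd x - y" "m dvd x' - y'"
  shows "m dvd x * x' - y * y'"
proof -
  have "x * x' - y * y' = (x - y) * x' + y * (x' - y')" by (simp add: algebra_simps)
  thus ?thesis using assms by simp
qed

lemma dvd_diff_sum:
  fixes m :: "'a :: comm_ring_1"
  shows "(\<And>i. i \<in> I \<Longrightarrow> m dvd f i - g i) \<Longrightarrow> m dvd sum f I - sum g I"
  by (simp add: sum_subtractf[symmetric] dvd_sum)

lemma dvd_diff_prod:
  fixes m :: "'a :: comm_ring_1"
  shows "(\<And>i. i \<in> I \<Longrightarrow> m dvd f i - g i) \<Longrightarrow> m dvd prod f I - prod g I"
  by (induction I rule: infinite_finite_induct) (auto intro: dvd_diff_mult)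

text \<open>The general ring covers both integer matrices modulo \<open>m\<close> and the matrices
  \<open>X - A\<close> over polynomials modulo the constant \<open>[:m:]\<close>.\<close>

definition mcong :: "'a :: comm_ring_1 \<Rightarrow> nat \<Rightarrow> 'a mat \<Rightarrow> 'a mat \<Rightarrow> bool" where
  "mcong m n A B \<longleftrightarrow> A \<in> carrier_mat n n \<and> B \<in> carrier_mat n n \<and>
     (\<forall>i<n. \<forall>j<n. m dvd A $$ (i,j) - B $$ (i,j))"

lemma mcongD: "mcong m n A B \<Longrightarrow> i < n \<Longrightarrow> j < n \<Longrightarrow> m dvd A $$ (i,j) - B $$ (i,j)"
  by (simp add: mcong_def)

lemma mcong_carrier: "mcong m n A B \<Longrightarrow> A \<in> carrier_mat n n" "mcong m n A B \<Longrightarrow> B \<in> carrier_mat n n"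
  by (simp_all add: mcong_def)

lemma mcong_refl: "A \<in> carrier_mat n n \<Longrightarrow> mcong m n A A"
  by (simp add: mcong_def)

lemma mcong_sym: "mcong m n A B \<Longrightarrow> mcong m n B A"
  unfolding mcong_def by (metis dvd_minus_iff minus_diff_eq)

lemma mcong_trans [trans]:
  assumes "mcong m n A B" "mcong m n B C"
  shows "mcong m n A C"
  unfolding mcong_def
proof (intro conjI allI impI)
  fix i j assume "i < n" "j < n"
  hence "m dvd (A $$ (i,j) - B $$ (i,j)) + (B $$ (i,j) - C $$ (i,j))"
    using assms by (intro dvd_add) (auto simp: mcong_def)
  thus "m dvd A $$ (i,j) - C $$ (i,j)" by simp
qed (use assms in \<open>auto simp: mcong_def\<close>)

lemma mcong_dvd: "mcong m n A B \<Longrightarrow> k dvd m \<Longrightarrow> mcong k n A B"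
  unfolding mcong_def by (meson dvd_trans)

lemma mcong_mult:
  assumes "mcong m n A B" "mcong m n A' B'"
  shows "mcong m n (A * A') (B * B')"
  unfolding mcong_def
proof (intro conjI allI impI)
  fix i j assume ij: "i < n" "j < n"
  have "m dvd (\<Sum>k = 0..<n. A $$ (i,k) * A' $$ (k,j)) - (\<Sum>k = 0..<n. B $$ (i,k) * B' $$ (k,j))"
    using ij assms by (intro dvd_diff_sum dvd_diff_mult) (auto simp: mcong_def)
  thus "m dvd (A * A') $$ (i,j) - (B * B') $$ (i,j)"
    using ij assms by (auto simp: mcong_def scalar_prod_def)
qed (use assms in \<open>auto simp: mcong_def\<close>)

lemma mcong_det:
  assumes "mcong m n A B"
  shows "m dvd det A - det B"
  unfolding det_def'[OF mcong_carrier(1)[OF assms]] det_def'[OF mcong_carrier(2)[OF assms]]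
proof (intro dvd_diff_sum dvd_diff_mult dvd_diff_prod)
  fix p i assume "p \<in> {p. p permutes {0..<n}}" "i \<in> {0..<n}"
  thus "m dvd A $$ (i, p i) - B $$ (i, p i)"
    using assms permutes_in_image[of p "{0..<n}" i] by (auto intro: mcongD)
qed simp

lemma mcong_char_poly_matrix:
  assumes "mcong m n A B"
  shows "mcong [:m:] n (char_poly_matrix A) (char_poly_matrix B)"
  unfolding mcong_def
proof (intro conjI allI impI)
  fix i j assume ij: "i < n" "j < n"
  have "char_poly_matrix A $$ (i,j) - char_poly_matrix B $$ (i,j) = [: B $$ (i,j) - A $$ (i,j) :]"
    using ij assms by (auto simp: mcong_def char_poly_matrix_def)
  moreover have "m dvd B $$ (i,j) - A $$ (i,j)" using mcongD[OF mcong_sym[OF assms] ij] .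
  then obtain e where "B $$ (i,j) - A $$ (i,j) = m * e" by (elim dvdE)
  ultimately have "char_poly_matrix A $$ (i,j) - char_poly_matrix B $$ (i,j) = [:m:] * [:e:]" by simp
  thus "[:m:] dvd char_poly_matrix A $$ (i,j) - char_poly_matrix B $$ (i,j)" by (metis dvd_triv_left)
qed (use assms in \<open>auto simp: mcong_def\<close>)

lemma mcong_char_poly:
  assumes "mcong m n A B"
  shows "m dvd coeff (char_poly A) k - coeff (char_poly B) k"
proof -
  obtain r where "char_poly A - char_poly B = [:m:] * r"
    using mcong_det[OF mcong_char_poly_matrix[OF assms]] by (auto simp: char_poly_def elim: dvdE)
  hence "coeff (char_poly A - char_poly B) k = m * coeff r k" by simp
  thus ?thesis by simp
qed

lemma coeff_char_poly_0:
  assumes "A \<in> carrier_mat n n"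
  shows "coeff (char_poly A) 0 = (-1) ^ n * det (A :: int mat)"
proof -
  have "poly (char_poly A) 0 = det ((-1) \<cdot>\<^sub>m A)"
    unfolding char_poly_def
    by (rule poly_det_cong[of _ n]) (use assms in \<open>auto simp: char_poly_matrix_def\<close>)
  thus ?thesis using assms by (simp add: poly_0_coeff_0)
qed

definition mod_mat :: "int \<Rightarrow> int mat \<Rightarrow> int mat" where
  "mod_mat m A = map_mat (\<lambda>x. x mod m) A"

definition reduced :: "int \<Rightarrow> nat \<Rightarrow> int mat set" where
  "reduced m n = {A \<in> carrier_mat n n. \<forall>i<n. \<forall>j<n. 0 \<le> A $$ (i,j) \<and> A $$ (i,j) < m}"

text \<open>A model of SL(n, \<int>/m) by integer matrices of least residues.\<close>

definition SLm :: "int \<Rightarrow> nat \<Rightarrow> int mat set" where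
  "SLm m n = {A \<in> reduced m n. m dvd det A - 1}"

lemma mod_mat_cong: "A \<in> carrier_mat n n \<Longrightarrow> mcong m n A (mod_mat m A)"
  by (auto simp: mcong_def mod_mat_def mod_eq_dvd_iff[symmetric])

lemma mod_mat_reduced: "m > 0 \<Longrightarrow> A \<in> carrier_mat n n \<Longrightarrow> mod_mat m A \<in> reduced m n"
  by (auto simp: reduced_def mod_mat_def)

lemma SLm_carrier: "A \<in> SLm m n \<Longrightarrow> A \<in> carrier_mat n n"
  by (simp add: SLm_def reduced_def)

lemma reduced_eqI:
  assumes "A \<in> reduced m n" "B \<in> reduced m n" "mcong m n A B"
  shows "A = B"
proof (rule eq_matI)
  fix i j assume "i < dim_row B" "j < dim_col B"
  hence ij: "i < n" "j < n" using assms by (auto simp: reduced_def)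
  hence "m dvd A $$ (i,j) - B $$ (i,j)" using assms(3) by (auto simp: mcong_def)
  hence "A $$ (i,j) mod m = B $$ (i,j) mod m" by (simp add: mod_eq_dvd_iff)
  thus "A $$ (i,j) = B $$ (i,j)" using assms(1,2) ij by (auto simp: reduced_def)
qed (use assms in \<open>auto simp: reduced_def\<close>)

lemma mod_mat_eq_iff:
  assumes "m > 0" "A \<in> carrier_mat n n" "B \<in> carrier_mat n n"
  shows "mod_mat m A = mod_mat m B \<longleftrightarrow> mcong m n A B"
proof
  assume "mod_mat m A = mod_mat m B"
  thus "mcong m n A B" using mod_mat_cong[OF assms(2), of m] mod_mat_cong[OF assms(3), of m] mcong_trans mcong_sym by metis
next
  assume "mcong m n A B"
  hence "mcong m n (mod_mat m A) (mod_mat m B)"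
    using mod_mat_cong[OF assms(2), of m] mod_mat_cong[OF assms(3), of m] mcong_trans mcong_sym by blast
  thus "mod_mat m A = mod_mat m B" using reduced_eqI mod_mat_reduced assms by blast
qed

lemma mod_mat_SLm:
  assumes "m > 0" "A \<in> carrier_mat n n" "m dvd det A - 1"
  shows "mod_mat m A \<in> SLm m n"
proof -
  have "m dvd (det A - 1) - (det A - det (mod_mat m A))"
    by (rule dvd_diff[OF assms(3) mcong_det[OF mod_mat_cong[OF assms(2)]]])
  thus ?thesis using assms mod_mat_reduced by (simp add: SLm_def)
qed

lemma finite_reduced: "finite (reduced m n)"
proof (rule finite_subset)
  show "reduced m n \<subseteq> (\<lambda>f. mat n n f) ` (({0..<n} \<times> {0..<n}) \<rightarrow>\<^sub>E {0..<m})"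
  proof
    fix A assume A: "A \<in> reduced m n"
    define f where "f = restrict (\<lambda>ij. A $$ ij) ({0..<n} \<times> {0..<n})"
    have "A = mat n n f" using A by (intro eq_matI) (auto simp: reduced_def f_def)
    moreover have "f \<in> ({0..<n} \<times> {0..<n}) \<rightarrow>\<^sub>E {0..<m}" using A by (auto simp: reduced_def f_def)
    ultimately show "A \<in> (\<lambda>f. mat n n f) ` (({0..<n} \<times> {0..<n}) \<rightarrow>\<^sub>E {0..<m})" by blast
  qed
  show "finite ((\<lambda>f. mat n n f) ` (({0..<n} \<times> {0..<n}) \<rightarrow>\<^sub>E {0..<m}))"
    by (intro finite_imageI finite_PiE) auto
qed

lemma finite_SLm: "finite (SLm m n)"
  by (rule finite_subset[OF _ finite_reduced[of m n]]) (auto simp: SLm_def)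

lemma one_SLm: "m > 0 \<Longrightarrow> mod_mat m (1\<^sub>m n) \<in> SLm m n"
  by (rule mod_mat_SLm) auto

text \<open>The Chinese remainder theorem entry by entry; by coprimality the determinant condition
  modulo \<open>m * l\<close> is the conjunction of the two conditions. This is the source of
  independence between primes.\<close>

lemma SLm_crt:
  fixes m l :: int
  assumes cop: "coprime m l" and pos: "m > 0" "l > 0"
  shows "bij_betw (\<lambda>A. (mod_mat m A, mod_mat l A)) (SLm (m * l) n) (SLm m n \<times> SLm l n)"
  unfolding bij_betw_def
proof
  have ml: "m * l > 0" using pos by simp
  have comb: "mcong (m * l) n A B" if "mcong m n A B" "mcong l n A B" for A B
    using that cop by (auto simp: mcong_def intro: divides_mult)
  show "inj_on (\<lambda>A. (mod_mat m A, mod_mat l A)) (SLm (m * l) n)"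
  proof (rule inj_onI)
    fix A B assume A: "A \<in> SLm (m * l) n" and B: "B \<in> SLm (m * l) n" and "(mod_mat m A, mod_mat l A) = (mod_mat m B, mod_mat l B)"
    hence "mcong (m * l) n A B"
      using mod_mat_eq_iff[OF pos(1) SLm_carrier[OF A] SLm_carrier[OF B]]
        mod_mat_eq_iff[OF pos(2) SLm_carrier[OF A] SLm_carrier[OF B]] by (intro comb) auto
    thus "A = B" using A B reduced_eqI by (auto simp: SLm_def)
  qed
  show "(\<lambda>A. (mod_mat m A, mod_mat l A)) ` SLm (m * l) n = SLm m n \<times> SLm l n"
  proof
    show "(\<lambda>A. (mod_mat m A, mod_mat l A)) ` SLm (m * l) n \<subseteq> SLm m n \<times> SLm l n"
    proof
      fix x assume "x \<in> (\<lambda>A. (mod_mat m A, mod_mat l A)) ` SLm (m * l) n"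
      then obtain A where A: "A \<in> SLm (m * l) n" "x = (mod_mat m A, mod_mat l A)" by auto
      hence "m * l dvd det A - 1" by (simp add: SLm_def)
      hence "m dvd det A - 1" "l dvd det A - 1" by (auto dest: dvd_mult_left dvd_mult_right)
      thus "x \<in> SLm m n \<times> SLm l n" using mod_mat_SLm pos SLm_carrier[OF A(1)] A(2) by auto
    qed
    show "SLm m n \<times> SLm l n \<subseteq> (\<lambda>A. (mod_mat m A, mod_mat l A)) ` SLm (m * l) n"
    proof
      fix x assume "x \<in> SLm m n \<times> SLm l n"
      then obtain A B where x: "x = (A, B)" and A: "A \<in> SLm m n" and B: "B \<in> SLm l n" by auto
      have "\<exists>c. [c = A $$ (i,j)] (mod m) \<and> [c = B $$ (i,j)] (mod l)" for i j
        by (rule binary_chinese_remainder_int[OF cop])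
      then obtain f where f: "\<And>i j. [f i j = A $$ (i,j)] (mod m) \<and> [f i j = B $$ (i,j)] (mod l)" by metis
      define C where "C = mat n n (\<lambda>(i,j). f i j)"
      have C: "C \<in> carrier_mat n n" by (simp add: C_def)
      have CA: "mcong m n C A" using f SLm_carrier[OF A] by (auto simp: mcong_def C_def cong_iff_dvd_diff)
      have CB: "mcong l n C B" using f SLm_carrier[OF B] by (auto simp: mcong_def C_def cong_iff_dvd_diff)
      have "m dvd (det C - det A) + (det A - 1)" using mcong_det[OF CA] A by (intro dvd_add) (auto simp: SLm_def)
      moreover have "l dvd (det C - det B) + (det B - 1)" using mcong_det[OF CB] B by (intro dvd_add) (auto simp: SLm_def)
      ultimately have "m * l dvd det C - 1" using cop by (intro divides_mult) auto
      hence S: "mod_mat (m * l) C \<in> SLm (m * l) n" using mod_mat_SLm[OF ml C] by simp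
      have R: "mcong (m * l) n (mod_mat (m * l) C) C" by (rule mcong_sym[OF mod_mat_cong[OF C]])
      have rc: "mod_mat (m * l) C \<in> carrier_mat n n" using S by (rule SLm_carrier)
      have "mod_mat m (mod_mat (m * l) C) = A"
      proof (rule reduced_eqI[of _ m n])
        show "mod_mat m (mod_mat (m * l) C) \<in> reduced m n" by (rule mod_mat_reduced[OF pos(1) rc])
        show "A \<in> reduced m n" using A by (simp add: SLm_def)
        show "mcong m n (mod_mat m (mod_mat (m * l) C)) A"
          using mcong_trans[OF mcong_sym[OF mod_mat_cong[OF rc]] mcong_trans[OF mcong_dvd[OF R] CA]] by simp
      qed
      moreover have "mod_mat l (mod_mat (m * l) C) = B"
      proof (rule reduced_eqI[of _ l n])
        show "mod_mat l (mod_mat (m * l) C) \<in> reduced l n" by (rule mod_mat_reduced[OF pos(2) rc])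
        show "B \<in> reduced l n" using B by (simp add: SLm_def)
        show "mcong l n (mod_mat l (mod_mat (m * l) C)) B"
          using mcong_trans[OF mcong_sym[OF mod_mat_cong[OF rc]] mcong_trans[OF mcong_dvd[OF R] CB]] by simp
      qed
      ultimately show "x \<in> (\<lambda>A. (mod_mat m A, mod_mat l A)) ` SLm (m * l) n" using S x by (intro image_eqI[of _ _ "mod_mat (m * l) C"]) auto
    qed
  qed
qed

text \<open>For monic \<open>f\<close> of degree \<open>n\<close>, the matrix of multiplication by
  \<open>X\<close> modulo \<open>f\<close> in the basis of powers of \<open>X\<close>.\<close>

definition companion :: "nat \<Rightarrow> 'a :: comm_ring_1 poly \<Rightarrow> 'a mat" where
  "companion n f = mat n n (\<lambda>(i,j). if j + 1 < n then (if i = j + 1 then 1 else 0) else - coeff f i)"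

lemma companion_carrier: "companion n f \<in> carrier_mat n n"
  by (simp add: companion_def)

text \<open>Replacing the first row of \<open>X - C\<close> by the combination of all rows with weights
  \<open>1, X, X^2, \<dots>\<close> turns it into \<open>(0, \<dots>, 0, f)\<close>.\<close>

lemma char_poly_companion:
  fixes f :: "'a :: idom poly"
  assumes f: "degree f = n" "lead_coeff f = 1" and n: "n > 0"
  shows "char_poly (companion n f) = f"
proof -
  define X :: "'a poly" where "X = monom 1 1"
  define M where "M = char_poly_matrix (companion n f)"
  define U where "U = mat n n (\<lambda>(i,j). if i = 0 then X ^ j else if i = j then 1 else 0)"
  have Xp: "X ^ k = monom 1 k" for k by (simp add: X_def monom_power)
  have M: "M \<in> carrier_mat n n" unfolding M_def by (simp add: companion_carrier)
  have U: "U \<in> carrier_mat n n" by (simp add: U_def)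
  have Mij: "M $$ (i,j) = (if i = j then X else 0) - [:companion n f $$ (i,j):]" if "i < n" "j < n" for i j
    using that companion_carrier[of n f] by (auto simp: M_def char_poly_matrix_def X_def monom_altdef)
  have C: "companion n f $$ (i,j) = (if j + 1 < n then (if i = j + 1 then 1 else 0) else - coeff f i)"
    if "i < n" "j < n" for i j using that by (simp add: companion_def)
  have "upper_triangular U" by (auto simp: U_def)
  hence "det U = prod_list (diag_mat U)" by (rule det_upper_triangular[OF _ U])
  also have "\<dots> = (\<Prod>i\<in>{0..<n}. U $$ (i,i))" using U by (simp add: prod_list_diag_prod)
  also have "\<dots> = 1" by (rule prod.neutral) (auto simp: U_def)
  finally have dU: "det U = 1" .
  define W where "W = U * M"
  have W: "W \<in> carrier_mat n n" using U M by (simp add: W_def)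
  have Wsum: "W $$ (i,j) = (\<Sum>k = 0..<n. U $$ (i,k) * M $$ (k,j))" if "i < n" "j < n" for i j
    using that U M by (auto simp: W_def scalar_prod_def)
  have W0: "W $$ (0,j) = (if j + 1 < n then 0 else f)" if j: "j < n" for j
  proof (cases "j + 1 < n")
    case True
    have "W $$ (0,j) = (\<Sum>k = 0..<n. X ^ k * ((if k = j then X else 0) - (if k = j + 1 then 1 else 0)))"
      unfolding Wsum[OF n j] by (rule sum.cong) (use j True in \<open>auto simp: U_def Mij C one_pCons\<close>)
    also have "\<dots> = (\<Sum>k = 0..<n. if k = j then X ^ k * X else 0) - (\<Sum>k = 0..<n. if k = j + 1 then X ^ k else 0)"
      unfolding sum_subtractf[symmetric] by (rule sum.cong) auto
    also have "\<dots> = 0" using j True by (simp add: mult.commute)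
    finally show ?thesis using True by simp
  next
    case False
    hence jn: "j = n - 1" using j by simp
    have "W $$ (0,j) = (\<Sum>k = 0..<n. X ^ k * ((if k = j then X else 0) + [:coeff f k:]))"
      unfolding Wsum[OF n j] by (rule sum.cong) (use j False in \<open>auto simp: U_def Mij C\<close>)
    also have "\<dots> = (\<Sum>k = 0..<n. if k = j then X ^ k * X else 0) + (\<Sum>k = 0..<n. X ^ k * [:coeff f k:])"
      unfolding sum.distrib[symmetric] by (rule sum.cong) (auto simp: algebra_simps)
    also have "(\<Sum>k = 0..<n. if k = j then X ^ k * X else 0) = X ^ n"
      using j jn by (simp flip: power_Suc2)
    also have "X ^ n + (\<Sum>k = 0..<n. X ^ k * [:coeff f k:]) = (\<Sum>k\<le>n. monom (coeff f k) k)"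
      using f by (simp add: Xp smult_monom atLeast0LessThan lessThan_Suc_atMost[symmetric])
    also have "\<dots> = f" using poly_as_sum_of_monoms[of f] f(1) by simp
    finally show ?thesis using False by simp
  qed
  have Wi: "W $$ (i,j) = M $$ (i,j)" if ij: "i < n" "j < n" "i > 0" for i j
  proof -
    have "W $$ (i,j) = (\<Sum>k = 0..<n. if k = i then M $$ (k,j) else 0)"
      unfolding Wsum[OF ij(1,2)] by (rule sum.cong) (use ij in \<open>auto simp: U_def\<close>)
    thus ?thesis using ij by simp
  qed
  define D where "D = mat_delete W 0 (n - 1)"
  have Dij: "D $$ (i,j) = W $$ (Suc i, j)" if "i < n - 1" "j < n - 1" for i j
    using that W unfolding D_def mat_delete_def by auto
  have D: "D \<in> carrier_mat (n - 1) (n - 1)" using W unfolding D_def by (simp add: mat_delete_def)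
  have "upper_triangular D"
  proof (rule upper_triangularI)
    fix i j assume "j < i" "i < dim_row D"
    hence ij: "j < i" "i < n - 1" "j < n - 1" using D by auto
    hence "Suc i < n" "j < n" "Suc i \<noteq> j" "Suc i \<noteq> j + 1" "j + 1 < n" by auto
    thus "D $$ (i,j) = 0" unfolding Dij[OF ij(2,3)] by (simp add: Wi Mij C)
  qed
  hence "det D = prod_list (diag_mat D)" by (rule det_upper_triangular[OF _ D])
  also have "\<dots> = (\<Prod>i\<in>{0..<n-1}. D $$ (i,i))" using D by (simp add: prod_list_diag_prod)
  also have "\<dots> = (\<Prod>i\<in>{0..<n-1}. -1)"
  proof (rule prod.cong[OF refl])
    fix i assume "i \<in> {0..<n-1}"
    hence "i < n - 1" "Suc i < n" "i < n" "i + 1 < n" by auto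
    thus "D $$ (i,i) = -1" unfolding Dij[OF \<open>i < n - 1\<close> \<open>i < n - 1\<close>] by (simp add: Wi Mij C one_pCons)
  qed
  also have "\<dots> = (-1) ^ (n - 1)" by simp
  finally have dD: "det D = (-1) ^ (n - 1)" .
  \<comment> \<open>Only the last entry of the first row survives. Its minor is upper triangular
    with \<open>-1\<close> on the diagonal, and the resulting sign cancels that of the
    expansion.\<close>
  have "det W = (\<Sum>j<n. W $$ (0,j) * cofactor W 0 j)" by (rule laplace_expansion_row[OF W n])
  also have "\<dots> = (\<Sum>j<n. if j = n - 1 then f * cofactor W 0 (n - 1) else 0)"
    by (rule sum.cong) (auto simp: W0)
  also have "\<dots> = f * cofactor W 0 (n - 1)" using n by simp
  also have "cofactor W 0 (n - 1) = (-1) ^ (n - 1) * (-1) ^ (n - 1)"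
    unfolding cofactor_def D_def[symmetric] dD by simp
  also have "\<dots> = 1" by (simp flip: power_mult_distrib)
  finally have "det W = f" by simp
  moreover have "det W = det U * det M" unfolding W_def by (rule det_mult[OF U M])
  ultimately show ?thesis using dU by (simp add: char_poly_def M_def)
qed

section \<open>Sizes of classes with a given characteristic polynomial\<close>

definition GLm :: "int \<Rightarrow> nat \<Rightarrow> int mat set" where
  "GLm l n = {A \<in> reduced l n. \<not> l dvd det A}"

definition charclass :: "int \<Rightarrow> nat \<Rightarrow> int poly \<Rightarrow> int mat set" where
  "charclass l n f = {A \<in> SLm l n. \<forall>k. l dvd coeff (char_poly A) k - coeff f k}"

lemma finite_GLm: "finite (GLm l n)"
  by (rule finite_subset[OF _ finite_reduced[of l n]]) (auto simp: GLm_def)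

lemma finite_charclass: "finite (charclass l n f)"
  by (rule finite_subset[OF _ finite_SLm[of l n]]) (auto simp: charclass_def)

text \<open>Scaling the first row by \<open>d\<close> multiplies the determinant by
  \<open>d\<close>, so \<open>d\<close>, and then \<open>A\<close>, can be recovered from the
  result.\<close>

lemma card_SLm_le_GLm:
  fixes l :: nat
  assumes l: "prime l" and n: "n > 0"
  shows "(l - 1) * card (SLm (int l) n) \<le> card (GLm (int l) n)"
proof -
  let ?f = "\<lambda>(d, A). mod_mat (int l) (multrow 0 d A)"
  have lp: "int l > 0" "prime (int l)" using l prime_gt_0_nat by auto
  have mr: "multrow 0 d A \<in> carrier_mat n n" "det (multrow 0 d A) = d * det A" if "A \<in> carrier_mat n n" for d and A :: "int mat"
    using that n by (auto simp: det_multrow)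
  have inj: "inj_on ?f ({1..<int l} \<times> SLm (int l) n)"
  proof (rule inj_onI, clarify)
    fix d A e B assume d: "d \<in> {1..<int l}" "e \<in> {1..<int l}" and A: "A \<in> SLm (int l) n" and B: "B \<in> SLm (int l) n"
      and eq: "mod_mat (int l) (multrow 0 d A) = mod_mat (int l) (multrow 0 e B)"
    note Ac = SLm_carrier[OF A] and Bc = SLm_carrier[OF B]
    have mc: "mcong (int l) n (multrow 0 d A) (multrow 0 e B)"
      using eq mod_mat_eq_iff[OF lp(1) mr(1)[OF Ac] mr(1)[OF Bc]] by simp
    have e1: "int l dvd d * det A - e * det B" using mcong_det[OF mc] by (simp add: mr Ac Bc)
    have e2: "int l dvd d * (det A - 1)" "int l dvd e * (det B - 1)" using A B by (auto simp: SLm_def)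
    have "int l dvd (d * det A - e * det B) - d * (det A - 1) + e * (det B - 1)"
      by (rule dvd_add[OF dvd_diff[OF e1 e2(1)] e2(2)])
    hence "int l dvd d - e" by (simp add: algebra_simps)
    hence "d mod int l = e mod int l" by (simp add: mod_eq_dvd_iff)
    hence de: "d = e" using d by simp
    have nd: "\<not> int l dvd d" using d by (auto dest: zdvd_imp_le)
    have "mcong (int l) n A B"
      unfolding mcong_def
    proof (intro conjI allI impI Ac Bc)
      fix i j assume ij: "i < n" "j < n"
      show "int l dvd A $$ (i,j) - B $$ (i,j)"
      proof (cases "i = 0")
        case True
        have "int l dvd d * A $$ (i,j) - d * B $$ (i,j)"
          using mcongD[OF mc ij] ij Ac Bc True de by simp
        hence "int l dvd d * (A $$ (i,j) - B $$ (i,j))" by (simp add: algebra_simps)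
        thus ?thesis using nd lp(2) prime_dvd_mult_iff by blast
      next
        case False
        thus ?thesis using mcongD[OF mc ij] ij Ac Bc by simp
      qed
    qed
    hence "A = B" using A B reduced_eqI by (auto simp: SLm_def)
    thus "d = e \<and> A = B" using de by simp
  qed
  have "?f ` ({1..<int l} \<times> SLm (int l) n) \<subseteq> GLm (int l) n"
  proof clarify
    fix d A assume d: "d \<in> {1..<int l}" and A: "A \<in> SLm (int l) n"
    note Ac = SLm_carrier[OF A]
    have nd: "\<not> int l dvd d" using d by (auto dest: zdvd_imp_le)
    have "\<not> int l dvd det (mod_mat (int l) (multrow 0 d A))"
    proof
      assume "int l dvd det (mod_mat (int l) (multrow 0 d A))"
      hence "int l dvd det (multrow 0 d A) - det (mod_mat (int l) (multrow 0 d A)) + det (mod_mat (int l) (multrow 0 d A))"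
        by (intro dvd_add mcong_det[OF mod_mat_cong[OF mr(1)[OF Ac]]])
      hence "int l dvd d * det A - d * (det A - 1)" using A by (intro dvd_diff) (auto simp: mr Ac SLm_def)
      thus False using nd by (simp add: algebra_simps)
    qed
    thus "mod_mat (int l) (multrow 0 d A) \<in> GLm (int l) n" using mod_mat_reduced[OF lp(1) mr(1)[OF Ac]] by (simp add: GLm_def)
  qed
  from card_inj_on_le[OF inj this finite_GLm]
  have "card ({1..<int l} \<times> SLm (int l) n) \<le> card (GLm (int l) n)" .
  moreover have "card {1..<int l} = l - 1" by (simp add: nat_diff_distrib)
  ultimately show ?thesis by (simp add: card_cartesian_product)
qed

lemma const_poly_sum: "(\<Sum>k\<in>K. [:f k:]) = [:\<Sum>k\<in>K. f k:]"
  by (induction K rule: infinite_finite_induct) auto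

text \<open>Similarity modulo \<open>l\<close>, written without an inverse. The relation passes to
  \<open>X - B\<close> and \<open>X - C\<close>; after taking determinants, \<open>det g\<close> is
  cancelled coefficient by coefficient, as the prime \<open>l\<close> does not divide it.\<close>

lemma similar_mod_char_poly:
  fixes l :: nat
  assumes l: "prime l" and g: "g \<in> carrier_mat n n" "\<not> int l dvd det g"
    and B: "B \<in> carrier_mat n n" and C: "C \<in> carrier_mat n n"
    and eq: "mcong (int l) n (B * g) (g * C)"
  shows "int l dvd coeff (char_poly B) k - coeff (char_poly C) k"
proof -
  let ?c = "map_mat (\<lambda>a. [:a:]) g"
  have c: "?c \<in> carrier_mat n n" using g by simp
  note cB = char_poly_matrix_closed[OF B] and cC = char_poly_matrix_closed[OF C]
  have "mcong [:int l:] n (char_poly_matrix B * ?c) (?c * char_poly_matrix C)"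
    unfolding mcong_def
  proof (intro conjI allI impI)
    fix i j assume ij: "i < n" "j < n"
    have 1: "(char_poly_matrix B * ?c) $$ (i,j) = [:0,1:] * [:g $$ (i,j):] - [:(B * g) $$ (i,j):]"
    proof -
      have "(char_poly_matrix B * ?c) $$ (i,j) = (\<Sum>k = 0..<n. (if i = k then [:0,1:] * [:g $$ (k,j):] else 0) - [:B $$ (i,k) * g $$ (k,j):])"
        using ij g B by (auto simp: scalar_prod_def char_poly_matrix_def intro!: sum.cong)
      also have "\<dots> = [:0,1:] * [:g $$ (i,j):] - (\<Sum>k = 0..<n. [:B $$ (i,k) * g $$ (k,j):])"
        unfolding sum_subtractf using ij by simp
      also have "(\<Sum>k = 0..<n. [:B $$ (i,k) * g $$ (k,j):]) = [:(B * g) $$ (i,j):]"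
        using ij g B by (simp add: scalar_prod_def const_poly_sum)
      finally show ?thesis .
    qed
    have 2: "(?c * char_poly_matrix C) $$ (i,j) = [:0,1:] * [:g $$ (i,j):] - [:(g * C) $$ (i,j):]"
    proof -
      have "(?c * char_poly_matrix C) $$ (i,j) = (\<Sum>k = 0..<n. (if k = j then [:0,1:] * [:g $$ (i,k):] else 0) - [:g $$ (i,k) * C $$ (k,j):])"
        using ij g C by (auto simp: scalar_prod_def char_poly_matrix_def intro!: sum.cong)
      also have "\<dots> = [:0,1:] * [:g $$ (i,j):] - (\<Sum>k = 0..<n. [:g $$ (i,k) * C $$ (k,j):])"
        unfolding sum_subtractf using ij by simp
      also have "(\<Sum>k = 0..<n. [:g $$ (i,k) * C $$ (k,j):]) = [:(g * C) $$ (i,j):]"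
        using ij g C by (simp add: scalar_prod_def const_poly_sum)
      finally show ?thesis .
    qed
    obtain e where "(g * C) $$ (i,j) - (B * g) $$ (i,j) = int l * e"
      using mcongD[OF mcong_sym[OF eq] ij] by (elim dvdE)
    hence "(char_poly_matrix B * ?c) $$ (i,j) - (?c * char_poly_matrix C) $$ (i,j) = [:int l:] * [:e:]"
      unfolding 1 2 by simp
    thus "[:int l:] dvd (char_poly_matrix B * ?c) $$ (i,j) - (?c * char_poly_matrix C) $$ (i,j)"
      by (metis dvd_triv_left)
  qed (use c cB cC in auto)
  from mcong_det[OF this]
  have "[:int l:] dvd char_poly B * det ?c - det ?c * char_poly C"
    unfolding det_mult[OF cB c] det_mult[OF c cC] by (simp add: char_poly_def)
  moreover have "det ?c = [:det g:]"
  proof -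
    interpret comm_ring_hom "\<lambda>a::int. [:a:]" by unfold_locales (auto simp: one_pCons)
    show ?thesis by (rule hom_det)
  qed
  ultimately have "[:int l:] dvd [:det g:] * (char_poly B - char_poly C)" by (simp add: algebra_simps)
  then obtain r where "[:det g:] * (char_poly B - char_poly C) = [:int l:] * r" by (elim dvdE)
  hence "coeff ([:det g:] * (char_poly B - char_poly C)) k = coeff ([:int l:] * r) k" by simp
  hence "int l dvd det g * (coeff (char_poly B) k - coeff (char_poly C) k)" by simp
  moreover have "prime (int l)" using l by simp
  ultimately show ?thesis using g(2) prime_dvd_mult_iff by blast
qed

text \<open>The map \<open>g \<mapsto> (g C g^-1, first column of g)\<close> is injective for the companion matrix \<open>C\<close>: the
  columns of \<open>g\<close> are the iterates of the first one under \<open>g C g^-1\<close>.\<close>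

lemma card_GLm_le_charclass:
  fixes l :: nat
  assumes l: "prime l" and n: "n > 0" and f: "degree f = n" "lead_coeff f = 1"
    and f0: "int l dvd coeff f 0 - (-1) ^ n"
  shows "card (GLm (int l) n) \<le> card (charclass (int l) n f) * l ^ n"
proof -
  let ?l = "int l"
  have lp: "?l > 0" "prime ?l" using l prime_gt_0_nat by auto
  define C where "C = companion n f"
  have C: "C \<in> carrier_mat n n" by (simp add: C_def companion_carrier)
  have chC: "char_poly C = f" unfolding C_def by (rule char_poly_companion[OF f n])
  have "\<exists>B. B \<in> charclass ?l n f \<and> mcong ?l n (B * g) (g * C)" if g: "g \<in> GLm ?l n" for g
  proof -
    have gc: "g \<in> carrier_mat n n" and nd: "\<not> ?l dvd det g" using g by (auto simp: GLm_def reduced_def)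
    have "coprime ?l (det g)" using lp nd by (simp add: prime_imp_coprime)
    then obtain u d where ud: "u * ?l + d * det g = 1" by (metis bezout_int coprime_iff_gcd_eq_1)
    \<comment> \<open>With \<open>d\<close> inverse to \<open>det g\<close> modulo \<open>l\<close>,
      the multiple of the adjugate by \<open>d\<close> stands for the inverse of
      \<open>g\<close>.\<close>
    define B0 where "B0 = g * C * (d \<cdot>\<^sub>m adj_mat g)"
    have ac: "adj_mat g \<in> carrier_mat n n" by (rule adj_mat(1)[OF gc])
    have gC: "g * C \<in> carrier_mat n n" using gc C by simp
    have B0: "B0 \<in> carrier_mat n n" unfolding B0_def using gC ac by simp
    have "B0 * g = (g * C) * ((d \<cdot>\<^sub>m adj_mat g) * g)"
      unfolding B0_def by (rule assoc_mult_mat) (use gC ac gc in auto)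
    also have "(d \<cdot>\<^sub>m adj_mat g) * g = (d * det g) \<cdot>\<^sub>m 1\<^sub>m n"
      using ac gc adj_mat(3)[OF gc] by (auto simp: mult_smult_assoc_mat smult_smult_assoc)
    finally have B0g: "B0 * g = (g * C) * ((d * det g) \<cdot>\<^sub>m 1\<^sub>m n)" .
    have "?l dvd d * det g - 1"
    proof -
      have "d * det g - 1 = ?l * (- u)" using ud by (simp add: algebra_simps)
      thus ?thesis by simp
    qed
    hence "mcong ?l n ((d * det g) \<cdot>\<^sub>m 1\<^sub>m n) (1\<^sub>m n)" by (auto simp: mcong_def)
    hence "mcong ?l n (B0 * g) (g * C * 1\<^sub>m n)"
      unfolding B0g by (intro mcong_mult mcong_refl gC)
    hence B0m: "mcong ?l n (B0 * g) (g * C)" unfolding right_mult_one_mat[OF gC] .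
    define B where "B = mod_mat ?l B0"
    have Bc: "B \<in> carrier_mat n n" using mod_mat_reduced[OF lp(1) B0] by (simp add: B_def reduced_def)
    have "mcong ?l n (B * g) (B0 * g)"
      unfolding B_def by (intro mcong_mult mcong_refl gc mcong_sym[OF mod_mat_cong[OF B0]])
    hence Bm: "mcong ?l n (B * g) (g * C)" using B0m mcong_trans by blast
    have ch: "?l dvd coeff (char_poly B) k - coeff f k" for k
      using similar_mod_char_poly[OF l gc nd Bc C Bm] chC by simp
    \<comment> \<open>The determinant of \<open>B\<close> is read off the constant coefficient,
      where \<open>f\<close> has the value \<open>(-1) ^ n\<close> modulo \<open>l\<close>.\<close>
    have "?l dvd (coeff (char_poly B) 0 - coeff f 0) + (coeff f 0 - (-1) ^ n)"
      by (rule dvd_add[OF ch f0])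
    hence "?l dvd (-1) ^ n * ((-1) ^ n * det B - (-1) ^ n)"
      unfolding coeff_char_poly_0[OF Bc] by simp
    hence "?l dvd det B - 1" by (simp add: right_diff_distrib)
    hence "B \<in> charclass ?l n f"
      using mod_mat_reduced[OF lp(1) B0] ch by (simp add: charclass_def SLm_def B_def)
    thus ?thesis using Bm by blast
  qed
  then obtain \<beta> where \<beta>: "\<And>g. g \<in> GLm ?l n \<Longrightarrow> \<beta> g \<in> charclass ?l n f \<and> mcong ?l n (\<beta> g * g) (g * C)" by metis
  define V where "V = {xs :: int list. set xs \<subseteq> {0..<?l} \<and> length xs = n}"
  define \<phi> where "\<phi> = (\<lambda>g. (\<beta> g, map (\<lambda>i. g $$ (i,0)) [0..<n]))"
  have inj: "inj_on \<phi> (GLm ?l n)"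
  proof (rule inj_onI)
    fix g h assume g: "g \<in> GLm ?l n" and h: "h \<in> GLm ?l n" and eq: "\<phi> g = \<phi> h"
    have gc: "g \<in> carrier_mat n n" and hc: "h \<in> carrier_mat n n" using g h by (auto simp: GLm_def reduced_def)
    define B where "B = \<beta> g"
    have Bg: "mcong ?l n (B * g) (g * C)" and Bh: "mcong ?l n (B * h) (h * C)"
      using \<beta>[OF g] \<beta>[OF h] eq by (auto simp: B_def \<phi>_def)
    have Bc: "B \<in> carrier_mat n n" using \<beta>[OF g] by (simp add: B_def charclass_def SLm_def reduced_def)
    have col0: "g $$ (i,0) = h $$ (i,0)" if "i < n" for i
      using eq that by (auto simp: \<phi>_def)
    \<comment> \<open>Multiplication by the companion matrix on the right shifts the columns of
      \<open>g\<close> by one, apart from the last.\<close>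
    have gCcol: "(g * C) $$ (i,j) = g $$ (i, Suc j)" if "i < n" "Suc j < n" "g \<in> carrier_mat n n" for g :: "int mat" and i j
    proof -
      have "(g * C) $$ (i,j) = (\<Sum>k = 0..<n. g $$ (i,k) * (if k = Suc j then 1 else 0))"
        using that C by (auto simp: scalar_prod_def C_def companion_def intro!: sum.cong)
      also have "\<dots> = (\<Sum>k = 0..<n. if k = Suc j then g $$ (i,k) else 0)" by (rule sum.cong) auto
      also have "\<dots> = g $$ (i, Suc j)" using that by simp
      finally show ?thesis .
    qed
    have cols: "j < n \<Longrightarrow> i < n \<Longrightarrow> ?l dvd g $$ (i,j) - h $$ (i,j)" for j i
    proof (induction j arbitrary: i)
      case 0 thus ?case using col0 by simp
    next
      case (Suc j)
      have a: "?l dvd (B * g) $$ (i,j) - g $$ (i, Suc j)"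
        using mcongD[OF Bg, of i j] Suc.prems gCcol[of i j g] gc by simp
      have b: "?l dvd (B * h) $$ (i,j) - h $$ (i, Suc j)"
        using mcongD[OF Bh, of i j] Suc.prems gCcol[of i j h] hc by simp
      have "?l dvd (\<Sum>k = 0..<n. B $$ (i,k) * g $$ (k,j)) - (\<Sum>k = 0..<n. B $$ (i,k) * h $$ (k,j))"
        using Suc by (intro dvd_diff_sum dvd_diff_mult) auto
      hence c: "?l dvd (B * g) $$ (i,j) - (B * h) $$ (i,j)"
        using Suc.prems Bc gc hc by (simp add: scalar_prod_def)
      have "?l dvd ((B * g) $$ (i,j) - (B * h) $$ (i,j)) - ((B * g) $$ (i,j) - g $$ (i, Suc j)) + ((B * h) $$ (i,j) - h $$ (i, Suc j))"
        by (intro dvd_add dvd_diff a b c)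
      thus ?case by simp
    qed
    have "mcong ?l n g h" using cols gc hc by (simp add: mcong_def)
    thus "g = h" using g h reduced_eqI by (auto simp: GLm_def)
  qed
  have sub: "\<phi> ` GLm ?l n \<subseteq> charclass ?l n f \<times> V"
  proof
    fix x assume "x \<in> \<phi> ` GLm ?l n"
    then obtain g where g: "g \<in> GLm ?l n" "x = \<phi> g" by auto
    have "\<beta> g \<in> charclass ?l n f" using \<beta>[OF g(1)] by blast
    moreover have "map (\<lambda>i. g $$ (i,0)) [0..<n] \<in> V"
      using g(1) n unfolding V_def GLm_def reduced_def by auto
    ultimately show "x \<in> charclass ?l n f \<times> V" using g(2) by (simp add: \<phi>_def)
  qed
  have "finite V" unfolding V_def by (rule finite_lists_length_eq) simp
  hence "card (GLm ?l n) \<le> card (charclass ?l n f \<times> V)"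
    by (intro card_inj_on_le[OF inj sub] finite_cartesian_product finite_charclass)
  also have "\<dots> = card (charclass ?l n f) * l ^ n"
    by (simp add: card_cartesian_product V_def card_lists_length_eq)
  finally show ?thesis .
qed

text \<open>Least residues as coefficients make the classes of distinct \<open>f\<close> disjoint.
  Combining \<open>card_SLm_le_GLm\<close> with \<open>card_GLm_le_charclass\<close>, each class
  holds at least a fraction (l - 1) / l^n of \<open>SLm\<close>.\<close>

lemma card_charclasses:
  fixes l :: nat
  assumes l: "prime l" and n: "n > 0" and fin: "finite F"
    and F: "\<And>f. f \<in> F \<Longrightarrow> degree f = n \<and> lead_coeff f = 1 \<and> int l dvd coeff f 0 - (-1) ^ n"
    and red: "\<And>f k. f \<in> F \<Longrightarrow> 0 \<le> coeff f k \<and> coeff f k < int l"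
  shows "card F * ((l - 1) * card (SLm (int l) n)) \<le> card (\<Union>f\<in>F. charclass (int l) n f) * l ^ n"
proof -
  have disj: "charclass (int l) n f \<inter> charclass (int l) n g = {}" if "f \<in> F" "g \<in> F" "f \<noteq> g" for f g
  proof (rule ccontr)
    assume "\<not> ?thesis"
    then obtain A where A: "A \<in> charclass (int l) n f" "A \<in> charclass (int l) n g" by auto
    have "coeff f k = coeff g k" for k
    proof -
      have "int l dvd (coeff (char_poly A) k - coeff g k) - (coeff (char_poly A) k - coeff f k)"
        by (rule dvd_diff) (use A in \<open>simp_all add: charclass_def\<close>)
      hence "coeff f k mod int l = coeff g k mod int l" by (simp add: mod_eq_dvd_iff)
      thus ?thesis using red[OF that(1), of k] red[OF that(2), of k] by simp
    qed
    thus False using that(3) poly_eqI by blast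
  qed
  have "card F * ((l - 1) * card (SLm (int l) n)) = (\<Sum>f\<in>F. (l - 1) * card (SLm (int l) n))" by simp
  also have "\<dots> \<le> (\<Sum>f\<in>F. card (charclass (int l) n f) * l ^ n)"
    using card_SLm_le_GLm[OF l n] card_GLm_le_charclass[OF l n] F
    by (intro sum_mono) (meson order_trans)
  also have "\<dots> = (\<Sum>f\<in>F. card (charclass (int l) n f)) * l ^ n" by (simp add: sum_distrib_right)
  also have "(\<Sum>f\<in>F. card (charclass (int l) n f)) = card (\<Union>f\<in>F. charclass (int l) n f)"
    using disj by (intro card_UN_disjoint[symmetric] fin) (auto simp: finite_charclass)
  finally show ?thesis .
qed

section \<open>Generation by elementary matrices\<close>

text \<open>One step of Euclid's algorithm with quotient 1 or -1, the sign being chosen so that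
  \<open>x\<close> shrinks.\<close>

lemma abs_reduce:
  fixes x y :: int
  assumes "y \<noteq> 0" "\<bar>x\<bar> \<ge> \<bar>y\<bar>"
  shows "\<bar>- (sgn x * sgn y) * y + x\<bar> < \<bar>x\<bar>"
proof -
  have "- (sgn x * sgn y) * y + x = sgn x * (\<bar>x\<bar> - \<bar>y\<bar>)"
    by (simp add: algebra_simps abs_sgn)
  also have "\<bar>\<dots>\<bar> = \<bar>x\<bar> - \<bar>y\<bar>" using assms by (auto simp: abs_mult abs_sgn_eq)
  also have "\<dots> < \<bar>x\<bar>" using assms by simp
  finally show ?thesis .
qed

text \<open>Row reduction for an abstract property. It is later instantiated with being congruent to
  a product of an even number of generators.\<close>

locale elimination =
  fixes m :: int and n :: nat and R :: "int mat \<Rightarrow> bool"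
  assumes R_one: "R (1\<^sub>m n)"
    and R_step: "R A \<Longrightarrow> A \<in> carrier_mat n n \<Longrightarrow> k < n \<Longrightarrow> l < n \<Longrightarrow> k \<noteq> l \<Longrightarrow> R (addrow a k l A)"
begin

definition reach :: "int mat \<Rightarrow> bool" where
  "reach A \<longleftrightarrow> (\<exists>B. R B \<and> mcong m n B A)"

lemma addrow_index:
  "A \<in> carrier_mat n n \<Longrightarrow> i < n \<Longrightarrow> j < n \<Longrightarrow>
    addrow a k l A $$ (i,j) = (if k = i then a * A $$ (l,j) + A $$ (i,j) else A $$ (i,j))"
  by auto

lemma mcong_addrow:
  assumes "mcong m n A B" "l < n"
  shows "mcong m n (addrow a k l A) (addrow a k l B)"
  unfolding mcong_def
proof (intro conjI allI impI)
  fix i j assume ij: "i < n" "j < n"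
  have "m dvd a * (A $$ (l,j) - B $$ (l,j)) + (A $$ (i,j) - B $$ (i,j))"
    using assms ij by (intro dvd_add dvd_mult) (auto simp: mcong_def)
  moreover have "m dvd A $$ (i,j) - B $$ (i,j)" using assms ij by (auto simp: mcong_def)
  ultimately show "m dvd addrow a k l A $$ (i,j) - addrow a k l B $$ (i,j)"
    using assms ij by (auto simp: mcong_def algebra_simps)
qed (use assms in \<open>auto simp: mcong_def\<close>)

text \<open>A row operation is undone by the one with \<open>-a\<close>. So \<open>reach\<close> may
  be proved after row operations, and the reduction can run from \<open>A\<close> towards the
  identity.\<close>

lemma reach_addrow_back:
  assumes r: "reach (addrow a k l A)" and A: "A \<in> carrier_mat n n" and kl: "k < n" "l < n" "k \<noteq> l"
  shows "reach A"
proof -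
  obtain B where B: "R B" "mcong m n B (addrow a k l A)" using r by (auto simp: reach_def)
  have "addrow (-a) k l (addrow a k l A) = A"
    by (rule eq_matI) (use A kl in auto)
  hence "mcong m n (addrow (-a) k l B) A" using mcong_addrow[OF B(2) kl(2), of "-a" k] by simp
  moreover have "R (addrow (-a) k l B)" using R_step[OF B(1) mcong_carrier(1)[OF B(2)] kl] .
  ultimately show ?thesis by (auto simp: reach_def)
qed

definition lead :: "nat \<Rightarrow> int mat \<Rightarrow> bool" where
  "lead k A \<longleftrightarrow> A \<in> carrier_mat n n \<and> m dvd det A - 1 \<and>
     (\<forall>j<k. \<forall>i<n. m dvd A $$ (i,j) - (if i = j then 1 else 0))"

text \<open>Row \<open>s \<ge> k\<close> vanishes modulo \<open>m\<close> in the first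
  \<open>k\<close> columns, so adding a multiple of it leaves these columns as they are.\<close>

lemma lead_addrow:
  assumes A: "lead k A" and kn: "k \<le> n" and r: "r < n" "s < n" "r \<noteq> s" "k \<le> s"
  shows "lead k (addrow a r s A)"
  unfolding lead_def
proof (intro conjI allI impI)
  have Ac: "A \<in> carrier_mat n n" using A by (simp add: lead_def)
  thus "addrow a r s A \<in> carrier_mat n n" by simp
  show "m dvd det (addrow a r s A) - 1" using A det_addrow[OF r(2,3) Ac] by (simp add: lead_def)
  fix j i assume ij: "j < k" "i < n"
  have *: "\<forall>j<k. \<forall>i<n. m dvd A $$ (i,j) - (if i = j then 1 else 0)" using A by (simp add: lead_def)
  have "m dvd A $$ (i,j) - (if i = j then 1 else 0)" "m dvd A $$ (s,j) - (if s = j then 1 else 0)"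
    using *[rule_format, OF ij] *[rule_format, OF ij(1) r(2)] .
  moreover have "s \<noteq> j" using ij r by simp
  ultimately have "m dvd a * A $$ (s,j) + (A $$ (i,j) - (if i = j then 1 else 0))"
    "m dvd A $$ (i,j) - (if i = j then 1 else 0)" by auto
  thus "m dvd addrow a r s A $$ (i,j) - (if i = j then 1 else 0)"
    using ij kn Ac by (auto simp: algebra_simps)
qed

lemma clear_column:
  assumes IH: "\<And>A. lead (Suc k) A \<Longrightarrow> reach A" and k: "k < n"
  shows "lead k A \<Longrightarrow> m dvd A $$ (k,k) - 1 \<Longrightarrow> reach A"
proof (induction "card {i. i < n \<and> i \<noteq> k \<and> \<not> m dvd A $$ (i,k)}" arbitrary: A rule: less_induct)
  case less
  have Ac: "A \<in> carrier_mat n n" using less.prems by (simp add: lead_def)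
  show ?case
  proof (cases "\<exists>i<n. i \<noteq> k \<and> \<not> m dvd A $$ (i,k)")
    case False
    have "m dvd A $$ (i,j) - (if i = j then 1 else 0)" if ij: "j < Suc k" "i < n" for i j
    proof (cases "j = k")
      case True thus ?thesis using False less.prems(2) ij by (cases "i = k") auto
    next
      case False thus ?thesis using less.prems(1) ij by (auto simp: lead_def)
    qed
    hence "lead (Suc k) A" using less.prems by (auto simp: lead_def)
    thus ?thesis by (rule IH)
  next
    case True
    then obtain i where i: "i < n" "i \<noteq> k" "\<not> m dvd A $$ (i,k)" by auto
    define B where "B = addrow (- A $$ (i,k)) i k A"
    have Bk: "B $$ (r,k) = (if r = i then - A $$ (i,k) * A $$ (k,k) + A $$ (i,k) else A $$ (r,k))" if "r < n" for r
      unfolding B_def using addrow_index[OF Ac that k] by auto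
    have Bi: "m dvd B $$ (i,k)"
    proof -
      have "m dvd - A $$ (i,k) * (A $$ (k,k) - 1)" using less.prems(2) by (intro dvd_mult)
      also have "- A $$ (i,k) * (A $$ (k,k) - 1) = B $$ (i,k)" using Bk[OF i(1)] by (simp add: algebra_simps)
      finally show ?thesis .
    qed
    have "{r. r < n \<and> r \<noteq> k \<and> \<not> m dvd B $$ (r,k)} \<subset> {r. r < n \<and> r \<noteq> k \<and> \<not> m dvd A $$ (r,k)}"
    proof
      show "{r. r < n \<and> r \<noteq> k \<and> \<not> m dvd B $$ (r,k)} \<subseteq> {r. r < n \<and> r \<noteq> k \<and> \<not> m dvd A $$ (r,k)}"
      proof clarify
        fix r assume r: "r < n" "r \<noteq> k" "\<not> m dvd B $$ (r,k)" "m dvd A $$ (r,k)"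
        hence "r \<noteq> i" using Bi by auto
        thus False using r Bk by simp
      qed
      show "{r. r < n \<and> r \<noteq> k \<and> \<not> m dvd B $$ (r,k)} \<noteq> {r. r < n \<and> r \<noteq> k \<and> \<not> m dvd A $$ (r,k)}"
        using Bi i by blast
    qed
    hence "card {r. r < n \<and> r \<noteq> k \<and> \<not> m dvd B $$ (r,k)} < card {r. r < n \<and> r \<noteq> k \<and> \<not> m dvd A $$ (r,k)}"
      by (intro psubset_card_mono) auto
    moreover have "lead k B" unfolding B_def by (rule lead_addrow[OF less.prems(1)]) (use k i in auto)
    moreover have "m dvd B $$ (k,k) - 1" using Bk[OF k] i less.prems(2) by simp
    ultimately have "reach B" by (rule less.hyps)
    thus ?thesis unfolding B_def by (rule reach_addrow_back) (use Ac i k in auto)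
  qed
qed

text \<open>Row \<open>k\<close> of the adjugate times column \<open>k\<close> of \<open>A\<close>
  is \<open>det A\<close>, hence 1 modulo \<open>m\<close>. The adjugate entries before position
  \<open>k\<close> vanish modulo \<open>m\<close>, because the first \<open>k\<close> columns of
  \<open>A\<close> are unit vectors there, and among the rows from \<open>k\<close> on only
  \<open>i0\<close> contributes.\<close>

lemma pivot_unit:
  assumes A: "lead k A" and k: "k < n" and i0: "k \<le> i0" "i0 < n"
    and single: "\<And>i. k \<le> i \<Longrightarrow> i < n \<Longrightarrow> i \<noteq> i0 \<Longrightarrow> A $$ (i,k) = 0"
  shows "m dvd adj_mat A $$ (k,i0) * A $$ (i0,k) - 1"
proof -
  have Ac: "A \<in> carrier_mat n n" and dA: "m dvd det A - 1" using A by (auto simp: lead_def)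
  define H where "H = adj_mat A"
  have H: "H \<in> carrier_mat n n" "H * A = det A \<cdot>\<^sub>m 1\<^sub>m n" using adj_mat[OF Ac] by (auto simp: H_def)
  have HA: "(\<Sum>i = 0..<n. H $$ (k,i) * A $$ (i,j)) = (if k = j then det A else 0)" if "j < n" for j
  proof -
    have "(H * A) $$ (k,j) = (\<Sum>i = 0..<n. H $$ (k,i) * A $$ (i,j))"
      using H(1) Ac k that by (auto simp: scalar_prod_def)
    hence "(\<Sum>i = 0..<n. H $$ (k,i) * A $$ (i,j)) = (det A \<cdot>\<^sub>m 1\<^sub>m n) $$ (k,j)" using H(2) by simp
    thus ?thesis using k that by auto
  qed
  have H0: "m dvd H $$ (k,j)" if j: "j < k" for j
  proof -
    have "m dvd (\<Sum>i = 0..<n. H $$ (k,i) * A $$ (i,j)) - (\<Sum>i = 0..<n. H $$ (k,i) * (if i = j then 1 else 0))"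
      using A j k by (intro dvd_diff_sum dvd_diff_mult) (auto simp: lead_def)
    also have "(\<Sum>i = 0..<n. H $$ (k,i) * (if i = j then 1 else 0)) = (\<Sum>i = 0..<n. if i = j then H $$ (k,i) else 0)"
      by (rule sum.cong) auto
    also have "\<dots> = H $$ (k,j)" using j k by simp
    finally show ?thesis using HA[of j] j k by simp
  qed
  have "(\<Sum>i = 0..<n. H $$ (k,i) * A $$ (i,k)) = H $$ (k,i0) * A $$ (i0,k) + (\<Sum>i\<in>{0..<n} - {i0}. H $$ (k,i) * A $$ (i,k))"
    using i0 by (subst sum.remove[of _ i0]) auto
  moreover have "m dvd (\<Sum>i\<in>{0..<n} - {i0}. H $$ (k,i) * A $$ (i,k))"
  proof (rule dvd_sum)
    fix i assume i: "i \<in> {0..<n} - {i0}"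
    show "m dvd H $$ (k,i) * A $$ (i,k)"
      by (cases "i < k") (use H0 single i in \<open>auto simp: not_less\<close>)
  qed
  ultimately have "m dvd det A - H $$ (k,i0) * A $$ (i0,k)" using HA[OF k] by auto
  from dvd_diff[OF dA this] show ?thesis by (simp add: H_def)
qed

text \<open>In the last column no further row is available to correct the pivot, so the determinant
  has to do it: the complementary minor is the identity modulo \<open>m\<close>, which leaves 1 for
  the pivot.\<close>

lemma last_pivot:
  assumes A: "lead k A" and k: "Suc k = n"
  shows "m dvd A $$ (k,k) - 1"
proof -
  have Ac: "A \<in> carrier_mat n n" using A by (simp add: lead_def)
  have u: "m dvd adj_mat A $$ (k,k) * A $$ (k,k) - 1"
    by (rule pivot_unit[OF A]) (use k in auto)
  have "adj_mat A $$ (k,k) = det (mat_delete A k k)"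
    using Ac k by (simp add: adj_mat_def cofactor_def)
  moreover have "mcong m k (mat_delete A k k) (1\<^sub>m k)"
    unfolding mcong_def
  proof (intro conjI allI impI)
    show "mat_delete A k k \<in> carrier_mat k k" using Ac k by (auto simp: mat_delete_def)
    fix i j assume ij: "i < k" "j < k"
    have "m dvd A $$ (i,j) - (if i = j then 1 else 0)" using A ij k by (auto simp: lead_def)
    thus "m dvd mat_delete A k k $$ (i,j) - 1\<^sub>m k $$ (i,j)" using ij Ac k by (simp add: mat_delete_def)
  qed simp
  ultimately have "m dvd adj_mat A $$ (k,k) - 1" using mcong_det by fastforce
  hence "m dvd (adj_mat A $$ (k,k) - 1) * A $$ (k,k)" by simp
  from dvd_diff[OF u this] show ?thesis by (simp add: algebra_simps)
qed

text \<open>Euclid's algorithm on the entries of column \<open>k\<close> from row \<open>k\<close>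
  on, measured by the sum of absolute values, ends with at most one nonzero entry. This entry is a
  unit modulo \<open>m\<close>, and the case distinction turns it into a pivot 1.\<close>

lemma reduce_column:
  assumes IH: "\<And>A. lead (Suc k) A \<Longrightarrow> reach A" and k: "k < n"
  shows "lead k A \<Longrightarrow> reach A"
proof (induction "\<Sum>i\<in>{k..<n}. nat \<bar>A $$ (i,k)\<bar>" arbitrary: A rule: less_induct)
  case less
  note A = less.prems
  have Ac: "A \<in> carrier_mat n n" using A by (simp add: lead_def)
  show ?case
  proof (cases "\<exists>i\<in>{k..<n}. \<exists>j\<in>{k..<n}. i \<noteq> j \<and> A $$ (j,k) \<noteq> 0 \<and> \<bar>A $$ (i,k)\<bar> \<ge> \<bar>A $$ (j,k)\<bar>")
    case True
    then obtain i j where ij: "i \<in> {k..<n}" "j \<in> {k..<n}" "i \<noteq> j" "A $$ (j,k) \<noteq> 0" "\<bar>A $$ (i,k)\<bar> \<ge> \<bar>A $$ (j,k)\<bar>"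
      by auto
    define c where "c = - (sgn (A $$ (i,k)) * sgn (A $$ (j,k)))"
    define B where "B = addrow c i j A"
    have Bk: "B $$ (r,k) = (if r = i then c * A $$ (j,k) + A $$ (i,k) else A $$ (r,k))" if "r < n" for r
      unfolding B_def using addrow_index[OF Ac that k] by auto
    have "\<bar>c * A $$ (j,k) + A $$ (i,k)\<bar> < \<bar>A $$ (i,k)\<bar>"
      unfolding c_def by (rule abs_reduce[OF ij(4,5)])
    hence "\<bar>B $$ (i,k)\<bar> < \<bar>A $$ (i,k)\<bar>" using Bk[of i] ij(1) by simp
    hence lt: "nat \<bar>B $$ (i,k)\<bar> < nat \<bar>A $$ (i,k)\<bar>" by simp
    have "(\<Sum>r\<in>{k..<n}. nat \<bar>B $$ (r,k)\<bar>) < (\<Sum>r\<in>{k..<n}. nat \<bar>A $$ (r,k)\<bar>)"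
    proof (rule sum_strict_mono_ex1)
      show "\<forall>r\<in>{k..<n}. nat \<bar>B $$ (r,k)\<bar> \<le> nat \<bar>A $$ (r,k)\<bar>"
      proof
        fix r assume r: "r \<in> {k..<n}"
        show "nat \<bar>B $$ (r,k)\<bar> \<le> nat \<bar>A $$ (r,k)\<bar>"
        proof (cases "r = i")
          case True show ?thesis unfolding True by (rule less_imp_le[OF lt])
        next
          case False thus ?thesis using Bk[of r] r by simp
        qed
      qed
      show "\<exists>r\<in>{k..<n}. nat \<bar>B $$ (r,k)\<bar> < nat \<bar>A $$ (r,k)\<bar>" using lt ij(1) by blast
    qed simp
    moreover have "lead k B" unfolding B_def by (rule lead_addrow[OF A]) (use ij k in auto)
    ultimately have "reach B" by (rule less.hyps)
    thus ?thesis unfolding B_def by (rule reach_addrow_back) (use Ac ij in auto)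
  next
    case False
    have single: "\<not> (i \<noteq> j \<and> A $$ (j,k) \<noteq> 0 \<and> \<bar>A $$ (i,k)\<bar> \<ge> \<bar>A $$ (j,k)\<bar>)"
      if "i \<in> {k..<n}" "j \<in> {k..<n}" for i j using False that by blast
    have "\<exists>i0. k \<le> i0 \<and> i0 < n \<and> (\<forall>i. k \<le> i \<longrightarrow> i < n \<longrightarrow> i \<noteq> i0 \<longrightarrow> A $$ (i,k) = 0)"
    proof (cases "\<exists>i0\<in>{k..<n}. A $$ (i0,k) \<noteq> 0")
      case True
      then obtain i0 where i0: "i0 \<in> {k..<n}" "A $$ (i0,k) \<noteq> 0" by auto
      have "A $$ (i,k) = 0" if "k \<le> i" "i < n" "i \<noteq> i0" for i
      proof (rule ccontr)
        assume nz: "A $$ (i,k) \<noteq> 0"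
        have "\<bar>A $$ (i,k)\<bar> \<ge> \<bar>A $$ (i0,k)\<bar> \<or> \<bar>A $$ (i0,k)\<bar> \<ge> \<bar>A $$ (i,k)\<bar>" by linarith
        thus False using single[of i i0] single[of i0 i] that i0 nz by auto
      qed
      thus ?thesis using i0 by auto
    next
      case False
      thus ?thesis using k by (intro exI[of _ k]) auto
    qed
    then obtain i0 where i0: "k \<le> i0" "i0 < n" "\<And>i. k \<le> i \<Longrightarrow> i < n \<Longrightarrow> i \<noteq> i0 \<Longrightarrow> A $$ (i,k) = 0" by blast
    define g where "g = A $$ (i0,k)"
    define h where "h = adj_mat A $$ (k,i0)"
    have hg: "m dvd h * g - 1" unfolding h_def g_def by (rule pivot_unit[OF A k i0])
    consider (a) "i0 \<noteq> k" | (b) "i0 = k" "Suc k < n" | (c) "i0 = k" "Suc k = n" using k by linarith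
    thus ?thesis
    proof cases
      \<comment> \<open>The pivot position holds 0, so adding \<open>h\<close> times row
        \<open>i0\<close> puts \<open>h * g\<close> there, which is 1 modulo
        \<open>m\<close>.\<close>
      case a
      define B where "B = addrow h k i0 A"
      have "B $$ (k,k) = h * g" unfolding B_def using addrow_index[OF Ac k k] i0(3)[of k] a k by (simp add: g_def)
      hence "m dvd B $$ (k,k) - 1" using hg by simp
      moreover have "lead k B" unfolding B_def by (rule lead_addrow[OF A]) (use a i0 k in auto)
      ultimately have "reach B" using clear_column[OF IH k] by blast
      thus ?thesis unfolding B_def by (rule reach_addrow_back) (use Ac a i0 k in auto)
    next
      \<comment> \<open>The unit \<open>g\<close> is already at the pivot. The next row receives
        \<open>h * g\<close>, that is 1 modulo \<open>m\<close>, and adding \<open>1 - g\<close>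
        times this row corrects \<open>g\<close> to 1.\<close>
      case b
      define B where "B = addrow h (Suc k) k A"
      define C where "C = addrow (1 - g) k (Suc k) B"
      have Bc: "B \<in> carrier_mat n n" using Ac by (simp add: B_def)
      have B1: "B $$ (Suc k,k) = h * g" unfolding B_def using addrow_index[OF Ac b(2) k] i0(3)[of "Suc k"] b by (simp add: g_def)
      have B2: "B $$ (k,k) = g" unfolding B_def using addrow_index[OF Ac k k] b by (simp add: g_def)
      have "C $$ (k,k) - 1 = (1 - g) * (h * g - 1)"
        unfolding C_def using addrow_index[OF Bc k k] B1 B2 by (simp add: algebra_simps)
      hence "m dvd C $$ (k,k) - 1" using hg by simp
      moreover have lB: "lead k B" unfolding B_def by (rule lead_addrow[OF A]) (use b k in auto)
      moreover have "lead k C" unfolding C_def by (rule lead_addrow[OF lB]) (use b k in auto)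
      ultimately have "reach C" using clear_column[OF IH k] by blast
      hence "reach B" unfolding C_def by (rule reach_addrow_back) (use Bc b k in auto)
      thus ?thesis unfolding B_def by (rule reach_addrow_back) (use Ac b k in auto)
    next
      case c
      have "m dvd A $$ (k,k) - 1" by (rule last_pivot[OF A c(2)])
      thus ?thesis using clear_column[OF IH k A] by blast
    qed
  qed
qed

theorem reach_all:
  assumes "A \<in> carrier_mat n n" "m dvd det A - 1"
  shows "reach A"
proof -
  have all: "lead k A \<Longrightarrow> reach A" if "k \<le> n" for k A
    using that
  proof (induction k arbitrary: A rule: inc_induct)
    case base
    have "mcong m n (1\<^sub>m n) A"
      using base by - (rule mcong_sym, auto simp: lead_def mcong_def)
    thus ?case using R_one by (auto simp: reach_def)
  next
    case (step k)
    show ?case by (rule reduce_column[OF step.IH step.hyps(2) step.prems])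
  qed
  thus ?thesis using assms by (intro all[of 0]) (auto simp: lead_def)
qed

end

section \<open>Words representing a matrix modulo an odd integer\<close>

lemma word_prod_carrier: "set ws \<subseteq> carrier_mat n n \<Longrightarrow> word_prod n ws \<in> carrier_mat n n"
  by (induction ws) (auto simp: word_prod_def)

lemma word_prod_append:
  assumes "set us \<subseteq> carrier_mat n n" "set vs \<subseteq> carrier_mat n n"
  shows "word_prod n (us @ vs) = word_prod n us * word_prod n vs"
  using assms(1)
proof (induction us)
  case Nil
  thus ?case using word_prod_carrier[OF assms(2)] by (simp add: word_prod_def)
next
  case (Cons u us)
  have "word_prod n ((u # us) @ vs) = u * (word_prod n us * word_prod n vs)"
    using Cons by (simp add: word_prod_def)
  also have "\<dots> = u * word_prod n us * word_prod n vs"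
    using Cons.prems word_prod_carrier[of us n] word_prod_carrier[OF assms(2)]
    by (subst assoc_mult_mat[of _ n n _ n _ n]) auto
  finally show ?case by (simp add: word_prod_def)
qed

lemma sym_gens_SL:
  assumes "generates_SL n S"
  shows "sym_gens n S \<subseteq> SL_int n"
proof
  fix B assume "B \<in> sym_gens n S"
  moreover have SSL: "S \<subseteq> SL_int n" using assms unfolding generates_SL_def by blast
  ultimately consider "B \<in> S" | A where "A \<in> S" "B \<in> carrier_mat n n" "A * B = 1\<^sub>m n"
    by (auto simp: sym_gens_def)
  thus "B \<in> SL_int n"
  proof cases
    case 1 thus ?thesis using SSL by auto
  next
    case 2
    hence A: "A \<in> carrier_mat n n" "det A = 1" using SSL by (auto simp: SL_int_def)
    have "det A * det B = 1" using det_mult[OF A(1) 2(2)] 2(3) by simp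
    thus ?thesis using A 2 by (simp add: SL_int_def)
  qed
qed

text \<open>Modulo an odd \<open>m\<close> every elementary matrix is the square of another one. This rules out a parity
  obstruction to the mixing of the walk.\<close>

lemma even_words:
  assumes gen: "generates_SL n S" and m: "odd m" and A: "A \<in> carrier_mat n n" "m dvd det A - 1"
  shows "\<exists>ws. set ws \<subseteq> sym_gens n S \<and> even (length ws) \<and> mcong m n (word_prod n ws) A"
proof -
  have Tc: "sym_gens n S \<subseteq> carrier_mat n n" using sym_gens_SL[OF gen] by (auto simp: SL_int_def)
  define R where "R = (\<lambda>A. \<exists>ws. set ws \<subseteq> sym_gens n S \<and> even (length ws) \<and> mcong m n (word_prod n ws) A)"
  interpret elimination m n R
  proof
    show "R (1\<^sub>m n)" unfolding R_def by (rule exI[of _ "[]"]) (auto simp: word_prod_def mcong_refl)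
  next
    fix A k l a assume RA: "R A" and A: "A \<in> carrier_mat n n" and kl: "k < n" "l < n" "k \<noteq> l"
    obtain ws where ws: "set ws \<subseteq> sym_gens n S" "even (length ws)" "mcong m n (word_prod n ws) A"
      using RA by (auto simp: R_def)
    \<comment> \<open>\<open>q + 1\<close> is the inverse of 2 modulo \<open>m\<close>, so the
      operation with \<open>b\<close> applied twice amounts to the one with \<open>a\<close>, and
      repeating the word \<open>w\<close> keeps the length even.\<close>
    obtain q where q: "m = 2 * q + 1" using m by (elim oddE)
    define b where "b = a * (q + 1)"
    define E where "E = addrow_mat n b k l"
    have Ec: "E \<in> carrier_mat n n" by (simp add: E_def)
    have "E \<in> SL_int n" using det_addrow_mat[OF kl(3)] by (simp add: E_def SL_int_def)
    moreover have "SL_int n = {word_prod n ws | ws. set ws \<subseteq> sym_gens n S}"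
      using gen unfolding generates_SL_def by blast
    ultimately obtain w where w: "set w \<subseteq> sym_gens n S" "E = word_prod n w" by blast
    have c: "set w \<subseteq> carrier_mat n n" "set ws \<subseteq> carrier_mat n n" using w ws Tc by auto
    have "word_prod n (w @ w @ ws) = E * (E * word_prod n ws)"
      using c w(2) by (simp add: word_prod_append)
    moreover have "mcong m n (E * (E * word_prod n ws)) (E * (E * A))"
      by (intro mcong_mult mcong_refl Ec ws)
    moreover have "E * (E * A) = addrow b k l (addrow b k l A)"
      using A kl by (simp add: E_def addrow_mat[symmetric])
    moreover have "mcong m n (addrow b k l (addrow b k l A)) (addrow a k l A)"
      unfolding mcong_def
    proof (intro conjI allI impI)
      fix i j assume ij: "i < n" "j < n"
      have "b * A $$ (l,j) + (b * A $$ (l,j) + A $$ (i,j)) - (a * A $$ (l,j) + A $$ (i,j)) = m * (a * A $$ (l,j))"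
        unfolding b_def q by (simp add: algebra_simps)
      thus "m dvd addrow b k l (addrow b k l A) $$ (i,j) - addrow a k l A $$ (i,j)"
        using ij A kl by auto
    qed (use A in auto)
    ultimately have "mcong m n (word_prod n (w @ w @ ws)) (addrow a k l A)" using mcong_trans by metis
    thus "R (addrow a k l A)" unfolding R_def using w ws by (intro exI[of _ "w @ w @ ws"]) auto
  qed
  obtain B where B: "R B" "mcong m n B A" using reach_all[OF A] by (auto simp: reach_def)
  thus ?thesis unfolding R_def using mcong_trans by blast
qed

section \<open>Equidistribution of words\<close>

lemma finite_words: "finite T \<Longrightarrow> finite (words T L)"
  unfolding words_def by (rule finite_lists_length_eq)

lemma card_words: "finite T \<Longrightarrow> card (words T L) = card T ^ L"
  unfolding words_def by (rule card_lists_length_eq)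

lemma bij_words_append:
  "bij_betw (\<lambda>(us, vs). us @ vs) (words T a \<times> words T b) (words T (a + b))"
proof (rule bij_betw_byWitness[of _ "\<lambda>ws. (take a ws, drop a ws)"])
  show "(\<lambda>ws. (take a ws, drop a ws)) ` words T (a + b) \<subseteq> words T a \<times> words T b"
    by (auto simp: words_def dest: in_set_takeD in_set_dropD)
qed (auto simp: words_def)

text \<open>\<open>mixing\<close> asks for one length \<open>K\<close> common to all pairs of
  states, so every transition in \<open>K\<close> steps has positive probability. Bijectivity of the
  action makes the uniform distribution stationary.\<close>

locale finite_walk =
  fixes T :: "'a set" and X :: "'x set" and act :: "'a \<Rightarrow> 'x \<Rightarrow> 'x" and K :: nat
  assumes finT: "finite T" and T_ne: "T \<noteq> {}" and finX: "finite X" and X_ne: "X \<noteq> {}"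
    and act_bij: "t \<in> T \<Longrightarrow> bij_betw (act t) X X"
    and K_pos: "K > 0"
    and mixing: "x \<in> X \<Longrightarrow> y \<in> X \<Longrightarrow> \<exists>ws\<in>words T K. foldr act ws x = y"
begin

definition avg :: "nat \<Rightarrow> ('x \<Rightarrow> real) \<Rightarrow> 'x \<Rightarrow> real" where
  "avg L h x = (\<Sum>ws\<in>words T L. h (foldr act ws x)) / real (card T ^ L)"

lemma cardT_pos: "card T > 0" using finT T_ne by (simp add: card_gt_0_iff)

lemma foldr_bij: "set ws \<subseteq> T \<Longrightarrow> bij_betw (foldr act ws) X X"
proof (induction ws)
  case Nil thus ?case by (simp add: bij_betw_def)
next
  case (Cons w ws)
  hence "bij_betw (act w \<circ> foldr act ws) X X" using act_bij bij_betw_trans by (metis insert_subset list.simps(15))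
  thus ?case by (simp add: comp_def)
qed

lemma words_bij: "ws \<in> words T L \<Longrightarrow> bij_betw (foldr act ws) X X"
  using foldr_bij by (simp add: words_def)

lemma words_in: "ws \<in> words T L \<Longrightarrow> x \<in> X \<Longrightarrow> foldr act ws x \<in> X"
  using words_bij by (auto simp: bij_betw_def)

lemma avg_add: "avg (a + b) h x = avg b (avg a h) x"
proof -
  have "(\<Sum>ws\<in>words T (a + b). h (foldr act ws x))
      = (\<Sum>(us, vs)\<in>words T a \<times> words T b. h (foldr act us (foldr act vs x)))"
    by (subst sum.reindex_bij_betw[OF bij_words_append, symmetric]) (simp add: case_prod_unfold)
  also have "\<dots> = (\<Sum>vs\<in>words T b. \<Sum>us\<in>words T a. h (foldr act us (foldr act vs x)))"
    by (subst sum.swap) (rule sum.cartesian_product[symmetric])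
  finally show ?thesis by (simp add: avg_def power_add sum_divide_distrib mult_ac)
qed

lemma avg_sum: "(\<Sum>x\<in>X. avg L h x) = (\<Sum>x\<in>X. h x)"
proof -
  have "(\<Sum>x\<in>X. avg L h x) = (\<Sum>x\<in>X. \<Sum>ws\<in>words T L. h (foldr act ws x)) / real (card T ^ L)"
    by (simp add: avg_def sum_divide_distrib)
  also have "(\<Sum>x\<in>X. \<Sum>ws\<in>words T L. h (foldr act ws x)) = (\<Sum>ws\<in>words T L. \<Sum>x\<in>X. h (foldr act ws x))"
    by (rule sum.swap)
  also have "\<dots> = (\<Sum>ws\<in>words T L. \<Sum>x\<in>X. h x)"
    by (rule sum.cong[OF refl]) (rule sum.reindex_bij_betw[OF words_bij])
  also have "\<dots> = real (card T ^ L) * (\<Sum>x\<in>X. h x)" by (simp add: card_words[OF finT])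
  finally show ?thesis using cardT_pos by simp
qed

definition osc :: "('x \<Rightarrow> real) \<Rightarrow> real" where "osc h = Max (h ` X) - Min (h ` X)"

lemma h_bounds: "x \<in> X \<Longrightarrow> Min (h ` X) \<le> h x \<and> h x \<le> Max (h ` X)"
  using finX by auto

lemma osc_le: "(\<And>x. x \<in> X \<Longrightarrow> lo \<le> h x \<and> h x \<le> hi) \<Longrightarrow> osc h \<le> hi - lo"
proof -
  assume b: "\<And>x. x \<in> X \<Longrightarrow> lo \<le> h x \<and> h x \<le> hi"
  have "Max (h ` X) \<in> h ` X" "Min (h ` X) \<in> h ` X" using finX X_ne by (auto intro!: Max_in Min_in)
  thus ?thesis using b unfolding osc_def by (smt (verit) imageE)
qed

lemma avg_bounds:
  assumes b: "\<And>x. x \<in> X \<Longrightarrow> lo \<le> h x \<and> h x \<le> hi" and x: "x \<in> X"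
  shows "lo \<le> avg L h x \<and> avg L h x \<le> hi"
proof -
  have "(\<Sum>ws\<in>words T L. lo) \<le> (\<Sum>ws\<in>words T L. h (foldr act ws x))"
    by (rule sum_mono) (use b words_in x in blast)
  moreover have "(\<Sum>ws\<in>words T L. h (foldr act ws x)) \<le> (\<Sum>ws\<in>words T L. hi)"
    by (rule sum_mono) (use b words_in x in blast)
  ultimately show ?thesis using cardT_pos by (simp add: avg_def card_words[OF finT] field_simps)
qed

definition \<delta> :: real where "\<delta> = 1 / real (card T ^ K)"

lemma delta: "0 < \<delta>" "\<delta> \<le> 1"
proof -
  have "card T ^ K \<ge> 1" using cardT_pos by simp
  hence "real (card T ^ K) \<ge> 1" by linarith
  thus "0 < \<delta>" "\<delta> \<le> 1" unfolding \<delta>_def using cardT_pos by (simp_all only: divide_le_eq_1) auto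
qed

text \<open>From every \<open>x\<close> some word of length \<open>K\<close>, of weight
  \<open>\<delta>\<close>, reaches a point where \<open>h\<close> is maximal. So the minimum rises
  by at least \<open>\<delta>\<close> times the oscillation, while the maximum does not
  rise.\<close>

lemma osc_contract: "osc (avg K h) \<le> (1 - \<delta>) * osc h"
proof -
  define lo where "lo = Min (h ` X)"
  define hi where "hi = Max (h ` X)"
  have b: "lo \<le> h x \<and> h x \<le> hi" if "x \<in> X" for x using h_bounds[OF that] by (simp add: lo_def hi_def)
  have "hi \<in> h ` X" using finX X_ne unfolding hi_def by (intro Max_in) auto
  then obtain z where z: "z \<in> X" "h z = hi" by auto
  have "lo + \<delta> * (hi - lo) \<le> avg K h x \<and> avg K h x \<le> hi" if x: "x \<in> X" for x
  proof
    show "avg K h x \<le> hi" using avg_bounds[of lo h hi x, OF b x] by blast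
    obtain w where w: "w \<in> words T K" "foldr act w x = z" using mixing[OF x z(1)] by auto
    have "(\<Sum>ws\<in>words T K. h (foldr act ws x)) = hi + (\<Sum>ws\<in>words T K - {w}. h (foldr act ws x))"
      using w z by (subst sum.remove[OF finite_words[OF finT] w(1)]) simp
    moreover have "(\<Sum>ws\<in>words T K - {w}. h (foldr act ws x)) \<ge> (\<Sum>ws\<in>words T K - {w}. lo)"
      by (rule sum_mono) (use b words_in x in blast)
    moreover have "(\<Sum>ws\<in>words T K - {w}. lo) = real (card T ^ K) * lo - lo"
    proof -
      have "(\<Sum>ws\<in>words T K. lo) = lo + (\<Sum>ws\<in>words T K - {w}. lo)"
        by (rule sum.remove[OF finite_words[OF finT] w(1)])
      thus ?thesis by (simp add: card_words[OF finT])
    qed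
    ultimately have "(\<Sum>ws\<in>words T K. h (foldr act ws x)) \<ge> real (card T ^ K) * lo + (hi - lo)" by simp
    hence "avg K h x \<ge> (real (card T ^ K) * lo + (hi - lo)) / real (card T ^ K)"
      unfolding avg_def by (intro divide_right_mono) auto
    also have "(real (card T ^ K) * lo + (hi - lo)) / real (card T ^ K) = lo + \<delta> * (hi - lo)"
      using cardT_pos by (simp add: \<delta>_def field_simps)
    finally show "lo + \<delta> * (hi - lo) \<le> avg K h x" .
  qed
  from osc_le[OF this] have "osc (avg K h) \<le> hi - (lo + \<delta> * (hi - lo))" .
  thus ?thesis by (simp add: osc_def lo_def hi_def algebra_simps)
qed

lemma osc_iterate: "osc (avg (r + k * K) h) \<le> (1 - \<delta>) ^ k * osc h"
proof (induction k)
  case 0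
  have "osc (avg r h) \<le> Max (h ` X) - Min (h ` X)"
    by (rule osc_le) (rule avg_bounds[OF h_bounds])
  thus ?case by (simp add: osc_def)
next
  case (Suc k)
  have "avg (r + Suc k * K) h = avg K (avg (r + k * K) h)"
    using avg_add[of "r + k * K" K h] by (simp add: algebra_simps fun_eq_iff)
  hence "osc (avg (r + Suc k * K) h) \<le> (1 - \<delta>) * osc (avg (r + k * K) h)" using osc_contract by simp
  also have "\<dots> \<le> (1 - \<delta>) * ((1 - \<delta>) ^ k * osc h)" using Suc delta by (intro mult_left_mono) auto
  finally show ?case by (simp add: mult_ac)
qed

text \<open>Averaging preserves the mean over \<open>X\<close>, which therefore lies between the
  minimum and the maximum of \<open>avg L h\<close>. The error is at most the oscillation, and this
  decays geometrically in \<open>L div K\<close>.\<close>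

theorem equidistribution:
  assumes x0: "x0 \<in> X"
  shows "(\<lambda>L. avg L h x0) \<longlonglongrightarrow> (\<Sum>x\<in>X. h x) / real (card X)"
proof -
  define \<mu> where "\<mu> = (\<Sum>x\<in>X. h x) / real (card X)"
  have cX: "real (card X) > 0" using finX X_ne by (simp add: card_gt_0_iff)
  have le: "\<bar>avg L h x0 - \<mu>\<bar> \<le> (1 - \<delta>) ^ (L div K) * osc h" for L
  proof -
    define g where "g = avg L h"
    have "real (card X) * Min (g ` X) \<le> (\<Sum>x\<in>X. g x)"
      using sum_mono[of X "\<lambda>_. Min (g ` X)" g] h_bounds[of _ g] by simp
    moreover have "(\<Sum>x\<in>X. g x) \<le> real (card X) * Max (g ` X)"
      using sum_mono[of X g "\<lambda>_. Max (g ` X)"] h_bounds[of _ g] by simp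
    moreover have "(\<Sum>x\<in>X. g x) = real (card X) * \<mu>"
      unfolding g_def avg_sum using cX by (simp add: \<mu>_def)
    ultimately have "Min (g ` X) \<le> \<mu>" "\<mu> \<le> Max (g ` X)" using cX by auto
    hence "\<bar>g x0 - \<mu>\<bar> \<le> osc g" using h_bounds[OF x0, of g] by (auto simp: osc_def)
    also have "osc g \<le> (1 - \<delta>) ^ (L div K) * osc h"
      using osc_iterate[of "L mod K" "L div K" h] by (simp add: g_def)
    finally show ?thesis by (simp add: g_def)
  qed
  have "filterlim (\<lambda>L. L div K) at_top sequentially"
    unfolding filterlim_at_top
  proof
    fix Z
    show "eventually (\<lambda>L. Z \<le> L div K) sequentially"
      using K_pos by (intro eventually_sequentiallyI[of "Z * K"]) (simp add: less_eq_div_iff_mult_less_eq)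
  qed
  moreover have "(\<lambda>k. (1 - \<delta>) ^ k) \<longlonglongrightarrow> 0" using delta by (intro LIMSEQ_power_zero) auto
  ultimately have "(\<lambda>L. (1 - \<delta>) ^ (L div K)) \<longlonglongrightarrow> 0" by (rule filterlim_compose[rotated])
  hence lim: "(\<lambda>L. (1 - \<delta>) ^ (L div K) * osc h) \<longlonglongrightarrow> 0" by (rule tendsto_mult_left_zero)
  have "(\<lambda>L. \<bar>avg L h x0 - \<mu>\<bar>) \<longlonglongrightarrow> 0"
    by (rule tendsto_sandwich[OF _ _ tendsto_const lim]) (simp_all add: le)
  hence "(\<lambda>L. avg L h x0 - \<mu>) \<longlonglongrightarrow> 0" by (rule tendsto_rabs_zero_cancel)
  thus ?thesis unfolding \<mu>_def[symmetric] by (simp add: LIM_zero_iff)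
qed

end

section \<open>The walk on matrices modulo an integer\<close>

lemma right_inverse_adj:
  assumes A: "A \<in> SL_int n" and B: "B \<in> carrier_mat n n" "A * B = 1\<^sub>m n"
  shows "B = adj_mat A"
proof -
  have Ac: "A \<in> carrier_mat n n" "det A = 1" using A by (auto simp: SL_int_def)
  have "adj_mat A * (A * B) = (adj_mat A * A) * B"
    by (rule assoc_mult_mat[symmetric]) (use adj_mat(1)[OF Ac(1)] Ac B in auto)
  also have "adj_mat A * A = 1\<^sub>m n" using adj_mat(3)[OF Ac(1)] Ac(2) by (auto intro!: eq_matI)
  finally show ?thesis using B adj_mat(1)[OF Ac(1)] by simp
qed

lemma adj_inverse:
  assumes A: "A \<in> SL_int n"
  shows "A * adj_mat A = 1\<^sub>m n" "adj_mat A * A = 1\<^sub>m n" "adj_mat A \<in> carrier_mat n n"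
proof -
  have Ac: "A \<in> carrier_mat n n" "det A = 1" using A by (auto simp: SL_int_def)
  show "A * adj_mat A = 1\<^sub>m n" using adj_mat(2)[OF Ac(1)] Ac(2) by (auto intro!: eq_matI)
  show "adj_mat A * A = 1\<^sub>m n" using adj_mat(3)[OF Ac(1)] Ac(2) by (auto intro!: eq_matI)
  show "adj_mat A \<in> carrier_mat n n" by (rule adj_mat(1)[OF Ac(1)])
qed

lemma finite_sym_gens:
  assumes "finite S" "generates_SL n S"
  shows "finite (sym_gens n S)"
proof (rule finite_subset)
  have "S \<subseteq> SL_int n" using assms unfolding generates_SL_def by blast
  thus "sym_gens n S \<subseteq> S \<union> adj_mat ` S" unfolding sym_gens_def using right_inverse_adj by blast
  show "finite (S \<union> adj_mat ` S)" using assms by simp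
qed

lemma sym_gens_inverse:
  assumes gen: "generates_SL n S" and t: "t \<in> sym_gens n S"
  shows "\<exists>t'\<in>sym_gens n S. t * t' = 1\<^sub>m n"
proof -
  have SSL: "S \<subseteq> SL_int n" using gen unfolding generates_SL_def by blast
  consider "t \<in> S" | A where "A \<in> S" "t \<in> carrier_mat n n" "A * t = 1\<^sub>m n" using t unfolding sym_gens_def by blast
  thus ?thesis
  proof cases
    case 1
    hence "adj_mat t \<in> sym_gens n S" using SSL adj_inverse unfolding sym_gens_def by blast
    thus ?thesis using adj_inverse(1) SSL 1 by blast
  next
    case 2
    hence "t * A = 1\<^sub>m n" using right_inverse_adj adj_inverse(2) SSL by blast
    thus ?thesis using 2(1) unfolding sym_gens_def by blast
  qed
qed

text \<open>Without generators every product would be the identity, but an elementary matrix of size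
  at least 2 is not.\<close>

lemma sym_gens_nonempty:
  assumes gen: "generates_SL n S" and n: "n \<ge> 2"
  shows "sym_gens n S \<noteq> {}"
proof
  assume e: "sym_gens n S = {}"
  have "addrow_mat n (1::int) 0 1 \<in> SL_int n" using det_addrow_mat[of 0 1 n "1::int"] by (simp add: SL_int_def)
  moreover have "SL_int n = {word_prod n ws | ws. set ws \<subseteq> sym_gens n S}" using gen unfolding generates_SL_def by blast
  ultimately have "addrow_mat n (1::int) 0 1 = word_prod n []" unfolding e by auto
  hence "addrow_mat n (1::int) 0 1 $$ (0,1) = 1\<^sub>m n $$ (0,1)" by (simp add: word_prod_def)
  thus False using n by simp
qed

definition modact :: "int \<Rightarrow> int mat \<Rightarrow> int mat \<Rightarrow> int mat" where
  "modact m t x = mod_mat m (t * x)"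

lemma modact_SLm:
  assumes "m > 0" "t \<in> SL_int n" "x \<in> SLm m n"
  shows "modact m t x \<in> SLm m n"
  unfolding modact_def
proof (rule mod_mat_SLm[OF assms(1)])
  have c: "t \<in> carrier_mat n n" "x \<in> carrier_mat n n" "det t = 1" using assms SLm_carrier by (auto simp: SL_int_def)
  thus "t * x \<in> carrier_mat n n" by simp
  show "m dvd det (t * x) - 1" using det_mult[OF c(1,2)] c(3) assms(3) by (simp add: SLm_def)
qed

lemma modact_inj:
  assumes m: "m > 0" and t: "t \<in> SL_int n"
  shows "inj_on (modact m t) (SLm m n)"
proof (rule inj_onI)
  fix x y assume x: "x \<in> SLm m n" and y: "y \<in> SLm m n" and eq: "modact m t x = modact m t y"
  have c: "t \<in> carrier_mat n n" "x \<in> carrier_mat n n" "y \<in> carrier_mat n n"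
    using t x y SLm_carrier by (auto simp: SL_int_def)
  note adj = adj_inverse[OF t]
  have "mcong m n (t * x) (t * y)" using eq mod_mat_eq_iff[OF m, of "t * x" n "t * y"] c by (simp add: modact_def)
  hence "mcong m n (adj_mat t * (t * x)) (adj_mat t * (t * y))"
    by (rule mcong_mult[OF mcong_refl[OF adj(3)]])
  moreover have "adj_mat t * (t * z) = z" if "z \<in> carrier_mat n n" for z
    using assoc_mult_mat[OF adj(3) c(1) that] adj(2) that by simp
  ultimately have "mcong m n x y" using c by simp
  thus "x = y" using x y reduced_eqI by (auto simp: SLm_def)
qed

lemma foldr_modact:
  assumes m: "m > 0" and ws: "set ws \<subseteq> carrier_mat n n" and x: "x \<in> carrier_mat n n"
  shows "mcong m n (foldr (modact m) ws x) (word_prod n ws * x) \<and>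
    (x \<in> reduced m n \<longrightarrow> foldr (modact m) ws x \<in> reduced m n)"
  using ws
proof (induction ws)
  case Nil
  thus ?case using x by (simp add: word_prod_def mcong_refl)
next
  case (Cons w ws)
  have c: "w \<in> carrier_mat n n" "word_prod n ws \<in> carrier_mat n n" using Cons.prems word_prod_carrier[of ws n] by auto
  have ih: "mcong m n (foldr (modact m) ws x) (word_prod n ws * x)" using Cons by simp
  have fc: "w * foldr (modact m) ws x \<in> carrier_mat n n" using c mcong_carrier(1)[OF ih] by simp
  have f: "foldr (modact m) (w # ws) x = mod_mat m (w * foldr (modact m) ws x)"
    by (simp add: modact_def[of m w])
  have "mcong m n (foldr (modact m) (w # ws) x) (w * foldr (modact m) ws x)"
    unfolding f by (rule mcong_sym[OF mod_mat_cong[OF fc]])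
  also have "mcong m n (w * foldr (modact m) ws x) (w * (word_prod n ws * x))"
    by (rule mcong_mult[OF mcong_refl[OF c(1)] ih])
  also have "w * (word_prod n ws * x) = word_prod n (w # ws) * x"
    using assoc_mult_mat[OF c x] by (simp add: word_prod_def)
  finally have "mcong m n (foldr (modact m) (w # ws) x) (word_prod n (w # ws) * x)" .
  moreover have "foldr (modact m) (w # ws) x \<in> reduced m n" unfolding f by (rule mod_mat_reduced[OF m fc])
  ultimately show ?case by blast
qed

lemma det_adj_mod:
  assumes x: "x \<in> SLm m n"
  shows "m dvd det (adj_mat x) - 1" "mcong m n (adj_mat x * x) (1\<^sub>m n)" "adj_mat x \<in> carrier_mat n n"
proof -
  have xc: "x \<in> carrier_mat n n" by (rule SLm_carrier[OF x])
  have dx: "m dvd det x - 1" using x by (simp add: SLm_def)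
  show ac: "adj_mat x \<in> carrier_mat n n" by (rule adj_mat(1)[OF xc])
  show c1: "mcong m n (adj_mat x * x) (1\<^sub>m n)"
    unfolding adj_mat(3)[OF xc] mcong_def using dx by auto
  have "m dvd det (adj_mat x) * det x - 1" using mcong_det[OF c1] det_mult[OF ac xc] by simp
  moreover have "m dvd det (adj_mat x) * (det x - 1)" using dx by simp
  ultimately have "m dvd (det (adj_mat x) * det x - 1) - det (adj_mat x) * (det x - 1)" by (rule dvd_diff)
  thus "m dvd det (adj_mat x) - 1" by (simp add: algebra_simps)
qed

text \<open>Any two states are joined by a word of even length. Mutually inverse generators
  \<open>t\<close>, \<open>t'\<close> act trivially as a pair, so such pairs fill every word up to
  one common even length \<open>K\<close>.\<close>

lemma modular_mixing:
  assumes gen: "generates_SL n S" and m: "odd m" "m > 0" and n: "n \<ge> 2"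
  shows "\<exists>K>0. \<forall>x\<in>SLm m n. \<forall>y\<in>SLm m n. \<exists>ws\<in>words (sym_gens n S) K. foldr (modact m) ws x = y"
proof -
  define T where "T = sym_gens n S"
  have Tc: "T \<subseteq> carrier_mat n n" using sym_gens_SL[OF gen] by (auto simp: SL_int_def T_def)
  have "\<exists>ws. set ws \<subseteq> T \<and> even (length ws) \<and> foldr (modact m) ws x = y"
    if x: "x \<in> SLm m n" and y: "y \<in> SLm m n" for x y
  proof -
    note ax = det_adj_mod[OF x]
    have xc: "x \<in> carrier_mat n n" and yc: "y \<in> carrier_mat n n" using x y SLm_carrier by auto
    have "m dvd det y * (det (adj_mat x) - 1) + (det y - 1)"
      using ax(1) y by (intro dvd_add) (auto simp: SLm_def)
    hence d: "m dvd det (y * adj_mat x) - 1" by (simp add: det_mult[OF yc ax(3)] algebra_simps)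
    obtain ws where ws: "set ws \<subseteq> T" "even (length ws)" "mcong m n (word_prod n ws) (y * adj_mat x)"
      using even_words[OF gen m(1) _ d] yc ax(3) unfolding T_def by auto
    have wc: "set ws \<subseteq> carrier_mat n n" using ws Tc by auto
    have "mcong m n (foldr (modact m) ws x) (word_prod n ws * x)" using foldr_modact[OF m(2) wc xc] by blast
    also have "mcong m n (word_prod n ws * x) (y * adj_mat x * x)" by (rule mcong_mult[OF ws(3) mcong_refl[OF xc]])
    also have "y * adj_mat x * x = y * (adj_mat x * x)" by (rule assoc_mult_mat[OF yc ax(3) xc])
    also have "mcong m n (y * (adj_mat x * x)) (y * 1\<^sub>m n)" by (rule mcong_mult[OF mcong_refl[OF yc] ax(2)])
    also have "y * 1\<^sub>m n = y" using yc by simp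
    finally have "foldr (modact m) ws x = y"
      using foldr_modact[OF m(2) wc xc] x y reduced_eqI by (auto simp: SLm_def)
    thus ?thesis using ws by blast
  qed
  then obtain w where w: "\<And>x y. x \<in> SLm m n \<Longrightarrow> y \<in> SLm m n \<Longrightarrow>
    set (w x y) \<subseteq> T \<and> even (length (w x y)) \<and> foldr (modact m) (w x y) x = y" by metis
  define K where "K = 2 * (1 + (\<Sum>x\<in>SLm m n. \<Sum>y\<in>SLm m n. length (w x y)))"
  obtain t where t: "t \<in> T" using sym_gens_nonempty[OF gen n] by (auto simp: T_def)
  then obtain t' where t': "t' \<in> T" "t * t' = 1\<^sub>m n" using sym_gens_inverse[OF gen] unfolding T_def by blast
  have pad: "foldr (modact m) (concat (replicate j [t,t'])) y = y" if y: "y \<in> SLm m n" for y j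
  proof (induction j)
    case (Suc j)
    have yc: "y \<in> carrier_mat n n" using y SLm_carrier by auto
    have tc: "t \<in> carrier_mat n n" "t' \<in> carrier_mat n n" using t t' Tc by auto
    have "mcong m n (foldr (modact m) [t,t'] y) (word_prod n [t,t'] * y)"
      using foldr_modact[OF m(2) _ yc, of "[t,t']"] tc by simp
    also have "word_prod n [t,t'] * y = y" using t'(2) tc yc by (simp add: word_prod_def)
    finally have "foldr (modact m) [t,t'] y = y"
      using foldr_modact[OF m(2) _ yc, of "[t,t']"] tc y reduced_eqI by (auto simp: SLm_def)
    thus ?case using Suc by simp
  qed simp
  have "\<exists>ws\<in>words T K. foldr (modact m) ws x = y" if x: "x \<in> SLm m n" and y: "y \<in> SLm m n" for x y
  proof -
    have "length (w x y) \<le> (\<Sum>y\<in>SLm m n. length (w x y))"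
      using finite_SLm y by (intro member_le_sum) auto
    also have "\<dots> \<le> (\<Sum>x\<in>SLm m n. \<Sum>y\<in>SLm m n. length (w x y))"
      using finite_SLm x by (intro member_le_sum) auto
    finally have "length (w x y) \<le> K" by (simp add: K_def)
    moreover have "even K" by (simp add: K_def)
    ultimately have "even (K - length (w x y))" using w[OF x y] by simp
    then obtain j where j: "K - length (w x y) = 2 * j" by (elim evenE)
    define ws where "ws = concat (replicate j [t,t']) @ w x y"
    have "length ws = K" using j \<open>length (w x y) \<le> K\<close> by (simp add: ws_def length_concat sum_list_replicate)
    moreover have "set ws \<subseteq> T" using t t' w[OF x y] by (auto simp: ws_def)
    moreover have "foldr (modact m) ws x = y" using w[OF x y] pad[OF y, of j] by (simp add: ws_def)
    ultimately show ?thesis by (intro bexI[of _ ws]) (auto simp: words_def)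
  qed
  moreover have "K > 0" by (simp add: K_def)
  ultimately show ?thesis unfolding T_def by blast
qed

theorem words_equidistributed:
  assumes gen: "generates_SL n S" and fin: "finite S" and n: "n \<ge> 2" and m: "odd m" "m > 0" and B: "B \<subseteq> SLm m n"
  shows "(\<lambda>L. real (card {ws \<in> words (sym_gens n S) L. mod_mat m (word_prod n ws) \<in> B}) / real (card (words (sym_gens n S) L)))
    \<longlonglongrightarrow> real (card B) / real (card (SLm m n))"
proof -
  let ?T = "sym_gens n S"
  obtain K where K: "K > 0" "\<forall>x\<in>SLm m n. \<forall>y\<in>SLm m n. \<exists>ws\<in>words ?T K. foldr (modact m) ws x = y"
    using modular_mixing[OF gen m n] by blast
  have TSL: "?T \<subseteq> SL_int n" by (rule sym_gens_SL[OF gen])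
  have finT: "finite ?T" by (rule finite_sym_gens[OF fin gen])
  interpret finite_walk ?T "SLm m n" "modact m" K
  proof
    show "finite ?T" by (rule finT)
    show "?T \<noteq> {}" by (rule sym_gens_nonempty[OF gen n])
    show "finite (SLm m n)" by (rule finite_SLm)
    show "SLm m n \<noteq> {}" using one_SLm[OF m(2)] by blast
    show "K > 0" by (rule K(1))
    show "\<exists>ws\<in>words ?T K. foldr (modact m) ws x = y" if "x \<in> SLm m n" "y \<in> SLm m n" for x y using K that by blast
    show "bij_betw (modact m t) (SLm m n) (SLm m n)" if "t \<in> ?T" for t
    proof -
      have t: "t \<in> SL_int n" using that TSL by blast
      have "modact m t ` SLm m n \<subseteq> SLm m n" using modact_SLm[OF m(2) t] by blast
      thus ?thesis using modact_inj[OF m(2) t] endo_inj_surj[OF finite_SLm] by (auto simp: bij_betw_def)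
    qed
  qed
  define h :: "int mat \<Rightarrow> real" where "h = (\<lambda>x. if x \<in> B then 1 else 0)"
  define x0 where "x0 = mod_mat m (1\<^sub>m n)"
  have x0: "x0 \<in> SLm m n" unfolding x0_def by (rule one_SLm[OF m(2)])
  have eq: "foldr (modact m) ws x0 = mod_mat m (word_prod n ws)" if "ws \<in> words ?T L" for ws L
  proof -
    have wc: "set ws \<subseteq> carrier_mat n n" using that TSL by (auto simp: words_def SL_int_def)
    have xc: "x0 \<in> carrier_mat n n" using x0 SLm_carrier by blast
    note pc = word_prod_carrier[OF wc]
    have "mcong m n (foldr (modact m) ws x0) (word_prod n ws * x0)" using foldr_modact[OF m(2) wc xc] by blast
    also have "mcong m n (word_prod n ws * x0) (word_prod n ws * 1\<^sub>m n)"
      unfolding x0_def by (rule mcong_mult[OF mcong_refl[OF pc] mcong_sym[OF mod_mat_cong]]) simp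
    also have "word_prod n ws * 1\<^sub>m n = word_prod n ws" using pc by simp
    also have "mcong m n (word_prod n ws) (mod_mat m (word_prod n ws))" by (rule mod_mat_cong[OF pc])
    finally show ?thesis
      using foldr_modact[OF m(2) wc xc] x0 mod_mat_reduced[OF m(2) pc] reduced_eqI by (auto simp: SLm_def)
  qed
  have "avg L h x0 = real (card {ws \<in> words ?T L. mod_mat m (word_prod n ws) \<in> B}) / real (card (words ?T L))" for L
  proof -
    have "(\<Sum>ws\<in>words ?T L. h (foldr (modact m) ws x0)) = (\<Sum>ws\<in>words ?T L. if mod_mat m (word_prod n ws) \<in> B then 1 else 0)"
      by (rule sum.cong) (auto simp: eq h_def)
    also have "\<dots> = real (card {ws \<in> words ?T L. mod_mat m (word_prod n ws) \<in> B})"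
      using finite_words[OF finT] by (simp add: sum.If_cases Int_def)
    finally show ?thesis by (simp add: avg_def card_words[OF finT])
  qed
  moreover have "(\<Sum>x\<in>SLm m n. h x) = real (card B)"
    using B finite_SLm by (simp add: h_def sum.If_cases Int_absorb1)
  ultimately show ?thesis using equidistribution[OF x0, of h] by simp
qed

section \<open>Almost all words have full Galois group\<close>

text \<open>One ideal is fixed for each \<open>l\<close>, since the polynomial belonging to given
  exponents depends on it.\<close>

definition place :: "nat \<Rightarrow> complex set" where
  "place l = (SOME P. prime_above l P)"

lemma place: "prime l \<Longrightarrow> prime_above l (place l)"
  unfolding place_def by (rule someI_ex) (rule exists_prime_above)

definition pattern_class :: "nat \<Rightarrow> nat \<Rightarrow> nat \<Rightarrow> nat list set \<Rightarrow> int mat set" where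
  "pattern_class l N n C = (\<Union>xs\<in>C. charclass (int l) N (prime_above.redpoly l (place l) N n ((!) xs)))"

text \<open>The factor \<open>2 ^ N\<close> pays for replacing \<open>(l + 1) div 2\<close> and
  \<open>l - 1\<close> by \<open>l / 2\<close>, and \<open>N ^ N\<close> bounds the number of
  exponent lists with the same polynomial.\<close>

definition density :: "nat \<Rightarrow> real" where "density N = 1 / (2 ^ N * real N ^ N)"

lemma density_bounds: "N \<ge> 1 \<Longrightarrow> 0 < density N \<and> density N \<le> 1"
proof -
  assume N: "N \<ge> 1"
  have "1 \<le> (2::real) ^ N * real N ^ N" using N mult_mono[of 1 "(2::real) ^ N" 1 "real N ^ N"] by simp
  thus ?thesis using N by (simp add: density_def)
qed

lemma pattern_class_subset: "pattern_class l N n C \<subseteq> SLm (int l) N"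
  by (auto simp: pattern_class_def charclass_def)

text \<open>At least \<open>card C / N ^ N\<close> polynomials occur, each with a class of at least
  a fraction \<open>(l - 1) / l ^ N\<close>. As \<open>card C\<close> is at least
  \<open>(l / 2) ^ (N - 1)\<close>, the powers of \<open>l\<close> cancel.\<close>

lemma card_pattern_class:
  assumes l: "prime l" "odd l" and N: "N \<ge> 1"
    and C: "finite C" "\<And>xs. xs \<in> C \<Longrightarrow> length xs = N \<and> admissible l N n \<pi> ((!) xs)"
    and cC: "((l + 1) div 2) ^ (N - 1) \<le> card C"
  shows "density N * real (card (SLm (int l) N)) \<le> real (card (pattern_class l N n C))"
proof -
  interpret prime_above l "place l" by (rule place[OF l(1)])
  define F where "F = (\<lambda>xs. redpoly N n ((!) xs)) ` C"
  have U: "pattern_class l N n C = (\<Union>f\<in>F. charclass (int l) N f)" by (simp add: pattern_class_def F_def)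
  define s where "s = card (SLm (int l) N)"
  define u where "u = card (pattern_class l N n C)"
  have 1: "card C \<le> card F * N ^ N" unfolding F_def by (rule card_redpolys[OF C])
  have 2: "card F * ((l - 1) * s) \<le> u * l ^ N"
    unfolding s_def u_def U
  proof (rule card_charclasses[OF l(1)])
    show "N > 0" using N by simp
    show "finite F" using C(1) by (simp add: F_def)
    fix f assume "f \<in> F"
    then obtain xs where xs: "xs \<in> C" "f = redpoly N n ((!) xs)" by (auto simp: F_def)
    have adm: "admissible l N n \<pi> ((!) xs)" using C(2)[OF xs(1)] by blast
    show "degree f = N \<and> lead_coeff f = 1 \<and> int l dvd coeff f 0 - (- 1) ^ N"
      unfolding xs(2) using degree_redpoly[OF adm] coeff_redpoly_top[OF adm] coeff_redpoly_0[OF adm] by simp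
    show "0 \<le> coeff f k \<and> coeff f k < int l" for k
    proof (cases "k \<le> N")
      case True thus ?thesis unfolding xs(2) using coeff_redpoly[OF adm True] by simp
    next
      case False thus ?thesis unfolding xs(2) using l_pos by (simp add: coeff_redpoly_gt)
    qed
  qed
  have l0: "l > 0" using l(1) prime_gt_0_nat by blast
  have l2: "l \<ge> 2" using l(1) by (rule prime_ge_2_nat)
  have h: "real l / 2 \<le> real ((l + 1) div 2)" by linarith
  have "(real l / 2) ^ N * real s = (real l / 2) * (real l / 2) ^ (N - 1) * real s"
    using N by (cases N) auto
  also have "\<dots> \<le> real (l - 1) * real ((l + 1) div 2) ^ (N - 1) * real s"
    using h l2 by (intro mult_right_mono mult_mono power_mono) auto
  also have "real ((l + 1) div 2) ^ (N - 1) \<le> real (card C)" using cC by (metis of_nat_le_iff of_nat_power)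
  hence "real (l - 1) * real ((l + 1) div 2) ^ (N - 1) * real s \<le> real (l - 1) * real (card C) * real s"
    by (intro mult_right_mono mult_left_mono) auto
  also have "\<dots> = real ((l - 1) * card C * s)" by simp
  also have "(l - 1) * card C * s \<le> (l - 1) * (card F * N ^ N) * s"
    using 1 by (intro mult_le_mono mult_le_mono2) auto
  hence "real ((l - 1) * card C * s) \<le> real ((l - 1) * (card F * N ^ N) * s)" by (simp only: of_nat_le_iff)
  also have "(l - 1) * (card F * N ^ N) * s = N ^ N * (card F * ((l - 1) * s))" by (simp add: mult_ac)
  also have "real \<dots> \<le> real (N ^ N * (u * l ^ N))" using 2 by (simp only: of_nat_le_iff mult_le_mono2)
  finally have "(real l / 2) ^ N * real s \<le> real (N ^ N * (u * l ^ N))" .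
  hence "real l ^ N * (real s / 2 ^ N) \<le> real l ^ N * (real N ^ N * real u)" by (simp add: power_divide mult_ac)
  moreover have "real l ^ N > 0" using l0 by simp
  ultimately have "real s / 2 ^ N \<le> real N ^ N * real u" by (simp only: mult_le_cancel_left_pos)
  hence "density N * real s \<le> real u" using N by (simp add: density_def field_simps)
  thus ?thesis by (simp add: s_def u_def)
qed

lemma mod_mat_mod_mat_dvd:
  assumes "l > 0" "m > 0" "l dvd m" "A \<in> carrier_mat n n"
  shows "mod_mat l (mod_mat m A) = mod_mat l A"
  using assms by (intro eq_matI) (auto simp: mod_mat_def mod_mod_cancel)

text \<open>By \<open>SLm_crt\<close> a matrix that is bad for all primes splits into a residue that
  is bad for \<open>Q\<close> and a residue modulo \<open>l\<close> outside \<open>G l\<close>, so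
  each prime contributes a factor \<open>1 - \<kappa>\<close>.\<close>

lemma card_bad_product:
  fixes \<kappa> :: real
  assumes "finite Q" and Q: "\<And>l. l \<in> Q \<Longrightarrow> prime l \<and> \<kappa> * real (card (SLm (int l) n)) \<le> real (card (G l)) \<and> G l \<subseteq> SLm (int l) n"
    and \<kappa>: "0 \<le> \<kappa>" "\<kappa> \<le> 1"
  shows "real (card {A \<in> SLm (\<Prod>l\<in>Q. int l) n. \<forall>l\<in>Q. mod_mat (int l) A \<notin> G l})
     \<le> (1 - \<kappa>) ^ card Q * real (card (SLm (\<Prod>l\<in>Q. int l) n))"
  using assms(1) Q
proof (induction Q rule: finite_induct)
  case empty
  thus ?case by simp
next
  case (insert l Q)
  define m where "m = (\<Prod>l\<in>Q. int l)"
  have pl: "prime l" using insert.prems by blast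
  have mpos: "m > 0" unfolding m_def using insert.prems prime_gt_0_nat by (intro prod_pos) auto
  have lpos: "int l > 0" using pl prime_gt_0_nat by simp
  have cop: "coprime m (int l)"
    unfolding m_def
  proof (rule prod_coprime_left)
    fix q assume q: "q \<in> Q"
    hence "prime q" "q \<noteq> l" using insert by auto
    thus "coprime (int q) (int l)" using pl by (simp add: primes_coprime)
  qed
  have ml: "(\<Prod>q\<in>insert l Q. int q) = m * int l" using insert by (simp add: m_def mult.commute)
  define B where "B = {A \<in> SLm m n. \<forall>q\<in>Q. mod_mat (int q) A \<notin> G q}"
  define B' where "B' = {A \<in> SLm (m * int l) n. \<forall>q\<in>insert l Q. mod_mat (int q) A \<notin> G q}"
  note bij = SLm_crt[OF cop mpos lpos, of n]
  have "(\<lambda>A. (mod_mat m A, mod_mat (int l) A)) ` B' \<subseteq> B \<times> (SLm (int l) n - G l)"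
  proof
    fix x assume "x \<in> (\<lambda>A. (mod_mat m A, mod_mat (int l) A)) ` B'"
    then obtain A where A: "A \<in> B'" "x = (mod_mat m A, mod_mat (int l) A)" by blast
    hence AS: "A \<in> SLm (m * int l) n" by (simp add: B'_def)
    hence im: "(mod_mat m A, mod_mat (int l) A) \<in> SLm m n \<times> SLm (int l) n" using bij by (auto simp: bij_betw_def)
    have "mod_mat (int q) (mod_mat m A) \<notin> G q" if q: "q \<in> Q" for q
    proof -
      have "int q dvd m" unfolding m_def using q insert.hyps(1) by (rule dvd_prodI[rotated])
      moreover have "int q > 0" using q insert.prems prime_gt_0_nat by simp
      ultimately have "mod_mat (int q) (mod_mat m A) = mod_mat (int q) A" using mod_mat_mod_mat_dvd mpos SLm_carrier[OF AS] by blast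
      thus ?thesis using A(1) q by (simp add: B'_def)
    qed
    thus "x \<in> B \<times> (SLm (int l) n - G l)" using im A by (auto simp: B_def B'_def)
  qed
  moreover have "inj_on (\<lambda>A. (mod_mat m A, mod_mat (int l) A)) B'"
    using bij by (rule inj_on_subset[OF bij_betw_imp_inj_on]) (auto simp: B'_def)
  ultimately have "card B' \<le> card (B \<times> (SLm (int l) n - G l))"
    using finite_SLm by (intro card_inj_on_le) (auto simp: B_def)
  also have "\<dots> = card B * (card (SLm (int l) n) - card (G l))"
  proof -
    have sub: "G l \<subseteq> SLm (int l) n" using insert.prems by blast
    show ?thesis unfolding card_cartesian_product card_Diff_subset[OF finite_subset[OF sub finite_SLm] sub] ..
  qed
  finally have "real (card B') \<le> real (card B) * real (card (SLm (int l) n) - card (G l))"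
    by (metis of_nat_le_iff of_nat_mult)
  also have "real (card (SLm (int l) n) - card (G l)) = real (card (SLm (int l) n)) - real (card (G l))"
    using insert.prems finite_SLm by (intro of_nat_diff card_mono) auto
  also have "real (card B) * (real (card (SLm (int l) n)) - real (card (G l)))
      \<le> ((1 - \<kappa>) ^ card Q * real (card (SLm m n))) * ((1 - \<kappa>) * real (card (SLm (int l) n)))"
  proof (rule mult_mono)
    show "real (card B) \<le> (1 - \<kappa>) ^ card Q * real (card (SLm m n))"
      using insert.IH insert.prems unfolding B_def m_def by blast
    show "real (card (SLm (int l) n)) - real (card (G l)) \<le> (1 - \<kappa>) * real (card (SLm (int l) n))"
      using insert.prems[of l] by (simp add: algebra_simps)
    show "0 \<le> (1 - \<kappa>) ^ card Q * real (card (SLm m n))" using \<kappa> by simp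
    have "card (G l) \<le> card (SLm (int l) n)" using insert.prems finite_SLm by (intro card_mono) auto
    thus "0 \<le> real (card (SLm (int l) n)) - real (card (G l))" by simp
  qed
  also have "\<dots> = (1 - \<kappa>) ^ card (insert l Q) * (real (card (SLm m n)) * real (card (SLm (int l) n)))"
    using insert.hyps by simp
  also have "real (card (SLm m n)) * real (card (SLm (int l) n)) = real (card (SLm (m * int l) n))"
    using bij_betw_same_card[OF bij] by (simp add: card_cartesian_product)
  finally show ?case unfolding ml B'_def .
qed

definition cycle_class :: "nat \<Rightarrow> nat \<Rightarrow> int mat set" where
  "cycle_class N l = pattern_class l N (l ^ (N - 1) - 1) (cycle_exponents l (N - 1) ` cycle_params l (N - 1))"

definition transp_class :: "nat \<Rightarrow> nat \<Rightarrow> int mat set" where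
  "transp_class N l = pattern_class l N (l\<^sup>2 - 1) (transp_set l (N - 2))"

lemma cycle_exponents_pattern:
  assumes "odd l" "l \<ge> 3" "N \<ge> 3" "xs \<in> cycle_exponents l (N - 1) ` cycle_params l (N - 1)"
  shows "length xs = N \<and> admissible l N (l ^ (N - 1) - 1) (fix0_cycle N) ((!) xs)"
proof -
  obtain c where c: "c \<in> cycle_params l (N - 1)" "xs = cycle_exponents l (N - 1) c" using assms(4) by blast
  have "N - 1 \<ge> 2" "Suc (N - 1) = N" using assms(3) by auto
  thus ?thesis using admissible_cycle_exponents[OF assms(1,2) _ c(1)] c(2) by (simp add: cycle_exponents_def)
qed

lemma transp_set_pattern:
  assumes "odd l" "l \<ge> 3" "N \<ge> 2" "xs \<in> transp_set l (N - 2)"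
  shows "length xs = N \<and> admissible l N (l\<^sup>2 - 1) (Transposition.transpose 0 1) ((!) xs)"
    and "i < N \<Longrightarrow> xs ! i \<noteq> 0 \<and> 2 * xs ! i \<noteq> l\<^sup>2 - 1"
proof -
  obtain as x where x: "as \<in> transp_slots l (N - 2)" "x \<in> transp_params l as" "xs = transp_exponents l as x"
    using assms(4) by (auto simp: transp_set_def)
  have N: "N - 2 + 2 = N" using assms(3) by simp
  have "length xs = N" using x(1,3) N by (simp add: transp_exponents_def transp_slots_def)
  thus "length xs = N \<and> admissible l N (l\<^sup>2 - 1) (Transposition.transpose 0 1) ((!) xs)"
    using transp_exponents_props(1)[OF assms(1,2) x(1,2)] unfolding N x(3) by blast
  show "i < N \<Longrightarrow> xs ! i \<noteq> 0 \<and> 2 * xs ! i \<noteq> l\<^sup>2 - 1"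
    using transp_exponents_props(2)[OF assms(1,2) x(1,2), of i] unfolding N x(3) by blast
qed

lemma card_cycle_class:
  assumes l: "prime l" "l \<ge> 2 * (N + 3)" and N: "N \<ge> 3"
  shows "density N * real (card (SLm (int l) N)) \<le> real (card (cycle_class N l))"
proof -
  have odd: "odd l" using prime_odd_nat[OF l(1)] l(2) by simp
  show ?thesis unfolding cycle_class_def
  proof (rule card_pattern_class[OF l(1) odd])
    show "N \<ge> 1" using N by simp
    have "finite (cycle_params l (N - 1))"
      by (rule finite_subset[of _ "{..<l ^ (N - 1) - 1}"]) (auto simp: cycle_params_def)
    thus "finite (cycle_exponents l (N - 1) ` cycle_params l (N - 1))" by simp
    show "length xs = N \<and> admissible l N (l ^ (N - 1) - 1) (fix0_cycle N) ((!) xs)"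
      if "xs \<in> cycle_exponents l (N - 1) ` cycle_params l (N - 1)" for xs
      using cycle_exponents_pattern[OF odd _ N that] l(2) by simp
    show "((l + 1) div 2) ^ (N - 1) \<le> card (cycle_exponents l (N - 1) ` cycle_params l (N - 1))"
      by (rule cycle_exponents_count[OF odd l(2) N])
  qed
qed

lemma card_transp_class:
  assumes l: "prime l" "l \<ge> 2 * (N + 3)" and N: "N \<ge> 2"
  shows "density N * real (card (SLm (int l) N)) \<le> real (card (transp_class N l))"
proof -
  have odd: "odd l" using prime_odd_nat[OF l(1)] l(2) by simp
  show ?thesis unfolding transp_class_def
  proof (rule card_pattern_class[OF l(1) odd])
    show "N \<ge> 1" using N by simp
    show "finite (transp_set l (N - 2))" by (rule finite_transp_set)
    show "length xs = N \<and> admissible l N (l\<^sup>2 - 1) (Transposition.transpose 0 1) ((!) xs)"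
      if "xs \<in> transp_set l (N - 2)" for xs
      using transp_set_pattern(1)[OF odd _ N that] l(2) by simp
    \<comment> \<open>The bound \<open>2 * (N + 3)\<close> is the \<open>2 * (k + 5)\<close> of
      \<open>card_transp_set\<close> for \<open>k = N - 2\<close>.\<close>
    have "((l + 1) div 2) ^ (N - 2 + 1) \<le> card (transp_set l (N - 2))"
      by (rule card_transp_set[OF odd]) (use l(2) N in simp)
    moreover have "N - 2 + 1 = N - 1" using N by simp
    ultimately show "((l + 1) div 2) ^ (N - 1) \<le> card (transp_set l (N - 2))" by (simp only:)
  qed
qed

lemma char_poly_roots:
  assumes A: "A \<in> carrier_mat n n"
  obtains a where "int_roots n a (char_poly A)"
proof -
  have "map_mat of_int A \<in> carrier_mat n n" using A by simp
  from char_poly_factorized[OF this] obtain as :: "complex list" where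
    as: "char_poly (map_mat of_int A) = (\<Prod>a\<leftarrow>as. [:- a, 1:])" "length as = n" by blast
  have "(\<Prod>a\<leftarrow>as. [:- a, 1:]) = (\<Prod>i<n. [:- (as ! i), 1:])"
    using as(2) by (simp add: prod.list_conv_set_nth atLeast0LessThan)
  hence "of_int_poly (char_poly A) = (\<Prod>i<n. [:- (as ! i), 1:])"
    using as(1) of_int_hom.char_poly_hom[OF A, where 'a = complex] by simp
  hence "int_roots n ((!) as) (char_poly A)" by unfold_locales
  thus ?thesis by (rule that)
qed

lemma pattern_class_roots_mod:
  assumes l: "prime l" and A: "A \<in> carrier_mat N N" and r: "int_roots N a (char_poly A)"
    and B: "mod_mat (int l) A \<in> pattern_class l N n C"
    and C: "\<And>xs. xs \<in> C \<Longrightarrow> admissible l N n \<pi> ((!) xs)"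
  obtains xs where "xs \<in> C" "int_roots_mod N a (char_poly A) l (place l) n \<pi> ((!) xs)"
proof -
  interpret prime_above l "place l" by (rule place[OF l])
  obtain xs where xs: "xs \<in> C" "mod_mat (int l) A \<in> charclass (int l) N (redpoly N n ((!) xs))"
    using B by (auto simp: pattern_class_def)
  have "int l dvd coeff (char_poly A) k - coeff (redpoly N n ((!) xs)) k" for k
  proof -
    have "int l dvd (coeff (char_poly A) k - coeff (char_poly (mod_mat (int l) A)) k)
        + (coeff (char_poly (mod_mat (int l) A)) k - coeff (redpoly N n ((!) xs)) k)"
      by (rule dvd_add[OF mcong_char_poly[OF mod_mat_cong[OF A]]]) (use xs(2) in \<open>simp add: charclass_def\<close>)
    thus ?thesis by simp
  qed
  hence "int_roots_mod N a (char_poly A) l (place l) n \<pi> ((!) xs)"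
    using r C[OF xs(1)] prime_above_axioms
    by (simp add: int_roots_mod_def int_roots_mod_axioms_def)
  thus ?thesis by (rule that[OF xs(1)])
qed

text \<open>The two primes may differ: both Frobenius elements permute the same list
  \<open>a\<close> of complex roots, so they can be combined inside one \<open>Gal\<close>.\<close>

theorem galois_full_symmetric_criterion:
  assumes N: "N \<ge> 2" and A: "A \<in> carrier_mat N N" "det A = 1"
    and l2: "prime l2" "l2 \<ge> 3" "odd l2" "mod_mat (int l2) A \<in> transp_class N l2"
    and l1: "N \<ge> 3 \<Longrightarrow> prime l1 \<and> l1 \<ge> 3 \<and> odd l1 \<and> mod_mat (int l1) A \<in> cycle_class N l1"
  shows "galois_full_symmetric (char_poly A)"
proof -
  obtain a where a: "int_roots N a (char_poly A)" by (rule char_poly_roots[OF A(1)])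
  obtain xs where xs: "xs \<in> transp_set l2 (N - 2)"
    "int_roots_mod N a (char_poly A) l2 (place l2) (l2\<^sup>2 - 1) (Transposition.transpose 0 1) ((!) xs)"
    using pattern_class_roots_mod[OF l2(1) A(1) a l2(4)[unfolded transp_class_def]]
      transp_set_pattern(1)[OF l2(3,2) N] by metis
  interpret M2: int_roots_mod N a "char_poly A" l2 "place l2" "l2\<^sup>2 - 1" "Transposition.transpose 0 1" "(!) xs"
    by (rule xs(2))
  interpret int_roots_inj N a "char_poly A"
    by unfold_locales (rule M2.roots_inj)
  obtain s2 r2 where s2: "s2 \<in> Gal" "r2 permutes {..<N}" "\<forall>i<N. s2 (r2 i) = r2 (Transposition.transpose 0 1 i)"
    using M2.cycle_type by blast
  have units: "a i \<noteq> 1 \<and> a i \<noteq> -1" if "i < N" for i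
    by (rule M2.roots_not_unit[OF transp_set_pattern(2)[OF l2(3,2) N xs(1)] that])
  have c0: "coeff (char_poly A) 0 = 1 \<or> coeff (char_poly A) 0 = -1"
    using coeff_char_poly_0[OF A(1)] A(2) by (cases "even N") auto
  have "\<exists>s1 r1. N \<ge> 3 \<longrightarrow> s1 \<in> Gal \<and> r1 permutes {..<N} \<and> (\<forall>i<N. s1 (r1 i) = r1 (fix0_cycle N i))"
  proof (cases "N \<ge> 3")
    case True
    note l1 = l1[OF True]
    obtain ys where ys: "int_roots_mod N a (char_poly A) l1 (place l1) (l1 ^ (N - 1) - 1) (fix0_cycle N) ((!) ys)"
      using pattern_class_roots_mod[of l1 A N a "l1 ^ (N - 1) - 1" "cycle_exponents l1 (N - 1) ` cycle_params l1 (N - 1)" "fix0_cycle N"]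
        l1 A(1) a cycle_exponents_pattern[of l1 N] True unfolding cycle_class_def by metis
    show ?thesis using int_roots_mod.cycle_type[OF ys] by blast
  qed blast
  then obtain s1 r1 where s1: "N \<ge> 3 \<Longrightarrow> s1 \<in> Gal \<and> r1 permutes {..<N} \<and> (\<forall>i<N. s1 (r1 i) = r1 (fix0_cycle N i))" by blast
  have "Gal = Perms"
    by (rule Gal_full[OF N c0 units s2(1,2) s2(3)[rule_format] s1])
  thus ?thesis by (rule galois_full_symmetricI)
qed

theorem theorem8p1:
  fixes N :: nat and S :: "int mat set"
  assumes "N \<ge> 2" and "finite S" and "generates_SL N S"
  shows "(\<lambda>L. real (card {ws \<in> words (sym_gens N S) L.
                        galois_full_symmetric (char_poly (word_prod N ws))})
             / real (card (words (sym_gens N S) L))) \<longlonglongrightarrow> 1"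
proof (rule LIMSEQ_I)
  fix r :: real assume r: "r > 0"
  let ?T = "sym_gens N S"
  let ?good = "\<lambda>ws. galois_full_symmetric (char_poly (word_prod N ws))"
  have finT: "finite ?T" by (rule finite_sym_gens[OF assms(2,3)])
  have T_ne: "?T \<noteq> {}" by (rule sym_gens_nonempty[OF assms(3,1)])
  have TSL: "?T \<subseteq> SL_int N" by (rule sym_gens_SL[OF assms(3)])
  define \<kappa> where "\<kappa> = density N"
  have \<kappa>: "0 < \<kappa>" "\<kappa> \<le> 1" using density_bounds[of N] assms(1) by (auto simp: \<kappa>_def)
  have "(\<lambda>k. (1 - \<kappa>) ^ k) \<longlonglongrightarrow> 0" using \<kappa> by (intro LIMSEQ_power_zero) auto
  hence "eventually (\<lambda>k. (1 - \<kappa>) ^ k < r / 4) sequentially" using r by (intro order_tendstoD) auto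
  \<comment> \<open>Each of the two patterns may fail on a fraction
    \<open>(1 - \<kappa>) ^ k\<close>; with less than \<open>r / 4\<close> for each, the total stays
    below \<open>r / 2\<close>.\<close>
  then obtain k where k: "(1 - \<kappa>) ^ k < r / 4" by (auto simp: eventually_sequentially)
  have "infinite {l::nat. prime l \<and> l \<ge> 2 * (N + 3)}"
  proof
    assume "finite {l::nat. prime l \<and> l \<ge> 2 * (N + 3)}"
    hence "finite ({l::nat. prime l \<and> l \<ge> 2 * (N + 3)} \<union> {..<2 * (N + 3)})" by simp
    moreover have "{l::nat. prime l} \<subseteq> {l::nat. prime l \<and> l \<ge> 2 * (N + 3)} \<union> {..<2 * (N + 3)}" by auto
    ultimately show False using primes_infinite finite_subset by blast
  qed
  then obtain Q where Q: "finite Q" "card Q = k" "Q \<subseteq> {l::nat. prime l \<and> l \<ge> 2 * (N + 3)}"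
    using infinite_arbitrarily_large by blast
  have Qp: "prime l" "l \<ge> 2 * (N + 3)" "odd l" "l \<ge> 3" if "l \<in> Q" for l
  proof -
    show "prime l" "l \<ge> 2 * (N + 3)" using Q(3) that by auto
    thus "odd l" "l \<ge> 3" using prime_odd_nat[of l] by auto
  qed
  define m where "m = (\<Prod>l\<in>Q. int l)"
  have mpos: "m > 0" unfolding m_def using Qp(4) by (intro prod_pos) (metis of_nat_0_less_iff less_le_trans zero_less_numeral)
  have modd: "odd m" unfolding m_def using Qp(3) Q(1) by (simp add: even_prod_iff)
  define bad where "bad = (\<lambda>G. {A \<in> SLm m N. \<forall>l\<in>Q. mod_mat (int l) A \<notin> G l})"
  have bad_card: "real (card (bad G)) \<le> (1 - \<kappa>) ^ k * real (card (SLm m N))"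
    if "\<And>l. l \<in> Q \<Longrightarrow> \<kappa> * real (card (SLm (int l) N)) \<le> real (card (G l)) \<and> G l \<subseteq> SLm (int l) N" for G
    unfolding bad_def m_def Q(2)[symmetric]
    by (rule card_bad_product[OF Q(1)]) (use that Qp(1) \<kappa> in auto)
  define B where "B = bad (transp_class N) \<union> (if N \<ge> 3 then bad (cycle_class N) else {})"
  have BS: "B \<subseteq> SLm m N" by (auto simp: B_def bad_def)
  have SLpos: "real (card (SLm m N)) > 0" using one_SLm[OF mpos, of N] finite_SLm[of m N] by (auto simp: card_gt_0_iff)
  have "real (card B) \<le> real (card (bad (transp_class N))) + real (card (if N \<ge> 3 then bad (cycle_class N) else {}))"
    unfolding B_def by (metis card_Un_le of_nat_add of_nat_le_iff)
  also have "real (card (bad (transp_class N))) \<le> (1 - \<kappa>) ^ k * real (card (SLm m N))"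
    by (rule bad_card) (use card_transp_class Qp assms(1) pattern_class_subset in \<open>auto simp: \<kappa>_def transp_class_def\<close>)
  also have "real (card (if N \<ge> 3 then bad (cycle_class N) else {})) \<le> (1 - \<kappa>) ^ k * real (card (SLm m N))"
  proof (cases "N \<ge> 3")
    case True
    have "real (card (bad (cycle_class N))) \<le> (1 - \<kappa>) ^ k * real (card (SLm m N))"
      by (rule bad_card) (use card_cycle_class Qp True pattern_class_subset in \<open>auto simp: \<kappa>_def cycle_class_def\<close>)
    thus ?thesis using True by simp
  qed (use \<kappa> in simp)
  finally have "real (card B) \<le> 2 * (1 - \<kappa>) ^ k * real (card (SLm m N))" by (simp add: mult_ac)
  hence "real (card B) / real (card (SLm m N)) \<le> 2 * (1 - \<kappa>) ^ k" using SLpos by (simp add: field_simps)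
  also have "\<dots> < r / 2" using k by simp
  finally have lim_small: "real (card B) / real (card (SLm m N)) < r" using r by linarith
  have "(\<lambda>L. real (card {ws \<in> words ?T L. mod_mat m (word_prod N ws) \<in> B}) / real (card (words ?T L)))
      \<longlonglongrightarrow> real (card B) / real (card (SLm m N))"
    by (rule words_equidistributed[OF assms(3,2,1) modd mpos BS])
  hence "eventually (\<lambda>L. real (card {ws \<in> words ?T L. mod_mat m (word_prod N ws) \<in> B}) / real (card (words ?T L)) < r) sequentially"
    using lim_small by (rule order_tendstoD(2))
  then obtain L0 where L0: "\<And>L. L \<ge> L0 \<Longrightarrow>
      real (card {ws \<in> words ?T L. mod_mat m (word_prod N ws) \<in> B}) / real (card (words ?T L)) < r"
    by (auto simp: eventually_sequentially)
  \<comment> \<open>A product outside \<open>B\<close> modulo \<open>m\<close> finds in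
    \<open>Q\<close> a prime for each required pattern, so the criterion applies. Thus words without
    full Galois group are counted by \<open>B\<close>.\<close>
  have not_good: "mod_mat m (word_prod N ws) \<in> B" if ws: "ws \<in> words ?T L" and ng: "\<not> ?good ws" for ws L
  proof (rule ccontr)
    assume nB: "mod_mat m (word_prod N ws) \<notin> B"
    define A where "A = word_prod N ws"
    have wT: "set ws \<subseteq> ?T" using ws by (simp add: words_def)
    have AS: "A \<in> carrier_mat N N \<and> det A = 1"
      unfolding A_def using wT
    proof (induction ws)
      case Nil thus ?case by (simp add: word_prod_def)
    next
      case (Cons w ws)
      have w: "w \<in> carrier_mat N N" "det w = 1" using Cons.prems TSL by (auto simp: SL_int_def)
      have "word_prod N (w # ws) = w * word_prod N ws" by (simp add: word_prod_def)
      thus ?case using Cons w det_mult[OF w(1), of "word_prod N ws"] by simp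
    qed
    have "mod_mat m A \<in> SLm m N" using mod_mat_SLm[OF mpos] AS by simp
    moreover have rr: "mod_mat (int l) (mod_mat m A) = mod_mat (int l) A" if "l \<in> Q" for l
    proof -
      have "int l dvd m" unfolding m_def using that Q(1) by (rule dvd_prodI[rotated])
      moreover have "int l > 0" using Qp(4)[OF that] by simp
      ultimately show ?thesis using mod_mat_mod_mat_dvd mpos AS by blast
    qed
    ultimately have 1: "mod_mat m A \<in> bad G" if "\<And>l. l \<in> Q \<Longrightarrow> mod_mat (int l) A \<notin> G l" for G
      using that by (auto simp: bad_def)
    have "mod_mat m A \<notin> bad (transp_class N)" using nB by (auto simp: B_def A_def)
    then obtain l2 where l2: "l2 \<in> Q" "mod_mat (int l2) A \<in> transp_class N l2" using 1 by blast
    have "\<exists>l1. N \<ge> 3 \<longrightarrow> l1 \<in> Q \<and> mod_mat (int l1) A \<in> cycle_class N l1"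
    proof (cases "N \<ge> 3")
      case True
      hence "mod_mat m A \<notin> bad (cycle_class N)" using nB by (auto simp: B_def A_def)
      thus ?thesis using 1 by blast
    qed blast
    then obtain l1 where l1: "N \<ge> 3 \<Longrightarrow> l1 \<in> Q \<and> mod_mat (int l1) A \<in> cycle_class N l1" by blast
    have "galois_full_symmetric (char_poly A)"
      by (rule galois_full_symmetric_criterion[OF assms(1) _ _ _ _ _ l2(2), of l1])
         (use AS l1 l2(1) Qp in auto)
    thus False using ng by (simp add: A_def)
  qed
  show "\<exists>no. \<forall>L\<ge>no. norm (real (card {ws \<in> words ?T L. ?good ws}) / real (card (words ?T L)) - 1) < r"
  proof (intro exI allI impI)
    fix L assume L: "L \<ge> L0"
    let ?W = "words ?T L"
    have finW: "finite ?W" by (rule finite_words[OF finT])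
    have Wpos: "card ?W > 0" using finT T_ne by (simp add: card_words card_gt_0_iff)
    have "card ?W = card {ws \<in> ?W. ?good ws} + card {ws \<in> ?W. \<not> ?good ws}"
      by (subst card_Un_disjoint[symmetric]) (use finW in \<open>auto intro!: arg_cong[of _ _ card]\<close>)
    hence "real (card ?W) = real (card {ws \<in> ?W. ?good ws}) + real (card {ws \<in> ?W. \<not> ?good ws})"
      by (simp only: of_nat_add)
    moreover have "g / w - 1 = - (b / w)" if "w = g + b" "w > 0" for g b w :: real
      using that by (simp add: field_simps)
    moreover have "real (card ?W) > 0" using Wpos by simp
    ultimately have "real (card {ws \<in> ?W. ?good ws}) / real (card ?W) - 1 = - (real (card {ws \<in> ?W. \<not> ?good ws}) / real (card ?W))"
      by blast
    hence "norm (real (card {ws \<in> ?W. ?good ws}) / real (card ?W) - 1) = real (card {ws \<in> ?W. \<not> ?good ws}) / real (card ?W)"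
      by simp
    also have "\<dots> \<le> real (card {ws \<in> ?W. mod_mat m (word_prod N ws) \<in> B}) / real (card ?W)"
    proof (intro divide_right_mono)
      have "{ws \<in> ?W. \<not> ?good ws} \<subseteq> {ws \<in> ?W. mod_mat m (word_prod N ws) \<in> B}" using not_good by blast
      thus "real (card {ws \<in> ?W. \<not> ?good ws}) \<le> real (card {ws \<in> ?W. mod_mat m (word_prod N ws) \<in> B})"
        using finW by (simp add: card_mono)
    qed simp
    also have "\<dots> < r" by (rule L0[OF L])
    finally show "norm (real (card {ws \<in> ?W. ?good ws}) / real (card ?W) - 1) < r" .
  qed
qed

end
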